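(* There exists an absolute constant $c>0$ such that the following holds. Let $A$ be the adjacency matrix generated from a degree corrected block model $(\Theta,B,\psi)$ with $n$ nodes and $K$ communities. Let $P=\mathrm{diag}(\psi)\,\Theta B\Theta^T\,\mathrm{diag}(\psi)$ and assume that $P$ has rank $K$, that its smallest nonzero absolute eigenvalue is at least $\gamma_n>0$, and that its maximum entry is bounded from above by $\alpha_n$, where $\alpha_n\ge\log n/n$. Let $\varepsilon>0$ and let $\hat\Theta$ be the output of spherical $k$-median spectral clustering of $A$ with approximation parameter $\varepsilon$. If $$(2.5+\varepsilon)\frac{\sqrt{Kn\alpha_n}}{\gamma_n}<c\,\frac{n_{\min}}{\sqrt{\sum_{k=1}^K n_k^2\nu_k}},$$ then, with probability at least $1-n^{-1}$, $$L(\hat\Theta,\Theta)\le c^{-1}(2.5+\varepsilon)\sqrt{\sum_{k=1}^K n_k^2\nu_k}\;\frac{\sqrt{K\alpha_n}}{\gamma_n\sqrt n}.$$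
   Context: Membership matrices: $\mathbb M_{n,K}$ is the set of $n\times K$ matrices each of whose rows has exactly one entry $1$ and $K-1$ entries $0$. For $\Theta\in\mathbb M_{n,K}$, the community label $g_i\in\{1,\ldots,K\}$ of node $i$ is defined by $\Theta_{ig_i}=1$; $G_k=\{1\le i\le n: g_i=k\}$, $n_k=|G_k|$, $n_{\min}=\min_k n_k$. Degree corrected block model (DCBM) $(\Theta,B,\psi)$ with $n$ nodes and $K$ communities: $\Theta\in\mathbb M_{n,K}$ with all communities $G_k$ nonempty, $B\in[0,1]^{K\times K}$ symmetric, $\psi\in(0,1]^n$ with $\max_{i\in G_k}\psi_i=1$ for every $k=1,\ldots,K$. The random adjacency matrix $A=(a_{ij})$ has independent entries $a_{ij}\sim\mathrm{Bernoulli}(\psi_i\psi_jB_{g_ig_j})$ for $i<j$, with $a_{ii}=0$ and $a_{ij}=a_{ji}$ for $i>j$. Here $\mathrm{diag}(\psi)$ is the diagonal matrix with diagonal $\psi$. Degree heterogeneity: let $\phi_k\in\mathbb R^n$ agree with $\psi$ on $G_k$ and be zero elsewhere, and set $\tilde\psi_i=\psi_i/\|\phi_k\|$ for $i\in G_k$ (Euclidean norm). Define $\nu_k=n_k^{-2}\sum_{i\in G_k}\tilde\psi_i^{-2}$. Error measure: $L(\hat\Theta,\Theta)=n^{-1}\min_{J\in E_K}\|\hat\Theta J-\Theta\|_0$, where $E_K$ is the set of $K\times K$ permutation matrices and $\|M\|_0$ is the number of nonzero entries of $M$. Spherical $k$-median spectral clustering with approximation parameter $\varepsilon$: (1) let $\hat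 U\in\mathbb R^{n\times K}$ have as columns $K$ orthonormal eigenvectors of $A$ corresponding to the $K$ largest eigenvalues in absolute value; (2) let $I_+=\{i:\|\hat U_{i*}\|>0\}$, where $\hat U_{i*}$ is the $i$th row; (3) let $\hat U'$ be the $|I_+|\times K$ matrix with rows $\hat U_{i*}/\|\hat U_{i*}\|$, $i\in I_+$; (4) let $(\hat\Theta^+,\hat X)\in\mathbb M_{|I_+|,K}\times\mathbb R^{K\times K}$ be any pair with $$\|\hat\Theta^+\hat X-\hat U'\|_{2,1}\le(1+\varepsilon)\min_{\Theta'\in\mathbb M_{|I_+|,K},\,X'\in\mathbb R^{K\times K}}\|\Theta'X'-\hat U'\|_{2,1},$$ where $\|M\|_{2,1}=\sum_i\|M_{i*}\|$ is the sum of Euclidean norms of the rows; (5) output $\hat\Theta\in\mathbb M_{n,K}$ whose $i$th row is the corresponding row of $\hat\Theta^+$ if $i\in I_+$ and is $(1,0,\ldots,0)$ if $i\notin I_+$. *)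

theory Defs
  imports
    "Jordan_Normal_Form.Spectral_Radius"
    "Jordan_Normal_Form.DL_Rank"
    "Jordan_Normal_Form.DL_Submatrix"
    "HOL-Combinatorics.Permutations"
    "HOL-Probability.Product_PMF"
begin

unbundle no vec_syntax
unbundle no inner_syntax
hide_const (open) Finite_Cartesian_Product.mat Finite_Cartesian_Product.row
  Finite_Cartesian_Product.vec Determinants.det
hide_type (open) Finite_Cartesian_Product.vec

text \<open>Nodes are \<open>0, ..., n - 1\<close> and communities are \<open>0, ..., K - 1\<close>.\<close>

definition membership_mats :: "nat \<Rightarrow> nat \<Rightarrow> real mat set" where
  "membership_mats n K =
     {\<Theta> \<in> carrier_mat n K. \<forall>i<n. \<exists>g<K. \<forall>k<K. \<Theta> $$ (i, k) = (if k = g then 1 else 0)}"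

definition label :: "real mat \<Rightarrow> nat \<Rightarrow> nat" where
  "label \<Theta> i = (THE k. k < dim_col \<Theta> \<and> \<Theta> $$ (i, k) = 1)"

definition community :: "real mat \<Rightarrow> nat \<Rightarrow> nat set" where
  "community \<Theta> k = {i. i < dim_row \<Theta> \<and> label \<Theta> i = k}"

definition n_min :: "real mat \<Rightarrow> nat" where
  "n_min \<Theta> = Min ((\<lambda>k. card (community \<Theta> k)) ` {..<dim_col \<Theta>})"

definition dcbm :: "nat \<Rightarrow> nat \<Rightarrow> real mat \<Rightarrow> real mat \<Rightarrow> real vec \<Rightarrow> bool" where
  "dcbm n K \<Theta> B \<psi> \<longleftrightarrow>
     0 < n \<and>
     \<Theta> \<in> membership_mats n K \<and> (\<forall>k<K. community \<Theta> k \<noteq> {}) \<and>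
     B \<in> carrier_mat K K \<and> (\<forall>k<K. \<forall>l<K. 0 \<le> B $$ (k, l) \<and> B $$ (k, l) \<le> 1) \<and>
     transpose_mat B = B \<and>
     \<psi> \<in> carrier_vec n \<and> (\<forall>i<n. 0 < \<psi> $ i \<and> \<psi> $ i \<le> 1) \<and>
     (\<forall>k<K. Max ((\<lambda>i. \<psi> $ i) ` community \<Theta> k) = 1)"

text \<open>
  The law of the random adjacency matrix: independent Bernoulli edge indicators \<open>E (i, j)\<close> for
  \<open>i < j\<close>, extended symmetrically with zero diagonal.  Using the law itself, rather than a random
  matrix on an arbitrary probability space, keeps absolute constants independent of the type of
  the sample space.
\<close>
definition dcbm_adjacency :: "real mat \<Rightarrow> real mat \<Rightarrow> real vec \<Rightarrow> real mat pmf" where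
  "dcbm_adjacency \<Theta> B \<psi> =
     (let n = dim_row \<Theta> in
      map_pmf
        (\<lambda>E. mat n n (\<lambda>(i, j). if i < j then of_bool (E (i, j))
                              else if j < i then of_bool (E (j, i)) else 0))
        (Pi_pmf {(i, j). i < j \<and> j < n} False
          (\<lambda>(i, j). bernoulli_pmf (\<psi> $ i * \<psi> $ j * B $$ (label \<Theta> i, label \<Theta> j)))))"

definition diag_of_vec :: "real vec \<Rightarrow> real mat" where
  "diag_of_vec v = mat_diag (dim_vec v) (\<lambda>i. v $ i)"

definition dcbm_mean :: "real mat \<Rightarrow> real mat \<Rightarrow> real vec \<Rightarrow> real mat" where
  "dcbm_mean \<Theta> B \<psi> = diag_of_vec \<psi> * \<Theta> * B * transpose_mat \<Theta> * diag_of_vec \<psi>"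

definition vec_norm2 :: "real vec \<Rightarrow> real" where
  "vec_norm2 v = L2_set (\<lambda>i. v $ i) {..<dim_vec v}"

definition community_part :: "real mat \<Rightarrow> real vec \<Rightarrow> nat \<Rightarrow> real vec" where
  "community_part \<Theta> \<psi> k = vec (dim_vec \<psi>) (\<lambda>i. if i \<in> community \<Theta> k then \<psi> $ i else 0)"

definition psi_tilde :: "real mat \<Rightarrow> real vec \<Rightarrow> nat \<Rightarrow> real" where
  "psi_tilde \<Theta> \<psi> i = \<psi> $ i / vec_norm2 (community_part \<Theta> \<psi> (label \<Theta> i))"

definition nu :: "real mat \<Rightarrow> real vec \<Rightarrow> nat \<Rightarrow> real" where
  "nu \<Theta> \<psi> k =
     (\<Sum>i\<in>community \<Theta> k. 1 / (psi_tilde \<Theta> \<psi> i)\<^sup>2) / (real (card (community \<Theta> k)))\<^sup>2"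

definition permutation_mats :: "nat \<Rightarrow> real mat set" where
  "permutation_mats K =
     {mat K K (\<lambda>(i, j). if p i = j then 1 else 0) | p. p permutes {..<K}}"

definition nonzero_entries :: "real mat \<Rightarrow> nat" where
  "nonzero_entries M = card {(i, j). i < dim_row M \<and> j < dim_col M \<and> M $$ (i, j) \<noteq> 0}"

definition cluster_error :: "real mat \<Rightarrow> real mat \<Rightarrow> real" where
  "cluster_error \<Theta>' \<Theta> =
     real (Min ((\<lambda>J. nonzero_entries (\<Theta>' * J - \<Theta>)) ` permutation_mats (dim_col \<Theta>)))
       / real (dim_row \<Theta>)"

text \<open>
  The eigenvalues \<open>lam 0, ..., lam (n - 1)\<close> of a full orthonormal eigenbasis are the eigenvalues
  of \<open>A\<close> with multiplicity, so this says that the columns of \<open>U\<close> are orthonormal eigenvectors for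
  the \<open>K\<close> eigenvalues of largest modulus.  Ties and the choice of basis are left open.
\<close>
definition leading_eigenvectors :: "real mat \<Rightarrow> nat \<Rightarrow> real mat \<Rightarrow> bool" where
  "leading_eigenvectors A K U \<longleftrightarrow>
     (let n = dim_row A in
      K \<le> n \<and>
      (\<exists>V lam. V \<in> carrier_mat n n \<and> transpose_mat V * V = 1\<^sub>m n \<and>
         (\<forall>j<n. eigenvector A (col V j) (lam j)) \<and>
         (\<forall>j<K. \<forall>l. K \<le> l \<and> l < n \<longrightarrow> \<bar>lam l\<bar> \<le> \<bar>lam j\<bar>) \<and>
         U = mat n K (\<lambda>(i, j). V $$ (i, j))))"

definition norm21 :: "real mat \<Rightarrow> real" where
  "norm21 M = (\<Sum>i<dim_row M. vec_norm2 (row M i))"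

definition normalize_rows :: "real mat \<Rightarrow> real mat" where
  "normalize_rows M =
     mat (dim_row M) (dim_col M) (\<lambda>(i, j). M $$ (i, j) / vec_norm2 (row M i))"

definition k_median_value :: "nat \<Rightarrow> real mat \<Rightarrow> real" where
  "k_median_value K M =
     (INF (T, X) \<in> membership_mats (dim_row M) K \<times> carrier_mat K (dim_col M). norm21 (T * X - M))"

text \<open>
  The infimum above is attained (finitely many \<open>T\<close>, and for each of them geometric medians as rows
  of \<open>X\<close>), so it is the minimum of the \<open>k\<close>-median objective.

  The output of the algorithm is not unique; the predicate below holds for every
  matrix that some admissible run may return.
\<close>
definition spherical_k_median :: "real \<Rightarrow> nat \<Rightarrow> real mat \<Rightarrow> real mat \<Rightarrow> bool" where
  "spherical_k_median \<epsilon> K A \<Theta>' \<longleftrightarrow>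
     (\<exists>U T X. let n = dim_row A;
                 I = {i. i < n \<and> vec_norm2 (row U i) > 0};
                 U' = normalize_rows (submatrix U I {..<K})
             in leading_eigenvectors A K U \<and>
                T \<in> membership_mats (card I) K \<and> X \<in> carrier_mat K K \<and>
                norm21 (T * X - U') \<le> (1 + \<epsilon>) * k_median_value K U' \<and>
                \<Theta>' \<in> membership_mats n K \<and>
                submatrix \<Theta>' I {..<K} = T \<and>
                (\<forall>i<n. i \<notin> I \<longrightarrow> row \<Theta>' i = unit_vec K 0))"

end

theory Submission
  imports Defs
begin

text \<open>
  With high probability \<open>A\<close> is within \<open>O(\<surd>(n \<alpha>))\<close> of its mean \<open>P\<close> in operator norm.  This holds down
  to \<open>n \<alpha> \<ge> ln n\<close> because the trace moments of order \<open>2 p\<close>, \<open>p \<approx> ln n\<close>, of the centered matrix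
  are dominated by those of an \<open>r \<times> r\<close> matrix with bounded i.i.d. entries, \<open>r \<approx> n \<alpha> + p\<close>
  (the comparison argument of Bandeira and van Handel): both sums run over closed walks
  traversing each edge at least twice, and are compared shape by shape.  The norm of the small
  matrix is controlled by a net.

  Weyl's inequality and a Davis--Kahan argument then place the rows of the leading eigenvectors
  near positive multiples of the rows of a nearly orthogonal \<open>K \<times> K\<close> matrix, the row being
  selected by the community of the node, so that the
  normalised rows concentrate around \<open>K\<close> well separated directions.  A row far from its direction
  contributes a constant to the k-median objective, which bounds the number of bad nodes; if
  there are fewer than \<open>n_min\<close> of them, every community keeps a good node and the labels agree with
  the true ones up to a permutation on all good nodes.
\<close>

section \<open>Norms and powers of symmetric matrices\<close>

text \<open>A net argument cannot be run on the n-dimensional matrix itself: its entries have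
  variance about \<alpha> but size up to 1, and for n \<alpha> near ln n a single bilinear form has
  tails too heavy for a union bound over exp (O(n)) points. The comparison matrix has centered
  entries of unit size, hence sub-Gaussian forms, and its dimension r replaces n \<alpha>, so its
  norm O(sqrt r) has the desired order.

  The smallness hypothesis acts twice. Cauchy-Schwarz in one community bounds \<open>n_min\<close>
  by the heterogeneity term S, so the perturbation is a small fraction of the gap \<gamma>;
  multiplied by S, the same hypothesis keeps the number of bad nodes below \<open>n_min\<close>.

  In the factor 2.5 + \<epsilon>, an approximate median loses 2 + \<epsilon> by the triangle
  inequality, and 0.5 pays for nodes with zero row. Two mismatches are repaired separately: P has a
  diagonal while A has none, which costs at most \<alpha> \<le> sqrt (n \<alpha>) in norm, and
  \<alpha> may exceed 1, where it is truncated because the entries of P are at most 1.\<close>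

definition mat_app :: "nat \<Rightarrow> (nat \<Rightarrow> nat \<Rightarrow> real) \<Rightarrow> (nat \<Rightarrow> real) \<Rightarrow> nat \<Rightarrow> real" where
  "mat_app n a x i = (\<Sum>j<n. a i j * x j)"

text \<open>Matrices are plain functions with the dimension passed separately. Entries outside the
  range never enter the sums, so symmetry can be assumed for all indices without side
  conditions.\<close>

fun fpow :: "nat \<Rightarrow> (nat \<Rightarrow> nat \<Rightarrow> real) \<Rightarrow> nat \<Rightarrow> nat \<Rightarrow> nat \<Rightarrow> real" where
  "fpow n a 0 i j = of_bool (i = j)"
| "fpow n a (Suc k) i j = (\<Sum>l<n. a i l * fpow n a k l j)"

definition frob2 :: "nat \<Rightarrow> (nat \<Rightarrow> nat \<Rightarrow> real) \<Rightarrow> real" where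
  "frob2 n a = (\<Sum>i<n. \<Sum>j<n. (a i j)\<^sup>2)"

lemma sum_of_bool_eq_mult:
  fixes f :: "'a \<Rightarrow> real"
  assumes "finite S" "i \<in> S"
  shows "(\<Sum>l\<in>S. of_bool (i = l) * f l) = f i" "(\<Sum>l\<in>S. of_bool (l = i) * f l) = f i"
proof -
  have "(\<Sum>l\<in>S. of_bool (i = l) * f l) = (\<Sum>l\<in>S. if i = l then f l else 0)"
    "(\<Sum>l\<in>S. of_bool (l = i) * f l) = (\<Sum>l\<in>S. if l = i then f l else 0)"
    by (auto intro!: sum.cong)
  then show "(\<Sum>l\<in>S. of_bool (i = l) * f l) = f i" "(\<Sum>l\<in>S. of_bool (l = i) * f l) = f i"
    using assms by auto
qed

lemma fpow_add:
  assumes "i < n"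
  shows "fpow n a (k + m) i j = (\<Sum>l<n. fpow n a k i l * fpow n a m l j)"
  using assms
proof (induction k arbitrary: i)
  case 0
  then show ?case by (simp add: sum_of_bool_eq_mult)
next
  case (Suc k)
  have "fpow n a (Suc k + m) i j = (\<Sum>h<n. a i h * (\<Sum>l<n. fpow n a k h l * fpow n a m l j))"
    using Suc.IH by simp
  also have "\<dots> = (\<Sum>l<n. \<Sum>h<n. a i h * fpow n a k h l * fpow n a m l j)"
    by (subst sum.swap) (simp add: sum_distrib_left mult.assoc)
  finally show ?case by (simp add: sum_distrib_right)
qed

lemma fpow_one:
  assumes "j < n"
  shows "fpow n a (Suc 0) i j = a i j"
proof -
  have "fpow n a (Suc 0) i j = (\<Sum>l<n. of_bool (l = j) * a i l)"
    by (simp add: mult.commute)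
  then show ?thesis
    using assms by (simp add: sum_of_bool_eq_mult)
qed

lemma fpow_Suc_right:
  assumes "i < n" "j < n"
  shows "fpow n a (Suc k) i j = (\<Sum>l<n. fpow n a k i l * a l j)"
proof -
  have "fpow n a (Suc k) i j = fpow n a (k + Suc 0) i j"
    by simp
  also have "\<dots> = (\<Sum>l<n. fpow n a k i l * a l j)"
    unfolding fpow_add[OF assms(1)] fpow_one[OF assms(2)] ..
  finally show ?thesis .
qed

lemma fpow_sym:
  assumes "\<And>i j. a i j = a j i" "i < n" "j < n"
  shows "fpow n a k i j = fpow n a k j i"
  using assms(2,3)
proof (induction k arbitrary: i j)
  case 0
  then show ?case by (simp add: eq_commute)
next
  case (Suc k)
  have "fpow n a (Suc k) i j = (\<Sum>l<n. fpow n a k j l * a l i)"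
    using Suc by (auto simp: assms(1)[of i] mult.commute intro!: sum.cong)
  also have "\<dots> = fpow n a (Suc k) j i"
    using fpow_Suc_right[OF Suc.prems(2,1)] by simp
  finally show ?case .
qed

lemma mat_app_iterate:
  assumes "i < n"
  shows "(mat_app n a ^^ k) x i = (\<Sum>j<n. fpow n a k i j * x j)"
  using assms
proof (induction k arbitrary: i)
  case 0
  then show ?case by (simp add: sum_of_bool_eq_mult)
next
  case (Suc k)
  have "(mat_app n a ^^ Suc k) x i = (\<Sum>l<n. a i l * (\<Sum>j<n. fpow n a k l j * x j))"
    using Suc.IH by (simp add: mat_app_def[of n a "(mat_app n a ^^ k) x"])
  also have "\<dots> = (\<Sum>j<n. \<Sum>l<n. a i l * fpow n a k l j * x j)"
    by (subst sum.swap) (simp add: sum_distrib_left mult.assoc)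
  finally show ?case by (simp add: sum_distrib_right)
qed

lemma L2_set_power2: "(L2_set f S)\<^sup>2 = (\<Sum>i\<in>S. (f i)\<^sup>2)"
  by (simp add: L2_set_def sum_nonneg)

lemma L2_set_inner_le: "\<bar>\<Sum>i\<in>S. f i * g i\<bar> \<le> L2_set f S * L2_set g S"
  using L2_set_mult_ineq[of f g S] sum_abs[of "\<lambda>i. f i * g i" S] by (simp add: abs_mult)

lemma mat_app_self_adjoint:
  assumes "\<And>i j. a i j = a j i"
  shows "(\<Sum>i<n. mat_app n a x i * y i) = (\<Sum>i<n. x i * mat_app n a y i)"
proof -
  have "(\<Sum>i<n. mat_app n a x i * y i) = (\<Sum>i<n. \<Sum>j<n. a i j * x j * y i)"
    by (simp add: mat_app_def sum_distrib_right)
  also have "\<dots> = (\<Sum>j<n. \<Sum>i<n. a i j * x j * y i)" by (rule sum.swap)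
  also have "\<dots> = (\<Sum>j<n. \<Sum>i<n. x j * (a j i * y i))"
    using assms by (intro sum.cong) (auto simp: mult_ac)
  finally show ?thesis by (simp add: mat_app_def sum_distrib_left)
qed

lemma mat_app_frob2_le:
  "L2_set (\<lambda>i. \<Sum>j<n. a i j * x j) {..<n} \<le> sqrt (frob2 n a) * L2_set x {..<n}"
proof (rule power2_le_imp_le)
  have "(\<Sum>j<n. a i j * x j)\<^sup>2 \<le> (\<Sum>j<n. (a i j)\<^sup>2) * (L2_set x {..<n})\<^sup>2" for i
    using power_mono[OF L2_set_inner_le[of "a i" x "{..<n}"], of 2]
    by (simp add: power_mult_distrib L2_set_power2)
  then have "(L2_set (\<lambda>i. \<Sum>j<n. a i j * x j) {..<n})\<^sup>2
      \<le> (\<Sum>i<n. (\<Sum>j<n. (a i j)\<^sup>2) * (L2_set x {..<n})\<^sup>2)"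
    unfolding L2_set_power2[of _ "{..<n}"] by (intro sum_mono) (simp add: L2_set_power2)
  also have "\<dots> = (sqrt (frob2 n a) * L2_set x {..<n})\<^sup>2"
    by (simp add: frob2_def power_mult_distrib sum_distrib_right sum_nonneg)
  finally show "(L2_set (\<lambda>i. \<Sum>j<n. a i j * x j) {..<n})\<^sup>2 \<le> (sqrt (frob2 n a) * L2_set x {..<n})\<^sup>2" .
qed (simp add: frob2_def sum_nonneg)

text \<open>
  The norms of the iterates of a symmetric matrix are log-convex, so no spectral theorem is needed
  to bound the operator norm by the trace of a power.
\<close>
lemma norm_iterates_power_le:
  fixes a :: "nat \<Rightarrow> nat \<Rightarrow> real" and x :: "nat \<Rightarrow> real" and n :: nat
  assumes sym: "\<And>i j. a i j = a j i"
  defines "c \<equiv> \<lambda>k. L2_set ((mat_app n a ^^ k) x) {..<n}"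
  shows "c 1 ^ k * c 0 \<le> c k * c 0 ^ k"
proof -
  have nn: "c k \<ge> 0" for k by (simp add: c_def)
  have lc: "(c (Suc k))\<^sup>2 \<le> c k * c (Suc (Suc k))" for k
  proof -
    let ?y = "\<lambda>k. (mat_app n a ^^ k) x"
    have "(c (Suc k))\<^sup>2 = (\<Sum>i<n. mat_app n a (?y k) i * ?y (Suc k) i)"
      unfolding c_def L2_set_power2 by (simp add: power2_eq_square)
    also have "\<dots> = (\<Sum>i<n. ?y k i * ?y (Suc (Suc k)) i)"
      using mat_app_self_adjoint[of a n "?y k" "?y (Suc k)"] sym by simp
    also have "\<dots> \<le> c k * c (Suc (Suc k))"
      using L2_set_inner_le[of "?y k" "?y (Suc (Suc k))" "{..<n}"] by (simp add: c_def)
    finally show ?thesis .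
  qed
  \<comment> \<open>Log-convexity makes the ratios \<open>c (Suc k) / c k\<close> nondecreasing,
    hence at least \<open>c 1 / c 0\<close>. Cross-multiplication keeps the claim meaningful when
    some norms vanish.\<close>
  have step: "c k * c 1 \<le> c (Suc k) * c 0" for k
  proof (induction k)
    case 0
    then show ?case by simp
  next
    case (Suc k)
    show ?case
    proof (cases "c k = 0")
      case True
      then have "c (Suc k) = 0" using lc[of k] by simp
      then show ?thesis using nn by simp
    next
      case False
      have "c k * (c (Suc k) * c 1) \<le> c (Suc k) * (c (Suc k) * c 0)"
        using mult_left_mono[OF Suc nn[of "Suc k"]] by (simp add: mult_ac)
      also have "\<dots> \<le> c k * c (Suc (Suc k)) * c 0"
        using mult_right_mono[OF lc[of k] nn[of 0]] by (simp add: power2_eq_square mult_ac)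
      finally show ?thesis using False nn[of k] by (simp add: mult.assoc)
    qed
  qed
  show ?thesis
  proof (induction k)
    case 0
    then show ?case by simp
  next
    case (Suc k)
    have "c 1 ^ Suc k * c 0 \<le> c 1 * (c k * c 0 ^ k)"
      using mult_left_mono[OF Suc nn[of 1]] by (simp add: mult_ac)
    also have "\<dots> \<le> c (Suc k) * c 0 * c 0 ^ k"
      using mult_right_mono[OF step[of k] zero_le_power[OF nn[of 0], of k]] by (simp add: mult_ac)
    finally show ?case by (simp add: mult_ac)
  qed
qed

text \<open>The Frobenius norm dominates the operator norm of the k-th power, and log-convexity of
  the iterates takes the k-th root of the resulting bound.\<close>

lemma L2_set_mat_app_le:
  assumes sym: "\<And>i j. a i j = a j i" and "k > 0" "t \<ge> 0" and "frob2 n (fpow n a k) \<le> t ^ (2 * k)"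
  shows "L2_set (mat_app n a x) {..<n} \<le> t * L2_set x {..<n}"
proof (cases "L2_set x {..<n} = 0")
  case True
  then have "x j = 0" if "j < n" for j using that by (simp add: L2_set_eq_0_iff)
  then have "mat_app n a x i = 0" for i by (auto simp: mat_app_def intro!: sum.neutral)
  then show ?thesis using True by (simp add: L2_set_def)
next
  case False
  let ?c = "\<lambda>k. L2_set ((mat_app n a ^^ k) x) {..<n}"
  have pos: "?c 0 > 0" using False by (simp add: order_less_le)
  have "?c k = L2_set (\<lambda>i. \<Sum>j<n. fpow n a k i j * x j) {..<n}"
    by (intro L2_set_cong) (auto simp: mat_app_iterate)
  also have "\<dots> \<le> sqrt (frob2 n (fpow n a k)) * ?c 0"
    using mat_app_frob2_le by simp
  also have "\<dots> \<le> t ^ k * ?c 0"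
  proof (rule mult_right_mono)
    show "sqrt (frob2 n (fpow n a k)) \<le> t ^ k"
      using assms(3,4) by (intro real_le_lsqrt) (auto simp: power_even_eq mult.commute power_mult)
  qed simp
  finally have "?c 1 ^ k * ?c 0 \<le> (t ^ k * ?c 0) * ?c 0 ^ k"
    using norm_iterates_power_le[of a n x k] sym pos
    by (smt (verit) mult_right_mono zero_le_power)
  then have "?c 1 ^ k \<le> (t * ?c 0) ^ k"
    using pos by (simp add: power_mult_distrib mult_ac)
  then have "?c 1 \<le> t * ?c 0"
    using power_mono_iff[of "?c 1" "t * ?c 0" k] assms(2,3) pos by simp
  then show ?thesis by simp
qed

lemma frob2_fpow:
  assumes sym: "\<And>i j. a i j = a j i"
  shows "frob2 n (fpow n a k) = (\<Sum>i<n. fpow n a (2 * k) i i)"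
proof -
  have "fpow n a (2 * k) i i = (\<Sum>j<n. (fpow n a k i j)\<^sup>2)" if "i < n" for i
    using fpow_add[OF that, of a k k i] fpow_sym[OF sym that, where k = k]
    by (auto simp: mult_2 power2_eq_square intro!: sum.cong)
  then show ?thesis by (simp add: frob2_def)
qed

section \<open>Traces of powers as sums over closed walks\<close>

lemma sum_PiE_atMost_Suc:
  fixes f :: "(nat \<Rightarrow> 'a) \<Rightarrow> real"
  shows "(\<Sum>u\<in>{..Suc k} \<rightarrow>\<^sub>E T. f u) = (\<Sum>g\<in>{..k} \<rightarrow>\<^sub>E T. \<Sum>y\<in>T. f (g(Suc k := y)))"
proof -
  have "({..Suc k} \<rightarrow>\<^sub>E T) = (\<lambda>(y, g). g(Suc k := y)) ` (T \<times> ({..k} \<rightarrow>\<^sub>E T))"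
    using PiE_insert_eq[of "Suc k" "{..k}" "\<lambda>_. T"] by (simp add: atMost_Suc)
  moreover have "inj_on (\<lambda>(y, g). g(Suc k := y)) (T \<times> ({..k} \<rightarrow>\<^sub>E T))"
    by (rule inj_combinator) simp
  ultimately have "(\<Sum>u\<in>{..Suc k} \<rightarrow>\<^sub>E T. f u) = (\<Sum>(y, g)\<in>T \<times> ({..k} \<rightarrow>\<^sub>E T). f (g(Suc k := y)))"
    by (simp add: sum.reindex case_prod_unfold)
  then show ?thesis
    by (simp add: sum.cartesian_product[symmetric] sum.swap[of _ T])
qed

text \<open>The free weight \<open>\<phi>\<close> on the two endpoints is what makes the induction
  work: the last step of a walk is absorbed into a new weight. Closed walks are the case where
  \<open>\<phi>\<close> is the indicator of equal endpoints.\<close>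

lemma sum_walks:
  "(\<Sum>u\<in>{..k} \<rightarrow>\<^sub>E {..<n}. \<phi> (u 0) (u k) * (\<Prod>t<k. a (u t) (u (Suc t))))
    = (\<Sum>i<n. \<Sum>j<n. \<phi> i j * fpow n a k i j)"
proof (induction k arbitrary: \<phi>)
  case 0
  have "(\<Sum>u\<in>{..0::nat} \<rightarrow>\<^sub>E {..<n}. \<phi> (u 0) (u 0)) = (\<Sum>i<n. \<phi> i i)"
    by (rule sum.reindex_bij_witness[of _ "\<lambda>i. \<lambda>t\<in>{..0}. i" "\<lambda>u. u 0"])
      (auto simp: PiE_iff extensional_def)
  also have "\<dots> = (\<Sum>i<n. \<Sum>j<n. \<phi> i j * of_bool (i = j))"
    by (intro sum.cong) (auto simp: sum_of_bool_eq_mult mult.commute[of "\<phi> _ _"])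
  finally show ?case by simp
next
  case (Suc k)
  have "(\<Sum>u\<in>{..Suc k} \<rightarrow>\<^sub>E {..<n}. \<phi> (u 0) (u (Suc k)) * (\<Prod>t<Suc k. a (u t) (u (Suc t))))
      = (\<Sum>g\<in>{..k} \<rightarrow>\<^sub>E {..<n}. (\<Sum>y<n. \<phi> (g 0) y * a (g k) y) * (\<Prod>t<k. a (g t) (g (Suc t))))"
  proof -
    have "(\<Prod>t<Suc k. a ((g(Suc k := y)) t) ((g(Suc k := y)) (Suc t)))
        = (\<Prod>t<k. a (g t) (g (Suc t))) * a (g k) y" for g y
    proof -
      have "(\<Prod>t<k. a ((g(Suc k := y)) t) ((g(Suc k := y)) (Suc t))) = (\<Prod>t<k. a (g t) (g (Suc t)))"
        by (rule prod.cong) auto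
      then show ?thesis by (simp only: prod.lessThan_Suc) simp
    qed
    then show ?thesis
      unfolding sum_PiE_atMost_Suc by (simp add: sum_distrib_right sum_distrib_left mult_ac)
  qed
  also have "\<dots> = (\<Sum>i<n. \<Sum>l<n. (\<Sum>y<n. \<phi> i y * a l y) * fpow n a k i l)"
    by (rule Suc)
  also have "\<dots> = (\<Sum>i<n. \<Sum>y<n. \<phi> i y * fpow n a (Suc k) i y)"
  proof (rule sum.cong[OF refl])
    fix i assume i: "i \<in> {..<n}"
    have "(\<Sum>l<n. (\<Sum>y<n. \<phi> i y * a l y) * fpow n a k i l) = (\<Sum>y<n. \<phi> i y * (\<Sum>l<n. fpow n a k i l * a l y))"
      unfolding sum_distrib_left sum_distrib_right by (subst sum.swap) (simp add: mult_ac)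
    also have "\<dots> = (\<Sum>y<n. \<phi> i y * fpow n a (Suc k) i y)"
      using i by (intro sum.cong refl) (simp add: fpow_Suc_right del: fpow.simps)
    finally show "(\<Sum>l<n. (\<Sum>y<n. \<phi> i y * a l y) * fpow n a k i l) = (\<Sum>y<n. \<phi> i y * fpow n a (Suc k) i y)" .
  qed
  finally show ?case .
qed

text \<open>The starting vertex is repeated at position L, so that step t joins positions t and Suc
  t for all t < L without wrapping around. Extensionality makes the set finite.\<close>

definition closed_walks :: "nat \<Rightarrow> nat \<Rightarrow> (nat \<Rightarrow> nat) set" where
  "closed_walks n L = {u \<in> {..L} \<rightarrow>\<^sub>E {..<n}. u 0 = u L}"

lemma finite_closed_walks: "finite (closed_walks n L)"
  by (rule finite_subset[of _ "{..L} \<rightarrow>\<^sub>E {..<n}"]) (auto simp: closed_walks_def intro!: finite_PiE)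

lemma frob2_fpow_eq_walks:
  assumes sym: "\<And>i j. a i j = a j i"
  shows "frob2 n (fpow n a k) = (\<Sum>u\<in>closed_walks n (2 * k). \<Prod>t<2 * k. a (u t) (u (Suc t)))"
proof -
  have "(\<Sum>u\<in>closed_walks n (2 * k). \<Prod>t<2 * k. a (u t) (u (Suc t)))
     = (\<Sum>u\<in>{..2 * k} \<rightarrow>\<^sub>E {..<n}. of_bool (u 0 = u (2 * k)) * (\<Prod>t<2 * k. a (u t) (u (Suc t))))"
    unfolding closed_walks_def by (intro sum.mono_neutral_cong_left) (auto intro: finite_PiE)
  also have "\<dots> = (\<Sum>i<n. \<Sum>j<n. of_bool (i = j) * fpow n a (2 * k) i j)"
    by (rule sum_walks)
  finally show ?thesis
    by (simp add: frob2_fpow[OF sym] sum_of_bool_eq_mult)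
qed

section \<open>Shapes of closed walks\<close>

text \<open>The undirected edge used in step t; a singleton if the step stays at its vertex.\<close>

definition wedge :: "(nat \<Rightarrow> nat) \<Rightarrow> nat \<Rightarrow> nat set" where
  "wedge u t = {u t, u (Suc t)}"

text \<open>The walks that can contribute to an expected trace: a loop meets the zero diagonal, and
  an edge traversed exactly once contributes the mean of a centered entry.\<close>

definition heavy_walk :: "nat \<Rightarrow> (nat \<Rightarrow> nat) \<Rightarrow> bool" where
  "heavy_walk L u \<longleftrightarrow> (\<forall>t<L. u t \<noteq> u (Suc t)) \<and> (\<forall>t<L. 2 \<le> card {s. s < L \<and> wedge u s = wedge u t})"

definition edge_count :: "nat \<Rightarrow> (nat \<Rightarrow> nat) \<Rightarrow> nat" where
  "edge_count L u = card (wedge u ` {..<L})"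

lemma card_walk_vertices_le: "card (u ` {..L}) \<le> Suc (edge_count L u)"
  unfolding edge_count_def
proof (induction L)
  case 0
  then show ?case by simp
next
  case (Suc L)
  have sub: "u ` {..Suc L} = insert (u (Suc L)) (u ` {..L})"
    "wedge u ` {..<Suc L} = insert (wedge u L) (wedge u ` {..<L})"
    by (auto simp: atMost_Suc lessThan_Suc)
  show ?case
  proof (cases "u (Suc L) \<in> u ` {..L}")
    case True
    then have "card (u ` {..Suc L}) \<le> Suc (card (wedge u ` {..<L}))"
      using Suc sub by (simp add: insert_absorb)
    also have "\<dots> \<le> Suc (card (wedge u ` {..<Suc L}))"
      by (auto intro!: card_mono)
    finally show ?thesis .
  next
    case False
    have "wedge u L \<notin> wedge u ` {..<L}"
    proof
      assume "wedge u L \<in> wedge u ` {..<L}"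
      then obtain t where t: "t < L" "u (Suc L) \<in> wedge u t"
        by (auto simp: wedge_def)
      then have "u (Suc L) \<in> u ` {..L}"
        unfolding wedge_def by (metis Suc_leI atMost_iff image_eqI insertE less_imp_le singletonD)
      then show False using False by simp
    qed
    then show ?thesis
      using Suc False unfolding sub by simp
  qed
qed

text \<open>Double counting: the 2 p steps are distributed over the edges, with at least two steps
  for each.\<close>

lemma edge_count_heavy_le:
  assumes "heavy_walk (2 * p) u"
  shows "edge_count (2 * p) u \<le> p"
proof -
  let ?W = "wedge u ` {..<2 * p}"
  have "2 * card ?W = (\<Sum>e\<in>?W. 2)"
    by simp
  also have "\<dots> \<le> (\<Sum>e\<in>?W. card {s \<in> {..<2 * p}. wedge u s = e})"
    using assms by (intro sum_mono) (auto simp: heavy_walk_def)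
  also have "\<dots> = (\<Sum>e\<in>?W. \<Sum>s\<in>{s \<in> {..<2 * p}. wedge u s = e}. 1)"
    by simp
  also have "\<dots> = (\<Sum>s\<in>{..<2 * p}. 1)"
    by (rule sum.group) auto
  finally show ?thesis by (simp add: edge_count_def)
qed

lemma card_image_eq_kernel:
  assumes "\<And>s t. s \<in> S \<Longrightarrow> t \<in> S \<Longrightarrow> f s = f t \<longleftrightarrow> g s = g t"
  shows "card (f ` S) = card (g ` S)"
proof -
  let ?h = "\<lambda>x. g (inv_into S f x)"
  have h: "?h (f s) = g s" if "s \<in> S" for s
    using assms[of "inv_into S f (f s)" s] that by (auto simp: f_inv_into_f inv_into_into)
  have "inj_on ?h (f ` S)"
    using h assms by (auto simp: inj_on_def)
  moreover have "?h ` f ` S = g ` S"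
    using h by (force simp: image_iff)
  ultimately show ?thesis
    by (metis card_image)
qed

text \<open>Whatever enters the comparison depends only on which positions coincide. It can
  therefore be read off any representative of a shape, no matter how many points the walk may
  visit.\<close>

lemma walk_shape_cong:
  assumes "\<And>i j. i \<le> L \<Longrightarrow> j \<le> L \<Longrightarrow> u i = u j \<longleftrightarrow> v i = v j"
  shows "heavy_walk L u \<longleftrightarrow> heavy_walk L v" "edge_count L u = edge_count L v"
    "card (u ` {..L}) = card (v ` {..L})"
proof -
  have w: "wedge u s = wedge u t \<longleftrightarrow> wedge v s = wedge v t" if "s < L" "t < L" for s t
    using that assms by (simp add: wedge_def doubleton_eq_iff)
  have "{s. s < L \<and> wedge u s = wedge u t} = {s. s < L \<and> wedge v s = wedge v t}" if "t < L" for t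
    using w that by auto
  then show "heavy_walk L u \<longleftrightarrow> heavy_walk L v"
    using assms by (simp add: heavy_walk_def)
  show "edge_count L u = edge_count L v"
    unfolding edge_count_def by (rule card_image_eq_kernel) (use w in auto)
  show "card (u ` {..L}) = card (v ` {..L})"
    by (rule card_image_eq_kernel) (use assms in auto)
qed

text \<open>Canonical code of the pattern of coincidences: each vertex is renamed to the position of
  its first visit. The distinct values of the code thus correspond to the vertices of the
  walk.\<close>

definition walk_shape :: "nat \<Rightarrow> (nat \<Rightarrow> nat) \<Rightarrow> nat \<Rightarrow> nat" where
  "walk_shape L u = (\<lambda>i\<in>{..L}. LEAST j. u j = u i)"

lemma walk_shape_le: "i \<le> L \<Longrightarrow> walk_shape L u i \<le> i"
  by (simp add: walk_shape_def Least_le)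

lemma walk_shape_same: "i \<le> L \<Longrightarrow> u (walk_shape L u i) = u i"
  unfolding walk_shape_def by (simp, rule LeastI) (rule refl)

lemma walk_shape_eq_iff:
  assumes "i \<le> L" "j \<le> L"
  shows "walk_shape L u i = walk_shape L u j \<longleftrightarrow> u i = u j"
proof
  assume "walk_shape L u i = walk_shape L u j"
  then show "u i = u j"
    using walk_shape_same[OF assms(1), of u] walk_shape_same[OF assms(2), of u] by simp
next
  assume "u i = u j"
  then show "walk_shape L u i = walk_shape L u j"
    using assms by (simp add: walk_shape_def)
qed

lemma walk_shape_eqI:
  assumes "\<And>i j. i \<le> L \<Longrightarrow> j \<le> L \<Longrightarrow> u i = u j \<longleftrightarrow> v i = v j"
  shows "walk_shape L u = walk_shape L v"
proof
  fix i
  show "walk_shape L u i = walk_shape L v i"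
  proof (cases "i \<le> L")
    case True
    have "v (walk_shape L u i) = v i" "u (walk_shape L v i) = u i"
      using True assms[of "walk_shape L u i" i] assms[of "walk_shape L v i" i]
        walk_shape_same[of i L u] walk_shape_same[of i L v] walk_shape_le[of i L u] walk_shape_le[of i L v]
      by auto
    then have "walk_shape L v i \<le> walk_shape L u i" "walk_shape L u i \<le> walk_shape L v i"
      using True by (auto simp: walk_shape_def intro: Least_le)
    then show ?thesis by simp
  qed (simp add: walk_shape_def)
qed

lemma card_shape_le:
  "card {u \<in> closed_walks n L. walk_shape L u = s} \<le> n ^ card (s ` {..L})"
proof -
  let ?A = "{u \<in> closed_walks n L. walk_shape L u = s}"
  show ?thesis
  proof (cases "?A = {}")
    case False
    then obtain u0 where "walk_shape L u0 = s" by auto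
    then have sub: "s ` {..L} \<subseteq> {..L}"
      using walk_shape_le[of _ L u0] by force
    have "inj_on (\<lambda>u. restrict u (s ` {..L})) ?A"
    proof (rule inj_onI)
      fix u v assume uv: "u \<in> ?A" "v \<in> ?A" "restrict u (s ` {..L}) = restrict v (s ` {..L})"
      show "u = v"
      proof
        fix i
        show "u i = v i"
        proof (cases "i \<le> L")
          case True
          have "u i = u (s i)" "v i = v (s i)"
            using walk_shape_same[of i L u] walk_shape_same[of i L v] uv True by auto
          moreover have "u (s i) = v (s i)"
            using fun_cong[OF uv(3), of "s i"] True by auto
          ultimately show ?thesis by simp
        next
          case False
          then show ?thesis
            using uv by (auto simp: closed_walks_def PiE_def extensional_def)
        qed
      qed
    qed
    moreover have "(\<lambda>u. restrict u (s ` {..L})) ` ?A \<subseteq> s ` {..L} \<rightarrow>\<^sub>E {..<n}"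
      using sub by (auto simp: closed_walks_def PiE_def Pi_def)
    ultimately have "card ?A \<le> card (s ` {..L} \<rightarrow>\<^sub>E {..<n})"
      by (intro card_inj_on_le[where f = "\<lambda>u. restrict u (s ` {..L})"]) (auto intro: finite_PiE)
    then show ?thesis by (simp add: card_funcsetE)
  next
    case True
    then show ?thesis by (metis card.empty le0)
  qed
qed

text \<open>Every injective labelling of the first visits by points below r yields a walk of the
  same shape. The truncated subtraction makes the falling factorial zero when there are too few
  points.\<close>

lemma card_shape_ge:
  assumes u0: "u0 0 = u0 L" and s: "s = walk_shape L u0"
  shows "(\<Prod>i<card (s ` {..L}). r - i) \<le> card {u \<in> closed_walks r L. walk_shape L u = s}"
proof -
  let ?M = "s ` {..L}"
  let ?I = "{f \<in> ?M \<rightarrow>\<^sub>E {..<r}. inj_on f ?M}"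
  let ?A = "{u \<in> closed_walks r L. walk_shape L u = s}"
  let ?\<Phi> = "\<lambda>f. \<lambda>i\<in>{..L}. f (s i)"
  have "inj_on ?\<Phi> ?I"
  proof (rule inj_onI)
    fix f g assume fg: "f \<in> ?I" "g \<in> ?I" "?\<Phi> f = ?\<Phi> g"
    have "f x = g x" if "x \<in> ?M" for x
    proof -
      from that obtain i where "i \<le> L" "x = s i" by auto
      then show ?thesis using fun_cong[OF fg(3), of i] by simp
    qed
    moreover have "f x = g x" if "x \<notin> ?M" for x
      using fg that by (auto simp: PiE_def extensional_def)
    ultimately show "f = g" by blast
  qed
  moreover have "?\<Phi> ` ?I \<subseteq> ?A"
  proof clarify
    fix f assume f: "f \<in> ?M \<rightarrow>\<^sub>E {..<r}" "inj_on f ?M"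
    have "s 0 = s L" unfolding s using u0 walk_shape_eq_iff[of 0 L L u0] by simp
    then have "?\<Phi> f \<in> closed_walks r L"
      using f by (auto simp: closed_walks_def)
    moreover have "walk_shape L (?\<Phi> f) = walk_shape L u0"
    proof (rule walk_shape_eqI)
      fix i j assume ij: "i \<le> L" "j \<le> L"
      then have "f (s i) = f (s j) \<longleftrightarrow> s i = s j"
        using f(2) by (auto simp: inj_on_def)
      then show "?\<Phi> f i = ?\<Phi> f j \<longleftrightarrow> u0 i = u0 j"
        using ij walk_shape_eq_iff[OF ij, of u0] by (simp add: s)
    qed
    ultimately show "?\<Phi> f \<in> closed_walks r L \<and> walk_shape L (?\<Phi> f) = s"
      by (simp add: s)
  qed
  moreover have "finite ?A" using finite_closed_walks by simp
  ultimately have "card ?I \<le> card ?A"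
    by (rule card_inj_on_le)
  moreover have "card ?I = (\<Prod>i<card ?M. r - i)"
    using card_inj_on_subset_funcset[of ?M "{..<r}" ?M] by (simp add: lessThan_atLeast0)
  ultimately show ?thesis by simp
qed

text \<open>
  Both sides are grouped by shape.  A shape with \<open>m\<close> vertices has at least \<open>m - 1\<close> edges, at most
  \<open>p + 1\<close> vertices, at most \<open>n ^ m\<close> realisations in \<open>n\<close> points and at least
  \<open>r (r - p) ^ (m - 1)\<close> realisations in \<open>r\<close> points.
\<close>
lemma heavy_walks_comparison:
  fixes \<alpha> :: real
  assumes \<alpha>: "0 < \<alpha>" "\<alpha> \<le> 1" and n: "n > 0" and r: "real n * \<alpha> + real p \<le> real r"
  shows "(\<Sum>u\<in>{u \<in> closed_walks n (2 * p). heavy_walk (2 * p) u}. \<alpha> ^ edge_count (2 * p) u)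
    \<le> real n / real r * real (card {u \<in> closed_walks r (2 * p). heavy_walk (2 * p) u})"
proof -
  define L where "L = 2 * p"
  define A where "A = {u \<in> closed_walks n L. heavy_walk L u}"
  define A' where "A' = {u \<in> closed_walks r L. heavy_walk L u}"
  define C where "C = walk_shape L ` A"
  have r0: "real r > 0" using r \<alpha> n
    by (smt (verit) mult_pos_pos of_nat_0_less_iff of_nat_0_le_iff)
  have fin: "finite A" "finite A'" "finite C"
    using finite_closed_walks by (auto simp: A_def A'_def C_def)
  have shape: "(\<Sum>u\<in>{u \<in> A. walk_shape L u = s}. \<alpha> ^ edge_count L u)
     \<le> real n / real r * real (card {u \<in> A'. walk_shape L u = s})" if "s \<in> C" for s
  proof -
    from that obtain u0 where u0: "u0 \<in> A" "s = walk_shape L u0" by (auto simp: C_def)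
    define m where "m = card (s ` {..L})"
    define e where "e = edge_count L u0"
    have ker: "u i = u j \<longleftrightarrow> u0 i = u0 j" if "walk_shape L u = s" "i \<le> L" "j \<le> L" for u i j
      using walk_shape_eq_iff[of i L j u] walk_shape_eq_iff[of i L j u0] u0 that by simp
    have ec: "edge_count L u = e" if "walk_shape L u = s" for u
      unfolding e_def by (rule walk_shape_cong(2)) (use ker[OF that] in auto)
    have hv: "heavy_walk L u" if "walk_shape L u = s" for u
    proof -
      have "heavy_walk L u = heavy_walk L u0"
        by (rule walk_shape_cong(1)) (use ker[OF that] in auto)
      then show ?thesis using u0 by (simp add: A_def)
    qed
    have m_eq: "m = card (u0 ` {..L})"
      unfolding m_def u0(2) by (rule card_image_eq_kernel) (auto simp: walk_shape_eq_iff)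
    then have me: "m \<le> Suc e" using card_walk_vertices_le[of u0 L] by (simp add: e_def)
    have ep: "e \<le> p" using edge_count_heavy_le[of p u0] u0 by (simp add: e_def L_def A_def)
    have m1: "m \<ge> 1" unfolding m_eq by (simp add: Suc_le_eq card_gt_0_iff)
    have "(\<Sum>u\<in>{u \<in> A. walk_shape L u = s}. \<alpha> ^ edge_count L u)
        = real (card {u \<in> A. walk_shape L u = s}) * \<alpha> ^ e"
      using ec by simp
    also have "\<dots> \<le> real (n ^ m) * \<alpha> ^ (m - 1)"
    proof (rule mult_mono)
      have "card {u \<in> A. walk_shape L u = s} \<le> card {u \<in> closed_walks n L. walk_shape L u = s}"
        using finite_closed_walks by (intro card_mono) (auto simp: A_def)
      also have "\<dots> \<le> n ^ m"
        unfolding m_def by (rule card_shape_le)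
      finally show "real (card {u \<in> A. walk_shape L u = s}) \<le> real (n ^ m)"
        by (simp only: of_nat_le_iff)
      \<comment> \<open>Here \<alpha> \<le> 1 is used: surplus edges beyond a spanning tree only
        make the weight smaller.\<close>
      show "\<alpha> ^ e \<le> \<alpha> ^ (m - 1)" using \<alpha> me by (intro power_decreasing) auto
    qed (use \<alpha> in auto)
    also have "\<dots> = real n * (real n * \<alpha>) ^ (m - 1)"
      using m1 by (cases m) (auto simp: power_mult_distrib)
    also have "\<dots> = real n / real r * (real r * (real n * \<alpha>) ^ (m - 1))"
      using r0 by simp
    also have "\<dots> \<le> real n / real r * real (\<Prod>i<m. r - i)"
    proof (rule mult_left_mono)
      \<comment> \<open>Since Suc i \<le> m - 1 \<le> e \<le> p, each of these factors is at least r
        - p, which is at least n \<alpha>. The factor r for i = 0 is kept exact and cancels against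
        the prefactor n / r.\<close>
      have mr: "real n * \<alpha> \<le> real (r - Suc i)" if "i < m - 1" for i
        using that r me ep by (simp add: of_nat_diff)
      have "real r * (real n * \<alpha>) ^ (m - 1) = real r * (\<Prod>i<m - 1. real n * \<alpha>)"
        by simp
      also have "\<dots> \<le> real r * (\<Prod>i<m - 1. real (r - Suc i))"
        using mr \<alpha> by (intro mult_left_mono prod_mono) auto
      also have "\<dots> = real (\<Prod>i<Suc (m - 1). r - i)"
        by (subst prod.lessThan_Suc_shift) simp
      finally show "real r * (real n * \<alpha>) ^ (m - 1) \<le> real (\<Prod>i<m. r - i)"
        using m1 by simp
    qed simp
    also have "\<dots> \<le> real n / real r * real (card {u \<in> A'. walk_shape L u = s})"
    proof (rule mult_left_mono)
      have "(\<Prod>i<m. r - i) \<le> card {u \<in> closed_walks r L. walk_shape L u = s}"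
        unfolding m_def by (rule card_shape_ge[OF _ u0(2)]) (use u0 in \<open>auto simp: A_def closed_walks_def\<close>)
      also have "{u \<in> closed_walks r L. walk_shape L u = s} = {u \<in> A'. walk_shape L u = s}"
        using hv by (auto simp: A'_def)
      finally show "real (\<Prod>i<m. r - i) \<le> real (card {u \<in> A'. walk_shape L u = s})"
        by (simp only: of_nat_le_iff)
    qed simp
    finally show ?thesis .
  qed
  have "(\<Sum>u\<in>A. \<alpha> ^ edge_count L u) = (\<Sum>s\<in>C. \<Sum>u\<in>{u \<in> A. walk_shape L u = s}. \<alpha> ^ edge_count L u)"
    unfolding C_def by (rule sum.image_gen) (rule fin)
  also have "\<dots> \<le> (\<Sum>s\<in>C. real n / real r * real (card {u \<in> A'. walk_shape L u = s}))"
    by (intro sum_mono shape)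
  also have "\<dots> = real n / real r * real (\<Sum>s\<in>C. card {u \<in> A'. walk_shape L u = s})"
    by (simp add: sum_distrib_left)
  also have "(\<Sum>s\<in>C. card {u \<in> A'. walk_shape L u = s}) = card (\<Union>s\<in>C. {u \<in> A'. walk_shape L u = s})"
    using fin by (intro card_UN_disjoint[symmetric]) auto
  also have "real n / real r * real (card (\<Union>s\<in>C. {u \<in> A'. walk_shape L u = s})) \<le> real n / real r * real (card A')"
    using fin by (intro mult_left_mono) (auto intro!: card_mono)
  finally show ?thesis by (simp add: A_def A'_def L_def)
qed

section \<open>Moments of random symmetric matrices\<close>

definition pairs :: "nat \<Rightarrow> (nat \<times> nat) set" where
  "pairs n = {(i, j). i < j \<and> j < n}"

text \<open>The entry function \<open>f\<close> is a parameter so that one construction covers both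
  the centered adjacency matrix, with entries \<open>of_bool b - q e\<close>, and the comparison
  matrix, with entries \<open>skew_sign\<close>.\<close>

definition edge_matrix :: "(nat \<times> nat \<Rightarrow> bool \<Rightarrow> real) \<Rightarrow> (nat \<times> nat \<Rightarrow> bool) \<Rightarrow> nat \<Rightarrow> nat \<Rightarrow> real" where
  "edge_matrix f E i j =
     (if i < j then f (i, j) (E (i, j)) else if j < i then f (j, i) (E (j, i)) else 0)"

definition edge_law :: "nat \<Rightarrow> (nat \<times> nat \<Rightarrow> real) \<Rightarrow> (nat \<times> nat \<Rightarrow> bool) pmf" where
  "edge_law n q = Pi_pmf (pairs n) False (\<lambda>e. bernoulli_pmf (q e))"

definition multiplicity_in :: "nat \<Rightarrow> (nat \<Rightarrow> nat) \<Rightarrow> nat \<times> nat \<Rightarrow> nat" where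
  "multiplicity_in L u e = card {t. t < L \<and> wedge u t = {fst e, snd e}}"

lemma finite_pairs [simp]: "finite (pairs n)"
  by (rule finite_subset[of _ "{..<n} \<times> {..<n}"]) (auto simp: pairs_def)

lemma finite_set_edge_law: "finite (set_pmf (edge_law n q))"
  unfolding edge_law_def
  by (rule finite_subset[OF set_Pi_pmf_subset']) (auto intro!: finite_PiE_dflt)

lemma integrable_edge_law [simp]:
  fixes g :: "(nat \<times> nat \<Rightarrow> bool) \<Rightarrow> real"
  shows "integrable (measure_pmf (edge_law n q)) g"
  by (rule integrable_measure_pmf_finite[OF finite_set_edge_law])

lemma edge_matrix_sym: "edge_matrix f E i j = edge_matrix f E j i"
  by (auto simp: edge_matrix_def)

lemma expectation_prod_edge_law:
  fixes g :: "nat \<times> nat \<Rightarrow> bool \<Rightarrow> real"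
  shows "measure_pmf.expectation (edge_law n q) (\<lambda>E. \<Prod>e\<in>pairs n. g e (E e))
    = (\<Prod>e\<in>pairs n. measure_pmf.expectation (bernoulli_pmf (q e)) (g e))"
proof -
  let ?M = "measure_pmf (edge_law n q)"
  have "prob_space.indep_vars ?M (\<lambda>_. borel) (\<lambda>e E. g e (E e)) (pairs n)"
    unfolding edge_law_def
    by (rule prob_space.indep_vars_compose2[OF prob_space_measure_pmf indep_vars_Pi_pmf]) auto
  then have "measure_pmf.expectation (edge_law n q) (\<lambda>E. \<Prod>e\<in>pairs n. g e (E e))
      = (\<Prod>e\<in>pairs n. measure_pmf.expectation (edge_law n q) (\<lambda>E. g e (E e)))"
    by (intro prob_space.indep_vars_lebesgue_integral[OF prob_space_measure_pmf]) auto
  also have "\<dots> = (\<Prod>e\<in>pairs n. measure_pmf.expectation (bernoulli_pmf (q e)) (g e))"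
  proof (rule prod.cong[OF refl])
    fix e assume "e \<in> pairs n"
    then have "map_pmf (\<lambda>E. E e) (edge_law n q) = bernoulli_pmf (q e)"
      unfolding edge_law_def by (subst Pi_pmf_component) auto
    then have "measure_pmf.expectation (bernoulli_pmf (q e)) (g e)
        = measure_pmf.expectation (map_pmf (\<lambda>E. E e) (edge_law n q)) (g e)"
      by simp
    then show "measure_pmf.expectation (edge_law n q) (\<lambda>E. g e (E e))
        = measure_pmf.expectation (bernoulli_pmf (q e)) (g e)"
      by (simp only: integral_map_pmf)
  qed
  finally show ?thesis .
qed

text \<open>Independence holds across edges, not across steps, so the steps are regrouped by the
  edge they use. A step that stays put meets the zero diagonal.\<close>

lemma walk_product:
  assumes u: "u \<in> closed_walks n L"
  shows "(\<Prod>t<L. edge_matrix f E (u t) (u (Suc t)))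
    = (if \<exists>t<L. u t = u (Suc t) then 0 else \<Prod>e\<in>pairs n. f e (E e) ^ multiplicity_in L u e)"
proof (cases "\<exists>t<L. u t = u (Suc t)")
  case True
  then obtain t where t: "t < L" "u t = u (Suc t)" by blast
  then have "edge_matrix f E (u t) (u (Suc t)) = 0" by (simp add: edge_matrix_def)
  then show ?thesis using True t(1) by (auto intro!: prod_zero)
next
  case False
  let ?e = "\<lambda>t. (min (u t) (u (Suc t)), max (u t) (u (Suc t)))"
  have lt: "u t < n" if "t \<le> L" for t using u that by (auto simp: closed_walks_def)
  have e: "?e t \<in> pairs n" "edge_matrix f E (u t) (u (Suc t)) = f (?e t) (E (?e t))" if "t < L" for t
    using that False lt[of t] lt[of "Suc t"]
    by (auto simp: pairs_def edge_matrix_def min_def max_def)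
  have w: "?e t = e \<longleftrightarrow> wedge u t = {fst e, snd e}" if "t < L" "e \<in> pairs n" for t e
    using that False by (auto simp: wedge_def pairs_def doubleton_eq_iff min_def max_def)
  have "(\<Prod>t<L. edge_matrix f E (u t) (u (Suc t))) = (\<Prod>t<L. f (?e t) (E (?e t)))"
    using e by (intro prod.cong) auto
  also have "\<dots> = (\<Prod>e\<in>pairs n. \<Prod>t\<in>{t \<in> {..<L}. ?e t = e}. f (?e t) (E (?e t)))"
    using e(1) by (intro prod.group[symmetric]) auto
  also have "\<dots> = (\<Prod>e\<in>pairs n. \<Prod>t\<in>{t \<in> {..<L}. ?e t = e}. f e (E e))"
    by (intro prod.cong) auto
  also have "\<dots> = (\<Prod>e\<in>pairs n. f e (E e) ^ multiplicity_in L u e)"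
  proof (rule prod.cong[OF refl])
    fix e assume "e \<in> pairs n"
    then have "{t \<in> {..<L}. ?e t = e} = {t. t < L \<and> wedge u t = {fst e, snd e}}"
      using w by (intro Collect_cong) (metis lessThan_iff)
    then show "(\<Prod>t\<in>{t \<in> {..<L}. ?e t = e}. f e (E e)) = f e (E e) ^ multiplicity_in L u e"
      by (simp add: multiplicity_in_def)
  qed
  finally show ?thesis unfolding if_not_P[OF False] .
qed

definition bern_moment :: "(nat \<times> nat \<Rightarrow> real) \<Rightarrow> (nat \<times> nat \<Rightarrow> bool \<Rightarrow> real) \<Rightarrow> nat \<times> nat \<Rightarrow> nat \<Rightarrow> real" where
  "bern_moment q f e k = measure_pmf.expectation (bernoulli_pmf (q e)) (\<lambda>b. f e b ^ k)"

definition loopless :: "nat \<Rightarrow> (nat \<Rightarrow> nat) \<Rightarrow> bool" where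
  "loopless L u \<longleftrightarrow> (\<forall>t<L. u t \<noteq> u (Suc t))"

text \<open>For a symmetric matrix the squared Frobenius norm of a power is the trace of an even
  power. After its expansion into walks, independence factors each expectation into moments of
  single entries.\<close>

lemma expectation_frob2:
  "measure_pmf.expectation (edge_law n q) (\<lambda>E. frob2 n (fpow n (edge_matrix f E) p))
    = (\<Sum>u\<in>{u \<in> closed_walks n (2 * p). loopless (2 * p) u}.
        \<Prod>e\<in>pairs n. bern_moment q f e (multiplicity_in (2 * p) u e))"
proof -
  let ?E = "measure_pmf.expectation (edge_law n q)"
  let ?g = "\<lambda>u E. \<Prod>e\<in>pairs n. f e (E e) ^ multiplicity_in (2 * p) u e"
  have "?E (\<lambda>E. frob2 n (fpow n (edge_matrix f E) p))
     = ?E (\<lambda>E. \<Sum>u\<in>closed_walks n (2 * p). if loopless (2 * p) u then ?g u E else 0)"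
    by (intro Bochner_Integration.integral_cong refl, subst frob2_fpow_eq_walks[OF edge_matrix_sym],
        intro sum.cong refl, subst walk_product) (auto simp: loopless_def)
  also have "\<dots> = ?E (\<lambda>E. \<Sum>u\<in>{u \<in> closed_walks n (2 * p). loopless (2 * p) u}. ?g u E)"
    using finite_closed_walks by (simp add: sum.inter_filter)
  also have "\<dots> = (\<Sum>u\<in>{u \<in> closed_walks n (2 * p). loopless (2 * p) u}. ?E (?g u))"
    by (rule Bochner_Integration.integral_sum) simp
  also have "\<dots> = (\<Sum>u\<in>{u \<in> closed_walks n (2 * p). loopless (2 * p) u}.
        \<Prod>e\<in>pairs n. bern_moment q f e (multiplicity_in (2 * p) u e))"
    unfolding bern_moment_def by (intro sum.cong refl expectation_prod_edge_law)
  finally show ?thesis .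
qed

text \<open>A dictionary: heaviness and edge counts are defined through steps, whereas moments are
  indexed by ordered pairs. Without loops, pairs of positive multiplicity correspond bijectively to
  the edges used.\<close>

lemma loopless_multiplicity:
  assumes u: "u \<in> closed_walks n L" and l: "loopless L u"
  shows "heavy_walk L u \<longleftrightarrow> (\<forall>e\<in>pairs n. multiplicity_in L u e \<noteq> 1)"
    and "card {e \<in> pairs n. multiplicity_in L u e > 0} = edge_count L u"
proof -
  have lt: "u t < n" if "t \<le> L" for t using u that by (auto simp: closed_walks_def)
  have pair: "\<exists>e\<in>pairs n. wedge u t = {fst e, snd e}" if "t < L" for t
  proof (rule bexI)
    let ?e = "(min (u t) (u (Suc t)), max (u t) (u (Suc t)))"
    show "wedge u t = {fst ?e, snd ?e}" by (auto simp: wedge_def min_def max_def)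
    show "?e \<in> pairs n"
      using that l lt[of t] lt[of "Suc t"] by (auto simp: pairs_def loopless_def min_def max_def)
  qed
  have pos: "multiplicity_in L u e > 0 \<longleftrightarrow> {fst e, snd e} \<in> wedge u ` {..<L}" for e
    by (auto simp: multiplicity_in_def card_gt_0_iff)
  show "heavy_walk L u \<longleftrightarrow> (\<forall>e\<in>pairs n. multiplicity_in L u e \<noteq> 1)"
  proof
    assume h: "heavy_walk L u"
    show "\<forall>e\<in>pairs n. multiplicity_in L u e \<noteq> 1"
    proof
      fix e
      show "multiplicity_in L u e \<noteq> 1"
      proof (cases "multiplicity_in L u e > 0")
        case True
        then obtain t where t: "t < L" "wedge u t = {fst e, snd e}"
          using pos by (metis imageE lessThan_iff)
        then have "2 \<le> multiplicity_in L u e"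
          using h unfolding heavy_walk_def multiplicity_in_def by metis
        then show ?thesis by simp
      qed simp
    qed
  next
    assume m: "\<forall>e\<in>pairs n. multiplicity_in L u e \<noteq> 1"
    have "2 \<le> card {s. s < L \<and> wedge u s = wedge u t}" if t: "t < L" for t
    proof -
      obtain e where e: "e \<in> pairs n" "wedge u t = {fst e, snd e}" using pair[OF t] by blast
      then have "multiplicity_in L u e > 0" "multiplicity_in L u e \<noteq> 1"
        using pos m t by auto
      then show ?thesis using e by (simp add: multiplicity_in_def)
    qed
    then show "heavy_walk L u" using l by (simp add: heavy_walk_def loopless_def)
  qed
  have "bij_betw (\<lambda>e. {fst e, snd e}) {e \<in> pairs n. multiplicity_in L u e > 0} (wedge u ` {..<L})"
    unfolding bij_betw_def
  proof
    show "inj_on (\<lambda>e. {fst e, snd e}) {e \<in> pairs n. multiplicity_in L u e > 0}"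
      by (auto simp: inj_on_def pairs_def doubleton_eq_iff)
    show "(\<lambda>e. {fst e, snd e}) ` {e \<in> pairs n. multiplicity_in L u e > 0} = wedge u ` {..<L}"
    proof (intro subset_antisym subsetI)
      fix w assume w: "w \<in> wedge u ` {..<L}"
      then obtain e where "e \<in> pairs n" "w = {fst e, snd e}" using pair by (metis imageE lessThan_iff)
      then show "w \<in> (\<lambda>e. {fst e, snd e}) ` {e \<in> pairs n. multiplicity_in L u e > 0}"
        using w pos by auto
    qed (use pos in auto)
  qed
  then show "card {e \<in> pairs n. multiplicity_in L u e > 0} = edge_count L u"
    unfolding edge_count_def by (rule bij_betw_same_card)
qed

text \<open>An edge used once annihilates its walk, since the entry has mean zero. An edge used at
  least twice contributes at most its variance q (1 - q) \<le> \<alpha>, since the entry is bounded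
  by 1 in absolute value.\<close>

lemma expectation_frob2_centered_le:
  fixes \<alpha> :: real
  assumes q: "\<And>e. e \<in> pairs n \<Longrightarrow> 0 \<le> q e \<and> q e \<le> \<alpha> \<and> q e \<le> 1" and \<alpha>: "0 < \<alpha>"
  shows "measure_pmf.expectation (edge_law n q) (\<lambda>E. frob2 n (fpow n (edge_matrix (\<lambda>e b. of_bool b - q e) E) p))
    \<le> (\<Sum>u\<in>{u \<in> closed_walks n (2 * p). heavy_walk (2 * p) u}. \<alpha> ^ edge_count (2 * p) u)"
proof -
  let ?L = "2 * p"
  let ?f = "\<lambda>e b. of_bool b - q e"
  let ?m = "bern_moment q ?f"
  have mom: "?m e k = q e * (1 - q e) ^ k + (1 - q e) * (- q e) ^ k" if "e \<in> pairs n" for e k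
    unfolding bern_moment_def using q[OF that] by simp
  have m0: "?m e 0 = 1" and m1: "?m e 1 = 0" if "e \<in> pairs n" for e
    using mom[OF that, of 0] mom[OF that, of 1] by (simp_all add: algebra_simps)
  have m2: "\<bar>?m e k\<bar> \<le> \<alpha>" if e: "e \<in> pairs n" and k: "k \<ge> 2" for e k
  proof -
    note qe = q[OF e]
    have "\<bar>?m e k\<bar> \<le> q e * (1 - q e) ^ k + (1 - q e) * q e ^ k"
      unfolding mom[OF e] using qe by (intro order_trans[OF abs_triangle_ineq]) (simp add: abs_mult power_abs)
    also have "\<dots> \<le> q e * (1 - q e) ^ 2 + (1 - q e) * q e ^ 2"
      using qe k by (intro add_mono mult_left_mono power_decreasing) auto
    also have "\<dots> = q e * (1 - q e)" by (simp add: power2_eq_square algebra_simps)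
    also have "\<dots> \<le> q e * 1" using qe by (intro mult_left_mono) auto
    finally show ?thesis using qe by simp
  qed
  have term_le: "(\<Prod>e\<in>pairs n. ?m e (multiplicity_in ?L u e))
      \<le> (if heavy_walk ?L u then \<alpha> ^ edge_count ?L u else 0)"
    if u: "u \<in> closed_walks n ?L" "loopless ?L u" for u
  proof (cases "heavy_walk ?L u")
    case False
    then obtain e where e: "e \<in> pairs n" "multiplicity_in ?L u e = 1"
      using loopless_multiplicity(1)[OF u] by blast
    then have "(\<Prod>e\<in>pairs n. ?m e (multiplicity_in ?L u e)) = 0"
      using m1[OF e(1)] e by (intro prod_zero bexI[of _ e]) auto
    then show ?thesis using False by (simp only: if_False order_refl)
  next
    case True
    have "(\<Prod>e\<in>pairs n. ?m e (multiplicity_in ?L u e)) \<le> \<bar>\<Prod>e\<in>pairs n. ?m e (multiplicity_in ?L u e)\<bar>"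
      by simp
    also have "\<dots> = (\<Prod>e\<in>pairs n. \<bar>?m e (multiplicity_in ?L u e)\<bar>)"
      by (rule abs_prod)
    also have "\<dots> \<le> (\<Prod>e\<in>pairs n. if multiplicity_in ?L u e > 0 then \<alpha> else 1)"
    proof (rule prod_mono)
      fix e assume e: "e \<in> pairs n"
      then have "multiplicity_in ?L u e = 0 \<or> multiplicity_in ?L u e \<ge> 2"
        using True loopless_multiplicity(1)[OF u] by (metis One_nat_def less_2_cases not_le)
      then show "0 \<le> \<bar>?m e (multiplicity_in ?L u e)\<bar> \<and> \<bar>?m e (multiplicity_in ?L u e)\<bar>
          \<le> (if multiplicity_in ?L u e > 0 then \<alpha> else 1)"
        using m0[OF e] m2[OF e] by auto
    qed
    also have "\<dots> = \<alpha> ^ card {e \<in> pairs n. multiplicity_in ?L u e > 0}"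
      by (subst prod.inter_filter[symmetric]) auto
    finally show ?thesis using True loopless_multiplicity(2)[OF u] by simp
  qed
  have "measure_pmf.expectation (edge_law n q) (\<lambda>E. frob2 n (fpow n (edge_matrix ?f E) p))
      \<le> (\<Sum>u\<in>{u \<in> closed_walks n ?L. loopless ?L u}. if heavy_walk ?L u then \<alpha> ^ edge_count ?L u else 0)"
    unfolding expectation_frob2 by (rule sum_mono) (use term_le in auto)
  also have "\<dots> = (\<Sum>u\<in>{u \<in> closed_walks n ?L. heavy_walk ?L u}. \<alpha> ^ edge_count ?L u)"
    using finite_closed_walks
    by (intro sum.mono_neutral_cong_right) (auto simp: heavy_walk_def loopless_def)
  finally show ?thesis .
qed

section \<open>The comparison matrix and its lower moment bound\<close>

definition skew_sign :: "nat \<times> nat \<Rightarrow> bool \<Rightarrow> real" where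
  "skew_sign e b = (if b then 2 else - 1)"

text \<open>
  The two-point law on \<open>{2, -1}\<close> is centered and has all moments of order at least two bounded
  below by one; a symmetric law would lose the odd moments.
\<close>
lemma skew_moment:
  shows "bern_moment (\<lambda>_. 1 / 3) skew_sign e 1 = 0"
    and "bern_moment (\<lambda>_. 1 / 3) skew_sign e k \<ge> 0"
    and "k \<noteq> 1 \<Longrightarrow> bern_moment (\<lambda>_. 1 / 3) skew_sign e k \<ge> 1"
proof -
  have mom: "bern_moment (\<lambda>_. 1 / 3) skew_sign e k = (2 ^ k + 2 * (- 1) ^ k) / 3" for k
    by (simp add: bern_moment_def skew_sign_def)
  show m1: "bern_moment (\<lambda>_. 1 / 3) skew_sign e 1 = 0" by (simp add: mom)
  show m2: "bern_moment (\<lambda>_. 1 / 3) skew_sign e k \<ge> 1" if "k \<noteq> 1" for k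
  proof (cases "even k")
    case True
    have "(2::real) ^ k \<ge> 1" by simp
    then show ?thesis using True by (simp add: mom)
  next
    case False
    then have "k \<ge> 3" using that by (elim oddE) auto
    then have "(2::real) ^ 3 \<le> 2 ^ k" by (intro power_increasing) auto
    then show ?thesis using False by (simp add: mom)
  qed
  show "bern_moment (\<lambda>_. 1 / 3) skew_sign e k \<ge> 0"
    using m1 m2[of k] by (cases "k = 1") auto
qed

text \<open>No cancellation occurs: every loopless walk has nonnegative weight, and every heavy one
  has weight at least 1.\<close>

lemma expectation_frob2_skew_ge:
  "real (card {u \<in> closed_walks r (2 * p). heavy_walk (2 * p) u})
    \<le> measure_pmf.expectation (edge_law r (\<lambda>_. 1 / 3)) (\<lambda>E. frob2 r (fpow r (edge_matrix skew_sign E) p))"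
proof -
  let ?L = "2 * p"
  let ?P = "\<lambda>u. \<Prod>e\<in>pairs r. bern_moment (\<lambda>_. 1 / 3) skew_sign e (multiplicity_in ?L u e)"
  have ge: "?P u \<ge> 1" if "u \<in> closed_walks r ?L" "loopless ?L u" "heavy_walk ?L u" for u
    using loopless_multiplicity(1)[OF that(1,2)] that(3)
    by (intro prod_ge_1 skew_moment(3)) auto
  have "real (card {u \<in> closed_walks r ?L. heavy_walk ?L u}) = (\<Sum>u\<in>{u \<in> closed_walks r ?L. heavy_walk ?L u}. 1)"
    by simp
  also have "\<dots> \<le> (\<Sum>u\<in>{u \<in> closed_walks r ?L. heavy_walk ?L u}. ?P u)"
    by (rule sum_mono) (use ge in \<open>auto simp: heavy_walk_def loopless_def\<close>)
  also have "\<dots> \<le> (\<Sum>u\<in>{u \<in> closed_walks r ?L. loopless ?L u}. ?P u)"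
    using finite_closed_walks
    by (intro sum_mono2 prod_nonneg skew_moment(2)) (auto simp: heavy_walk_def loopless_def)
  finally show ?thesis unfolding expectation_frob2 .
qed

section \<open>Operator norm and lattice nets\<close>

definition bilin :: "nat \<Rightarrow> (nat \<Rightarrow> nat \<Rightarrow> real) \<Rightarrow> (nat \<Rightarrow> real) \<Rightarrow> (nat \<Rightarrow> real) \<Rightarrow> real" where
  "bilin r a x y = (\<Sum>i<r. x i * mat_app r a y i)"

text \<open>Integer points in the ball of radius 5 sqrt r. After division by 4 sqrt r they lie in
  the ball of radius 5/4 = 1 + 1/4, and rounding a point of the unit ball to them costs at most 1/4.
  The box displays the finiteness and supplies a product set for counting.\<close>

definition lattice_net :: "nat \<Rightarrow> (nat \<Rightarrow> int) set" where
  "lattice_net r = {z \<in> {..<r} \<rightarrow>\<^sub>E {- int (5 * r)..int (5 * r)}. (\<Sum>i<r. (z i)\<^sup>2) \<le> 25 * int r}"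

definition net_point :: "nat \<Rightarrow> (nat \<Rightarrow> int) \<Rightarrow> nat \<Rightarrow> real" where
  "net_point r z i = real_of_int (z i) / (4 * sqrt (real r))"

lemma finite_lattice_net: "finite (lattice_net r)"
  by (rule finite_subset[of _ "{..<r} \<rightarrow>\<^sub>E {- int (5 * r)..int (5 * r)}"])
    (auto simp: lattice_net_def intro!: finite_PiE)

lemma sum_half_power_abs_le: "(\<Sum>k\<in>{- int b..int b}. (1 / 2 :: real) ^ nat \<bar>k\<bar>) \<le> 4"
proof -
  let ?f = "\<lambda>k::int. (1 / 2 :: real) ^ nat \<bar>k\<bar>"
  have g: "(\<Sum>k<Suc b. (1 / 2 :: real) ^ k) \<le> 2"
    by (subst sum_gp_strict) simp
  have "{- int b..int b} \<subseteq> int ` {..<Suc b} \<union> (\<lambda>k. - int k) ` {..<Suc b}"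
  proof
    fix k assume "k \<in> {- int b..int b}"
    then have "k = int (nat k) \<and> nat k < Suc b \<or> k = - int (nat (- k)) \<and> nat (- k) < Suc b"
      by auto
    then show "k \<in> int ` {..<Suc b} \<union> (\<lambda>k. - int k) ` {..<Suc b}"
      by blast
  qed
  then have "sum ?f {- int b..int b} \<le> sum ?f (int ` {..<Suc b} \<union> (\<lambda>k. - int k) ` {..<Suc b})"
    by (intro sum_mono2) auto
  also have "\<dots> \<le> sum ?f (int ` {..<Suc b}) + sum ?f ((\<lambda>k. - int k) ` {..<Suc b})"
    by (subst sum_Un) (auto intro: sum_nonneg)
  also have "\<dots> = (\<Sum>k<Suc b. (1 / 2) ^ k) + (\<Sum>k<Suc b. (1 / 2) ^ k)"
    by (subst (1 2) sum.reindex) (auto simp: inj_on_def)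
  also have "\<dots> \<le> 4" using g by simp
  finally show ?thesis .
qed

text \<open>Chernoff-type counting: every point of the net has weight at least \<open>2 ^ (- 25 r)\<close>.\<close>
lemma card_lattice_net_le: "real (card (lattice_net r)) \<le> (4 * 2 ^ 25) ^ r"
proof -
  let ?w = "\<lambda>z. \<Prod>i<r. (1 / 2 :: real) ^ nat \<bar>z i\<bar>"
  let ?S = "{- int (5 * r)..int (5 * r)}"
  have w: "(1 / 2) ^ (25 * r) \<le> ?w z" if "z \<in> lattice_net r" for z
  proof -
    \<comment> \<open>For integers the absolute value is at most the square, so the bound on the
      Euclidean norm also bounds the exponent of the weight.\<close>
    have "int (\<Sum>i<r. nat \<bar>z i\<bar>) = (\<Sum>i<r. \<bar>z i\<bar>)" by simp
    also have "\<dots> \<le> (\<Sum>i<r. (z i)\<^sup>2)"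
    proof (rule sum_mono)
      fix i
      have "\<bar>z i\<bar> * 1 \<le> \<bar>z i\<bar> * \<bar>z i\<bar>"
      proof (cases "z i = 0")
        case False
        then show ?thesis by (intro mult_left_mono) auto
      qed simp
      then show "\<bar>z i\<bar> \<le> (z i)\<^sup>2" by (simp add: power2_eq_square)
    qed
    also have "\<dots> \<le> int (25 * r)" using that by (simp add: lattice_net_def)
    finally have "(\<Sum>i<r. nat \<bar>z i\<bar>) \<le> 25 * r" by linarith
    then have "(1 / 2 :: real) ^ (25 * r) \<le> (1 / 2) ^ (\<Sum>i<r. nat \<bar>z i\<bar>)"
      by (intro power_decreasing) auto
    then show ?thesis by (simp add: power_sum)
  qed
  have "real (card (lattice_net r)) * (1 / 2) ^ (25 * r) = (\<Sum>z\<in>lattice_net r. (1 / 2) ^ (25 * r))"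
    by simp
  also have "\<dots> \<le> (\<Sum>z\<in>lattice_net r. ?w z)"
    by (intro sum_mono w)
  also have "\<dots> \<le> (\<Sum>z\<in>{..<r} \<rightarrow>\<^sub>E ?S. ?w z)"
  proof (rule sum_mono2)
    show "lattice_net r \<subseteq> {..<r} \<rightarrow>\<^sub>E ?S" unfolding lattice_net_def by blast
    show "finite ({..<r} \<rightarrow>\<^sub>E ?S)" by (rule finite_PiE) simp_all
    show "0 \<le> ?w z" for z :: "nat \<Rightarrow> int" by (rule prod_nonneg) simp
  qed
  also have "\<dots> = (\<Prod>i<r. \<Sum>k\<in>?S. (1 / 2) ^ nat \<bar>k\<bar>)"
    by (rule prod_sum_PiE[of "{..<r}" "\<lambda>_. ?S" "\<lambda>_ k. (1 / 2 :: real) ^ nat \<bar>k\<bar>", symmetric]) simp_all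
  also have "\<dots> = (\<Sum>k\<in>?S. (1 / 2 :: real) ^ nat \<bar>k\<bar>) ^ r"
    by simp
  also have "\<dots> \<le> 4 ^ r"
    by (intro power_mono sum_half_power_abs_le sum_nonneg) simp
  finally have "real (card (lattice_net r)) * (1 / 2) ^ (25 * r) \<le> 4 ^ r" .
  then have "real (card (lattice_net r)) \<le> 4 ^ r * 2 ^ (25 * r)"
    by (simp add: power_one_over field_simps)
  then show ?thesis
    by (simp only: power_mult_distrib power_mult)
qed

lemma L2_set_le_iff: "c \<ge> 0 \<Longrightarrow> L2_set f S \<le> c \<longleftrightarrow> (\<Sum>i\<in>S. (f i)\<^sup>2) \<le> c\<^sup>2"
  using L2_set_power2[of f S] by (metis L2_set_nonneg power2_le_imp_le power_mono)

lemma net_point_norm_le: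
  assumes "r > 0" "z \<in> lattice_net r"
  shows "L2_set (net_point r z) {..<r} \<le> 5 / 4"
proof -
  have "(\<Sum>i<r. (net_point r z i)\<^sup>2) = real_of_int (\<Sum>i<r. (z i)\<^sup>2) / (16 * real r)"
    by (simp add: net_point_def power_divide power_mult_distrib sum_divide_distrib)
  also have "\<dots> \<le> real_of_int (25 * int r) / (16 * real r)"
    using assms by (intro divide_right_mono) (auto simp: lattice_net_def simp del: of_int_sum of_int_mult)
  also have "\<dots> = (5 / 4)\<^sup>2" using assms by (simp add: power2_eq_square)
  finally show ?thesis by (subst L2_set_le_iff) auto
qed

text \<open>Rounding down moves each coordinate by at most 1 / (4 sqrt r), so the total error is at
  most 1/4; the norm bound on the rounded point then follows from the triangle inequality.\<close>

lemma lattice_net_rounding: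
  assumes r: "r > 0" and x: "L2_set x {..<r} \<le> 1"
  obtains z where "z \<in> lattice_net r" "L2_set (\<lambda>i. x i - net_point r z i) {..<r} \<le> 1 / 4"
proof
  define s where "s = 4 * sqrt (real r)"
  have s: "s > 0" "s\<^sup>2 = 16 * real r" using r by (auto simp: s_def power_mult_distrib)
  define z where "z = (\<lambda>i\<in>{..<r}. \<lfloor>s * x i\<rfloor>)"
  have d: "\<bar>x i - net_point r z i\<bar> \<le> 1 / s" if "i < r" for i
  proof -
    have "x i - net_point r z i = (s * x i - real_of_int \<lfloor>s * x i\<rfloor>) / s"
      using s that unfolding net_point_def s_def[symmetric] by (simp add: z_def field_simps)
    moreover have "\<bar>s * x i - real_of_int \<lfloor>s * x i\<rfloor>\<bar> \<le> 1" by linarith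
    ultimately show ?thesis using s by (simp add: divide_right_mono)
  qed
  have "(\<Sum>i<r. (x i - net_point r z i)\<^sup>2) \<le> (\<Sum>i<r. (1 / s)\<^sup>2)"
  proof (rule sum_mono)
    fix i assume "i \<in> {..<r}"
    then show "(x i - net_point r z i)\<^sup>2 \<le> (1 / s)\<^sup>2"
      using power_mono[OF d, of i 2] by simp
  qed
  also have "\<dots> = (1 / 4)\<^sup>2"
    using s r by (simp add: power_divide)
  finally show close: "L2_set (\<lambda>i. x i - net_point r z i) {..<r} \<le> 1 / 4"
    by (subst L2_set_le_iff) auto
  have "L2_set (net_point r z) {..<r} = L2_set (\<lambda>i. x i + (- (x i - net_point r z i))) {..<r}"
    by simp
  also have "\<dots> \<le> L2_set x {..<r} + L2_set (\<lambda>i. - (x i - net_point r z i)) {..<r}"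
    by (rule L2_set_triangle_ineq)
  also have "L2_set (\<lambda>i. - (x i - net_point r z i)) {..<r} = L2_set (\<lambda>i. x i - net_point r z i) {..<r}"
    by (simp add: L2_set_def power2_commute)
  finally have "L2_set (net_point r z) {..<r} \<le> 5 / 4"
    using x close by linarith
  then have "(\<Sum>i<r. (net_point r z i)\<^sup>2) \<le> (5 / 4)\<^sup>2"
    by (subst (asm) L2_set_le_iff) auto
  then have "(\<Sum>i<r. (real_of_int (z i))\<^sup>2) / s\<^sup>2 \<le> (5 / 4)\<^sup>2"
    by (simp add: net_point_def s_def[symmetric] power_divide sum_divide_distrib)
  then have "(\<Sum>i<r. (real_of_int (z i))\<^sup>2) \<le> 25 * real r"
    using s r by (simp add: field_simps power2_eq_square)
  then have le: "(\<Sum>i<r. (z i)\<^sup>2) \<le> 25 * int r"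
    by (metis (mono_tags, lifting) of_int_le_iff of_int_mult of_int_numeral of_int_of_nat_eq of_int_power of_int_sum sum.cong)
  have "\<bar>z i\<bar> \<le> int (5 * r)" if i: "i < r" for i
  proof -
    have "(z i)\<^sup>2 \<le> (\<Sum>i<r. (z i)\<^sup>2)" using i by (intro member_le_sum) auto
    also have "\<dots> \<le> 25 * (int r * int r)" using le r by (smt (verit) mult_le_cancel_left1 of_nat_0_less_iff)
    also have "\<dots> = (int (5 * r))\<^sup>2" by (simp add: power2_eq_square)
    finally show ?thesis by (metis abs_le_square_iff abs_of_nat)
  qed
  then show "z \<in> lattice_net r"
    using le by (auto simp: lattice_net_def z_def abs_le_iff PiE_iff) (smt (verit))+
qed

section \<open>Bilinear forms and the passage from the net to the operator norm\<close>

lemma bilin_abs_le: "\<bar>bilin r a x y\<bar> \<le> L2_set x {..<r} * L2_set (mat_app r a y) {..<r}"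
  unfolding bilin_def by (rule L2_set_inner_le)

lemma bilin_add:
  "bilin r a (\<lambda>i. x i + x' i) y = bilin r a x y + bilin r a x' y"
  "bilin r a x (\<lambda>i. y i + y' i) = bilin r a x y + bilin r a x y'"
  by (simp_all add: bilin_def mat_app_def sum.distrib algebra_simps)

lemma bilin_scale: "bilin r a (\<lambda>i. c * x i) (\<lambda>i. d * y i) = c * d * bilin r a x y"
  by (simp add: bilin_def mat_app_def sum_distrib_left mult_ac)

lemma L2_set_scale: "L2_set (\<lambda>i. c * x i) S = \<bar>c\<bar> * L2_set x S"
  by (simp add: L2_set_def power_mult_distrib sum_distrib_left[symmetric] real_sqrt_mult)

lemma bilin_homogeneous_le:
  assumes M: "\<And>x y. L2_set x {..<r} \<le> 1 \<Longrightarrow> L2_set y {..<r} \<le> 1 \<Longrightarrow> \<bar>bilin r a x y\<bar> \<le> M"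
    and "c > 0" "d > 0" "L2_set x {..<r} \<le> c" "L2_set y {..<r} \<le> d"
  shows "\<bar>bilin r a x y\<bar> \<le> c * d * M"
proof -
  have "\<bar>bilin r a (\<lambda>i. (1 / c) * x i) (\<lambda>i. (1 / d) * y i)\<bar> \<le> M"
    by (rule M) (use assms in \<open>simp_all only: L2_set_scale, simp_all add: field_simps\<close>)
  then show ?thesis
    using assms(2,3) by (simp only: bilin_scale) (simp add: abs_mult field_simps)
qed

text \<open>Rounding both arguments shows that the supremum M over the unit ball satisfies M \<le>
  \<tau> + (5/16 + 1/4) M, hence M \<le> 4 \<tau>. The Frobenius norm guarantees that M is finite,
  without which the self-bound says nothing.\<close>

lemma L2_set_mat_app_le_net:
  assumes r: "r > 0"
    and \<tau>: "\<And>z w. z \<in> lattice_net r \<Longrightarrow> w \<in> lattice_net r \<Longrightarrow> \<bar>bilin r a (net_point r z) (net_point r w)\<bar> \<le> \<tau>"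
  shows "L2_set (mat_app r a x) {..<r} \<le> 4 * \<tau> * L2_set x {..<r}"
proof -
  let ?B = "{\<bar>bilin r a x y\<bar> | x y. L2_set x {..<r} \<le> 1 \<and> L2_set y {..<r} \<le> 1}"
  define M where "M = Sup ?B"
  have zero: "L2_set (\<lambda>_. 0) {..<r} \<le> 1" by (simp add: L2_set_def)
  have ne: "?B \<noteq> {}" using zero by blast
  have bdd: "bdd_above ?B"
  proof (rule bdd_aboveI)
    fix b assume "b \<in> ?B"
    then obtain x y where b: "b = \<bar>bilin r a x y\<bar>" "L2_set x {..<r} \<le> 1" "L2_set y {..<r} \<le> 1" by auto
    have "b \<le> L2_set x {..<r} * L2_set (mat_app r a y) {..<r}" using bilin_abs_le b by simp
    also have "\<dots> \<le> 1 * (sqrt (frob2 r a) * 1)"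
    proof (rule mult_mono)
      have "L2_set (mat_app r a y) {..<r} \<le> sqrt (frob2 r a) * L2_set y {..<r}"
        using mat_app_frob2_le[where x = y] by (simp add: mat_app_def[abs_def])
      also have "\<dots> \<le> sqrt (frob2 r a) * 1"
        using b by (intro mult_left_mono) (auto simp: frob2_def sum_nonneg)
      finally show "L2_set (mat_app r a y) {..<r} \<le> sqrt (frob2 r a) * 1" .
    qed (use b in auto)
    finally show "b \<le> 1 * (sqrt (frob2 r a) * 1)" .
  qed
  have M: "\<bar>bilin r a x y\<bar> \<le> M" if "L2_set x {..<r} \<le> 1" "L2_set y {..<r} \<le> 1" for x y
    unfolding M_def by (rule cSup_upper[OF _ bdd]) (use that in blast)
  have "M \<le> \<tau> + 9 / 16 * M"
    unfolding M_def
  proof (rule cSup_least[OF ne])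
    fix b assume "b \<in> ?B"
    then obtain x y where b: "b = \<bar>bilin r a x y\<bar>" "L2_set x {..<r} \<le> 1" "L2_set y {..<r} \<le> 1" by auto
    obtain z where z: "z \<in> lattice_net r" "L2_set (\<lambda>i. x i - net_point r z i) {..<r} \<le> 1 / 4"
      using lattice_net_rounding[OF r b(2)] .
    obtain w where w: "w \<in> lattice_net r" "L2_set (\<lambda>i. y i - net_point r w i) {..<r} \<le> 1 / 4"
      using lattice_net_rounding[OF r b(3)] .
    let ?x' = "net_point r z" and ?y' = "net_point r w"
    let ?d = "\<lambda>i. x i - ?x' i" and ?d' = "\<lambda>i. y i - ?y' i"
    have "bilin r a x y = bilin r a (\<lambda>i. ?x' i + ?d i) y" by simp
    also have "\<dots> = bilin r a ?x' y + bilin r a ?d y" by (rule bilin_add)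
    also have "bilin r a ?x' y = bilin r a ?x' (\<lambda>i. ?y' i + ?d' i)" by simp
    also have "\<dots> = bilin r a ?x' ?y' + bilin r a ?x' ?d'" by (rule bilin_add)
    finally have "b \<le> \<bar>bilin r a ?x' ?y'\<bar> + \<bar>bilin r a ?x' ?d'\<bar> + \<bar>bilin r a ?d y\<bar>"
      using b by linarith
    moreover have "\<bar>bilin r a ?x' ?y'\<bar> \<le> \<tau>" using \<tau> z w by blast
    moreover have "\<bar>bilin r a ?x' ?d'\<bar> \<le> (5 / 4) * (1 / 4) * M"
      by (rule bilin_homogeneous_le[OF M]) (use net_point_norm_le[OF r z(1)] w in auto)
    moreover have "\<bar>bilin r a ?d y\<bar> \<le> (1 / 4) * 1 * M"
      by (rule bilin_homogeneous_le[OF M]) (use z b in auto)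
    ultimately show "b \<le> \<tau> + 9 / 16 * Sup ?B" unfolding M_def by linarith
  qed
  moreover have "M \<ge> 0" using M[OF zero zero] by linarith
  ultimately have M4: "M \<le> 4 * \<tau>" by linarith
  let ?v = "mat_app r a x"
  show ?thesis
  proof (cases "L2_set ?v {..<r} = 0")
    case True
    then show ?thesis using \<open>M \<ge> 0\<close> M4 by simp
  next
    case False
    then have v: "L2_set ?v {..<r} > 0" by (simp add: order_less_le)
    have "L2_set x {..<r} \<noteq> 0"
    proof
      assume "L2_set x {..<r} = 0"
      then have "x j = 0" if "j < r" for j using that by (simp add: L2_set_eq_0_iff)
      then have "?v i = 0" for i by (auto simp: mat_app_def intro!: sum.neutral)
      then show False using False by (simp add: L2_set_def)
    qed
    then have x: "L2_set x {..<r} > 0" by (simp add: order_less_le)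
    \<comment> \<open>Testing the form on the image of x and x itself produces the square of the
      norm of the image.\<close>
    have "\<bar>bilin r a ?v x\<bar> \<le> L2_set ?v {..<r} * L2_set x {..<r} * M"
      by (rule bilin_homogeneous_le[OF M]) (use v x in auto)
    moreover have "bilin r a ?v x = L2_set ?v {..<r} * L2_set ?v {..<r}"
      unfolding bilin_def using L2_set_power2[of ?v "{..<r}"] by (simp add: power2_eq_square)
    ultimately have "L2_set ?v {..<r} \<le> L2_set x {..<r} * M"
      using v by simp
    also have "\<dots> \<le> L2_set x {..<r} * (4 * \<tau>)" using M4 by (intro mult_left_mono) auto
    finally show ?thesis by (simp add: mult_ac)
  qed
qed

text \<open>The columns of the power are images of unit vectors, so each contributes at most
  \<open>c ^ (2 * p)\<close>.\<close>

lemma frob2_fpow_le: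
  assumes c: "\<And>x. L2_set (mat_app r a x) {..<r} \<le> c * L2_set x {..<r}" and "c \<ge> 0"
  shows "frob2 r (fpow r a p) \<le> real r * c ^ (2 * p)"
proof -
  have it: "L2_set ((mat_app r a ^^ p) x) {..<r} \<le> c ^ p * L2_set x {..<r}" for x
  proof (induction p)
    case (Suc p)
    have "L2_set ((mat_app r a ^^ Suc p) x) {..<r} \<le> c * L2_set ((mat_app r a ^^ p) x) {..<r}"
      using c[of "(mat_app r a ^^ p) x"] by simp
    also have "\<dots> \<le> c * (c ^ p * L2_set x {..<r})" using Suc \<open>c \<ge> 0\<close> by (intro mult_left_mono) auto
    finally show ?case by (simp add: mult_ac)
  qed simp
  have "frob2 r (fpow r a p) = (\<Sum>j<r. \<Sum>i<r. (fpow r a p i j)\<^sup>2)"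
    unfolding frob2_def by (rule sum.swap)
  also have "\<dots> \<le> (\<Sum>j<r. c ^ (2 * p))"
  proof (rule sum_mono)
    fix j assume j: "j \<in> {..<r}"
    let ?e = "\<lambda>l. of_bool (j = l) :: real"
    have "fpow r a p i j = (mat_app r a ^^ p) ?e i" if "i < r" for i
      using that j sum_of_bool_eq_mult(1)[of "{..<r}" j "fpow r a p i"] by (simp add: mat_app_iterate mult.commute)
    then have "(\<Sum>i<r. (fpow r a p i j)\<^sup>2) = (L2_set ((mat_app r a ^^ p) ?e) {..<r})\<^sup>2"
      by (simp add: L2_set_power2)
    also have "\<dots> \<le> (c ^ p * L2_set ?e {..<r})\<^sup>2"
      using it by (intro power_mono) auto
    also have "L2_set ?e {..<r} = 1"
    proof -
      have "(\<Sum>i<r. (?e i)\<^sup>2) = (\<Sum>i<r. of_bool (j = i) * 1)" by (intro sum.cong) auto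
      then show ?thesis
        using j sum_of_bool_eq_mult(1)[of "{..<r}" j "\<lambda>_. 1::real"] by (simp add: L2_set_def)
    qed
    finally show "(\<Sum>i<r. (fpow r a p i j)\<^sup>2) \<le> c ^ (2 * p)"
      by (simp add: power_mult[symmetric] mult.commute)
  qed
  finally show ?thesis by simp
qed

section \<open>Moment comparison and Markov bound\<close>

text \<open>The linear term on the right cancels when this is averaged over a centered variable,
  leaving a sub-Gaussian bound.\<close>

lemma exp_le_add_exp_square: "exp x \<le> x + exp (x\<^sup>2 :: real)"
proof -
  have sq: "1 + x\<^sup>2 \<le> exp (x\<^sup>2)" by (rule exp_ge_add_one_self)
  consider "x > 1" | "0 \<le> x" "x \<le> 1" | "x < 0" by linarith
  then show ?thesis
  proof cases
    case 1
    then have "x \<le> x\<^sup>2" by (simp add: power2_eq_square)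
    then have "exp x \<le> exp (x\<^sup>2)" by simp
    then show ?thesis using 1 by linarith
  next
    case 2
    then show ?thesis using exp_bound[of x] sq by linarith
  next
    case 3
    \<comment> \<open>For y > 0 the Taylor minorant 1 + y + y^2/2 of exp y times 1 - y + y^2 is at
      least 1, which gives exp (-y) \<le> 1 - y + y^2.\<close>
    define y where "y = - x"
    have y: "y > 0" using 3 by (simp add: y_def)
    have "1 + y + y\<^sup>2 / 2 \<le> exp y" using y by (intro exp_lower_Taylor_quadratic) auto
    moreover have "1 - y + y\<^sup>2 > 0"
      using zero_le_power2[of "y - 1"] y by (simp add: power2_eq_square algebra_simps)
    ultimately have "(1 + y + y\<^sup>2 / 2) * (1 - y + y\<^sup>2) \<le> exp y * (1 - y + y\<^sup>2)"
      by (intro mult_right_mono) auto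
    moreover have "(1 + y + y\<^sup>2 / 2) * (1 - y + y\<^sup>2) = 1 + (y ^ 2 + y ^ 3 + y ^ 4) / 2"
      by (simp add: power2_eq_square power3_eq_cube power4_eq_xxxx field_simps)
    moreover have "0 \<le> (y ^ 2 + y ^ 3 + y ^ 4) / 2" using y by simp
    ultimately have "1 \<le> exp y * (1 - y + y\<^sup>2)" by linarith
    then have "exp (- y) \<le> 1 - y + y\<^sup>2" by (simp add: exp_minus field_simps)
    then have "exp x \<le> 1 + x + x\<^sup>2" by (simp add: y_def)
    then show ?thesis using sq by linarith
  qed
qed

text \<open>The left-hand side is the moment generating function of the law on 2 and -1 with weights
  1/3 and 2/3. Its mean is zero, so the linear terms cancel.\<close>

lemma mgf_skew_le: "(exp (2 * t) + 2 * exp (- t)) / 3 \<le> exp (4 * t\<^sup>2 :: real)"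
proof -
  have "exp (2 * t) \<le> 2 * t + exp (4 * t\<^sup>2)" "exp (- t) \<le> - t + exp (t\<^sup>2)"
    using exp_le_add_exp_square[of "2 * t"] exp_le_add_exp_square[of "- t"]
    by (simp_all add: power_mult_distrib)
  then have "exp (2 * t) + 2 * exp (- t) \<le> exp (4 * t\<^sup>2) + 2 * exp (t\<^sup>2)"
    by linarith
  also have "\<dots> \<le> exp (4 * t\<^sup>2) + 2 * exp (4 * t\<^sup>2)"
    by simp
  finally show ?thesis by simp
qed

lemma bilin_edge_matrix:
  "bilin r (edge_matrix f E) x y = (\<Sum>e\<in>pairs r. (x (fst e) * y (snd e) + x (snd e) * y (fst e)) * f e (E e))"
proof -
  let ?a = "edge_matrix f E"
  let ?g = "\<lambda>(i, j). x i * ?a i j * y j"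
  let ?up = "pairs r" and ?lo = "prod.swap ` pairs r"
  have "bilin r ?a x y = sum ?g ({..<r} \<times> {..<r})"
    by (simp add: bilin_def mat_app_def sum_distrib_left sum.cartesian_product mult.assoc)
  also have "\<dots> = sum ?g (?up \<union> ?lo)"
    by (intro sum.mono_neutral_right) (auto simp: pairs_def edge_matrix_def image_iff split: if_splits)
  also have "\<dots> = sum ?g ?up + sum ?g ?lo"
    by (intro sum.union_disjoint finite_imageI finite_pairs) (auto simp: pairs_def)
  also have "sum ?g ?lo = sum (?g \<circ> prod.swap) ?up"
    by (rule sum.reindex) (auto simp: inj_on_def)
  also have "sum ?g ?up + sum (?g \<circ> prod.swap) ?up = (\<Sum>e\<in>?up. ?g e + (?g \<circ> prod.swap) e)"
    by (simp add: sum.distrib)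
  also have "\<dots> = (\<Sum>e\<in>?up. (x (fst e) * y (snd e) + x (snd e) * y (fst e)) * f e (E e))"
    by (intro sum.cong) (auto simp: pairs_def edge_matrix_def algebra_simps)
  finally show ?thesis .
qed

text \<open>This is the variance proxy of the bilinear form. After splitting the square, each pair
  and its reversal contribute distinct cells of the full r by r grid.\<close>

lemma sum_pair_coeff_le:
  fixes x y :: "nat \<Rightarrow> real"
  shows "(\<Sum>e\<in>pairs r. (x (fst e) * y (snd e) + x (snd e) * y (fst e))\<^sup>2)
    \<le> 2 * (L2_set x {..<r})\<^sup>2 * (L2_set y {..<r})\<^sup>2"
proof -
  let ?h = "\<lambda>(i, j). (x i)\<^sup>2 * (y j)\<^sup>2"
  let ?up = "pairs r" and ?lo = "prod.swap ` pairs r"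
  have "(\<Sum>e\<in>?up. (x (fst e) * y (snd e) + x (snd e) * y (fst e))\<^sup>2)
      \<le> (\<Sum>e\<in>?up. 2 * (?h e + (?h \<circ> prod.swap) e))"
  proof (rule sum_mono)
    fix e :: "nat \<times> nat"
    have "(a + b)\<^sup>2 \<le> 2 * (a\<^sup>2 + b\<^sup>2)" for a b :: real
      using zero_le_power2[of "a - b"] by (simp add: power2_eq_square algebra_simps)
    from this[of "x (fst e) * y (snd e)" "x (snd e) * y (fst e)"]
    show "(x (fst e) * y (snd e) + x (snd e) * y (fst e))\<^sup>2 \<le> 2 * (?h e + (?h \<circ> prod.swap) e)"
      by (cases e) (simp add: power_mult_distrib)
  qed
  also have "\<dots> = 2 * (sum ?h ?up + sum (?h \<circ> prod.swap) ?up)"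
    by (simp add: sum_distrib_left sum.distrib)
  also have "sum (?h \<circ> prod.swap) ?up = sum ?h ?lo"
    by (rule sum.reindex[symmetric]) (auto simp: inj_on_def)
  also have "sum ?h ?up + sum ?h ?lo = sum ?h (?up \<union> ?lo)"
    by (intro sum.union_disjoint[symmetric] finite_imageI finite_pairs) (auto simp: pairs_def)
  also have "\<dots> \<le> sum ?h ({..<r} \<times> {..<r})"
    by (intro sum_mono2) (auto simp: pairs_def)
  also have "\<dots> = (L2_set x {..<r})\<^sup>2 * (L2_set y {..<r})\<^sup>2"
    by (simp add: L2_set_power2 sum_product sum.cartesian_product)
  finally show ?thesis by simp
qed

lemma expectation_exp_skew:
  "measure_pmf.expectation (bernoulli_pmf (1 / 3)) (\<lambda>b. exp (c * skew_sign e b))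
    = (exp (2 * c) + 2 * exp (- c)) / 3"
  by (simp add: skew_sign_def mult.commute)

lemma mgf_bilin_skew_le:
  assumes "L2_set x {..<r} \<le> 5 / 4" "L2_set y {..<r} \<le> 5 / 4"
  shows "measure_pmf.expectation (edge_law r (\<lambda>_. 1 / 3)) (\<lambda>E. exp (l * bilin r (edge_matrix skew_sign E) x y))
    \<le> exp (20 * l\<^sup>2)"
proof -
  let ?c = "\<lambda>e. l * (x (fst e) * y (snd e) + x (snd e) * y (fst e))"
  have "measure_pmf.expectation (edge_law r (\<lambda>_. 1 / 3)) (\<lambda>E. exp (l * bilin r (edge_matrix skew_sign E) x y))
      = measure_pmf.expectation (edge_law r (\<lambda>_. 1 / 3)) (\<lambda>E. \<Prod>e\<in>pairs r. exp (?c e * skew_sign e (E e)))"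
    by (simp add: bilin_edge_matrix sum_distrib_left exp_sum mult.assoc)
  also have "\<dots> = (\<Prod>e\<in>pairs r. measure_pmf.expectation (bernoulli_pmf (1 / 3)) (\<lambda>b. exp (?c e * skew_sign e b)))"
    by (rule expectation_prod_edge_law)
  also have "\<dots> \<le> (\<Prod>e\<in>pairs r. exp (4 * (?c e)\<^sup>2))"
  proof (rule prod_mono)
    fix e
    have "measure_pmf.expectation (bernoulli_pmf (1 / 3)) (\<lambda>b. exp (?c e * skew_sign e b))
      = (exp (2 * ?c e) + 2 * exp (- ?c e)) / 3"
      by (rule expectation_exp_skew)
    then show "0 \<le> measure_pmf.expectation (bernoulli_pmf (1 / 3)) (\<lambda>b. exp (?c e * skew_sign e b)) \<and>
       measure_pmf.expectation (bernoulli_pmf (1 / 3)) (\<lambda>b. exp (?c e * skew_sign e b)) \<le> exp (4 * (?c e)\<^sup>2)"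
      using mgf_skew_le[of "?c e"] by (simp add: add_nonneg_nonneg)
  qed
  also have "\<dots> = exp (4 * l\<^sup>2 * (\<Sum>e\<in>pairs r. (x (fst e) * y (snd e) + x (snd e) * y (fst e))\<^sup>2))"
    by (simp add: exp_sum power_mult_distrib sum_distrib_left mult_ac)
  also have "\<dots> \<le> exp (4 * l\<^sup>2 * 5)"
  proof -
    \<comment> \<open>The value 2 (5/4)^4 is just below 5, whence the exponent 4 * 5 = 20.\<close>
    have "2 * (L2_set x {..<r})\<^sup>2 * (L2_set y {..<r})\<^sup>2 \<le> 2 * (5 / 4)\<^sup>2 * (5 / 4)\<^sup>2"
      using assms by (intro mult_mono power_mono) auto
    also have "\<dots> \<le> (5::real)" by (simp add: power2_eq_square)
    finally have "(\<Sum>e\<in>pairs r. (x (fst e) * y (snd e) + x (snd e) * y (fst e))\<^sup>2) \<le> 5"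
      using sum_pair_coeff_le[of x y r] by linarith
    then show ?thesis
      by (intro iffD2[OF exp_le_cancel_iff] mult_left_mono) auto
  qed
  finally show ?thesis by simp
qed

text \<open>The inequality y \<le> exp y at y = x / k, raised to the k-th power. It converts
  exponential moments into polynomial ones.\<close>

lemma power_le_power_mult_exp:
  assumes "x \<ge> 0"
  shows "x ^ k \<le> real k ^ k * exp x"
proof (cases "k = 0")
  case False
  have "x / real k \<le> exp (x / real k)"
    using exp_ge_add_one_self[of "x / real k"] by linarith
  then have "(x / real k) ^ k \<le> exp (x / real k) ^ k"
    using assms by (intro power_mono) auto
  also have "\<dots> = exp x" using False by (simp flip: exp_of_nat_mult)
  finally show ?thesis using False by (simp add: power_divide field_simps)
qed (use assms in simp)

lemma moment_bilin_skew_le: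
  assumes r: "r > 0" and "L2_set x {..<r} \<le> 5 / 4" "L2_set y {..<r} \<le> 5 / 4"
  shows "measure_pmf.expectation (edge_law r (\<lambda>_. 1 / 3)) (\<lambda>E. (bilin r (edge_matrix skew_sign E) x y) ^ (2 * r))
    \<le> 2 * (4 * exp 20 * real r) ^ r"
proof -
  let ?E = "measure_pmf.expectation (edge_law r (\<lambda>_. 1 / 3))"
  let ?b = "\<lambda>E. bilin r (edge_matrix skew_sign E) x y"
  \<comment> \<open>At this scale exp (20 l^2) equals (exp 20)^r, so the moment of order 2 r loses
    only a factor geometric in r, like the size of the net.\<close>
  define l where "l = sqrt (real r)"
  have l: "l > 0" "l\<^sup>2 = real r" using r by (auto simp: l_def)
  have l2r: "l ^ (2 * r) = real r ^ r" using l by (simp add: power_mult)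
  have pt: "(?b E) ^ (2 * r) \<le> (4 * real r) ^ r * (exp (l * ?b E) + exp ((- l) * ?b E))" for E
  proof -
    have "real r ^ r * (?b E) ^ (2 * r) = \<bar>l * ?b E\<bar> ^ (2 * r)"
      by (simp add: power_even_abs l2r power_mult_distrib)
    also have "\<dots> \<le> real (2 * r) ^ (2 * r) * exp \<bar>l * ?b E\<bar>"
      by (rule power_le_power_mult_exp) simp
    also have "\<dots> \<le> real (2 * r) ^ (2 * r) * (exp (l * ?b E) + exp ((- l) * ?b E))"
      by (intro mult_left_mono) (auto simp: abs_if)
    also have "real (2 * r) ^ (2 * r) = real r ^ r * (4 * real r) ^ r"
    proof -
      have "real (2 * r) ^ (2 * r) = ((real (2 * r))\<^sup>2) ^ r" by (rule power_mult)
      also have "(real (2 * r))\<^sup>2 = real r * (4 * real r)" by (simp add: power2_eq_square)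
      finally show ?thesis by (simp only: power_mult_distrib)
    qed
    finally have "real r ^ r * (?b E) ^ (2 * r) \<le> real r ^ r * ((4 * real r) ^ r * (exp (l * ?b E) + exp ((- l) * ?b E)))"
      by (simp add: mult.assoc)
    then show ?thesis using r by (subst (asm) mult_le_cancel_left_pos) auto
  qed
  have "?E (\<lambda>E. (?b E) ^ (2 * r)) \<le> ?E (\<lambda>E. (4 * real r) ^ r * (exp (l * ?b E) + exp ((- l) * ?b E)))"
    by (rule integral_mono) (use pt in auto)
  also have "\<dots> = (4 * real r) ^ r * (?E (\<lambda>E. exp (l * ?b E)) + ?E (\<lambda>E. exp ((- l) * ?b E)))"
    by simp
  also have "\<dots> \<le> (4 * real r) ^ r * (exp (20 * l\<^sup>2) + exp (20 * (- l)\<^sup>2))"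
    by (intro mult_left_mono add_mono mgf_bilin_skew_le assms) simp
  also have "\<dots> = 2 * (4 * exp 20 * real r) ^ r"
    by (simp add: l power_mult_distrib exp_of_nat_mult[symmetric] mult_ac)
  finally show ?thesis .
qed

text \<open>The factor 16 is the square of the loss 4 in passing from the net to the norm,
  \<open>(4 * 2 ^ 25)\<^sup>2\<close> counts pairs of net points, and \<open>4 * exp 20\<close>
  comes from the moment of one form; the counting and moment factors are per unit of r.\<close>

definition skew_const :: real where
  "skew_const = 16 * ((4 * 2 ^ 25)\<^sup>2 * (4 * exp 20))"

text \<open>
  The union bound over the net is affordable only for moments of order at least \<open>2 r\<close>; the
  elementary inequality \<open>v ^ p \<le> 1 + v ^ r\<close> for \<open>p \<le> r\<close> transfers it to lower moments.
\<close>
lemma expectation_frob2_skew_le: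
  assumes r: "r > 0" and p: "p \<le> r"
  shows "measure_pmf.expectation (edge_law r (\<lambda>_. 1 / 3)) (\<lambda>E. frob2 r (fpow r (edge_matrix skew_sign E) p))
    \<le> 3 * real r * (skew_const * real r) ^ p"
proof -
  let ?E = "measure_pmf.expectation (edge_law r (\<lambda>_. 1 / 3))"
  let ?b = "\<lambda>z w E. bilin r (edge_matrix skew_sign E) (net_point r z) (net_point r w)"
  let ?N = "lattice_net r"
  define g :: real where "g = 4 * 2 ^ 25"
  define D where "D = g\<^sup>2 * (4 * exp 20) * real r"
  define S where "S = (\<lambda>E. \<Sum>z\<in>?N. \<Sum>w\<in>?N. (?b z w E) ^ (2 * r))"
  have D: "D > 0" "16 * D = skew_const * real r" using r by (auto simp: D_def g_def skew_const_def)
  have S0: "S E \<ge> 0" for E by (auto simp: S_def intro!: sum_nonneg)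
  have pt: "frob2 r (fpow r (edge_matrix skew_sign E) p) \<le> real r * (16 * D) ^ p * (1 + S E / D ^ r)" for E
  proof -
    \<comment> \<open>The l^(2r) norm of the values on the net bounds their maximum, and its power
      of order 2 r is a sum whose expectation can be computed termwise.\<close>
    define \<tau> where "\<tau> = root (2 * r) (S E)"
    have \<tau>: "\<tau> \<ge> 0" "\<tau> ^ (2 * r) = S E" using S0 r by (auto simp: \<tau>_def)
    have "\<bar>?b z w E\<bar> \<le> \<tau>" if zw: "z \<in> ?N" "w \<in> ?N" for z w
    proof -
      have "(?b z w E) ^ (2 * r) \<le> (\<Sum>w\<in>?N. (?b z w E) ^ (2 * r))"
        using zw finite_lattice_net by (intro member_le_sum) auto
      also have "\<dots> \<le> S E"
        unfolding S_def using zw finite_lattice_net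
        by (intro member_le_sum[of z ?N "\<lambda>z. \<Sum>w\<in>?N. (?b z w E) ^ (2 * r)"]) (auto intro!: sum_nonneg)
      finally have "\<bar>?b z w E\<bar> ^ (2 * r) \<le> \<tau> ^ (2 * r)" by (simp add: \<tau> power_even_abs)
      then show ?thesis using r \<tau> by (subst (asm) power_mono_iff) auto
    qed
    then have "L2_set (mat_app r (edge_matrix skew_sign E) x) {..<r} \<le> 4 * \<tau> * L2_set x {..<r}" for x
      by (intro L2_set_mat_app_le_net[OF r]) auto
    then have "frob2 r (fpow r (edge_matrix skew_sign E) p) \<le> real r * (4 * \<tau>) ^ (2 * p)"
      using \<tau> by (intro frob2_fpow_le) auto
    also have "(4 * \<tau>) ^ (2 * p) = (16 * D) ^ p * (\<tau>\<^sup>2 / D) ^ p"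
      using D(1) by (simp add: power_mult power_mult_distrib power_divide)
    also have "(\<tau>\<^sup>2 / D) ^ p \<le> 1 + (\<tau>\<^sup>2 / D) ^ r"
    proof (cases "\<tau>\<^sup>2 / D \<le> 1")
      case True
      then have "(\<tau>\<^sup>2 / D) ^ p \<le> 1" using D by (intro power_le_one) auto
      moreover have "(\<tau>\<^sup>2 / D) ^ r \<ge> 0" using D by auto
      ultimately show ?thesis by linarith
    next
      case False
      then have "(\<tau>\<^sup>2 / D) ^ p \<le> (\<tau>\<^sup>2 / D) ^ r" using p by (intro power_increasing) auto
      then show ?thesis by linarith
    qed
    also have "(\<tau>\<^sup>2 / D) ^ r = S E / D ^ r"
      by (simp add: power_divide \<tau>(2)[symmetric] power_mult)
    finally show ?thesis using D by (simp add: mult.assoc mult_left_mono)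
  qed
  have ES: "?E S \<le> 2 * D ^ r"
  proof -
    have "?E S = (\<Sum>z\<in>?N. \<Sum>w\<in>?N. ?E (\<lambda>E. (?b z w E) ^ (2 * r)))"
      by (simp add: S_def)
    also have "\<dots> \<le> (\<Sum>z\<in>?N. \<Sum>w\<in>?N. 2 * (4 * exp 20 * real r) ^ r)"
      by (intro sum_mono moment_bilin_skew_le net_point_norm_le r)
    also have "\<dots> = (real (card ?N))\<^sup>2 * (2 * (4 * exp 20 * real r) ^ r)"
      by (simp add: power2_eq_square)
    also have "\<dots> \<le> (g ^ r)\<^sup>2 * (2 * (4 * exp 20 * real r) ^ r)"
      unfolding g_def by (intro mult_right_mono power_mono card_lattice_net_le) auto
    also have "\<dots> = 2 * D ^ r"
      by (simp add: D_def power_mult_distrib power_mult[symmetric] mult_ac)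
    finally show ?thesis .
  qed
  have "?E (\<lambda>E. frob2 r (fpow r (edge_matrix skew_sign E) p)) \<le> ?E (\<lambda>E. real r * (16 * D) ^ p * (1 + S E / D ^ r))"
    by (rule integral_mono) (use pt in auto)
  also have "\<dots> = real r * (16 * D) ^ p * (1 + ?E S / D ^ r)"
    by (simp add: measure_pmf.prob_space)
  also have "\<dots> \<le> real r * (16 * D) ^ p * (1 + 2)"
    using ES D(1) by (intro mult_left_mono add_left_mono) (auto simp: field_simps)
  finally show ?thesis unfolding D(2) by (simp add: mult_ac)
qed

text \<open>The absolute constant is the one of the comparison matrix, with \<open>r \<le> 6 n \<alpha>\<close> and \<open>exp 4\<close> from Markov.\<close>
lemma centered_norm_bound:
  fixes \<alpha> :: real
  assumes n: "n \<ge> 2" and \<alpha>: "ln (real n) / real n \<le> \<alpha>" "\<alpha> \<le> 1"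
    and q: "\<And>e. e \<in> pairs n \<Longrightarrow> 0 \<le> q e \<and> q e \<le> \<alpha>"
  defines "t \<equiv> sqrt (6 * skew_const * exp 4) * sqrt (real n * \<alpha>)"
  shows "measure_pmf.prob (edge_law n q)
      {E. \<forall>x. L2_set (mat_app n (edge_matrix (\<lambda>e b. of_bool b - q e) E) x) {..<n} \<le> t * L2_set x {..<n}}
    \<ge> 1 - 1 / real n"
proof -
  let ?X = "edge_matrix (\<lambda>e b. of_bool b - q e)"
  let ?Z = "\<lambda>p E. frob2 n (fpow n (?X E) p)"
  let ?P = "measure_pmf.prob (edge_law n q)"
  \<comment> \<open>Large enough that exp (4 p) \<ge> n^4 beats the factor n in the trace bound, yet
    small enough that r stays of order n \<alpha>.\<close>
  define p where "p = nat \<lceil>ln (real n)\<rceil>"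
  define r where "r = nat \<lceil>real n * \<alpha>\<rceil> + p"
  \<comment> \<open>This absorbs the two roundings: r \<le> n \<alpha> + ln n + 2 \<le> 2 n \<alpha>
    + 2 \<le> 6 n \<alpha>, because n \<alpha> \<ge> ln n \<ge> 1/2.\<close>
  have ln2: "ln (real n) \<ge> 1 / 2"
  proof -
    have "exp (1 / 2 :: real) \<le> 2" using exp_half_le2 by simp
    then have "exp (1 / 2) \<le> real n" using n by linarith
    then show ?thesis using n by (subst ln_ge_iff) auto
  qed
  have na: "ln (real n) \<le> real n * \<alpha>" using \<alpha>(1) n by (simp add: field_simps)
  have "0 < real n * \<alpha>" using na ln2 by linarith
  then have \<alpha>0: "\<alpha> > 0" using n by (simp add: zero_less_mult_iff)
  have p: "p > 0" "ln (real n) \<le> real p" "real p \<le> ln (real n) + 1"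
    using ln2 by (auto simp: p_def)
  have r: "real n * \<alpha> + real p \<le> real r" "real r \<le> 6 * (real n * \<alpha>)" "r > 0" "p \<le> r"
    using p na ln2 by (auto simp: r_def) linarith+
  have sc: "skew_const > 0" by (simp add: skew_const_def)
  have t2: "t\<^sup>2 = 6 * skew_const * exp 4 * (real n * \<alpha>)" and t0: "t \<ge> 0"
    using sc \<alpha>0 by (simp_all add: t_def power_mult_distrib)
  have tpos: "t > 0" using t0 t2 sc \<alpha>0 n by (cases "t = 0") auto
  have "measure_pmf.expectation (edge_law n q) (?Z p)
      \<le> (\<Sum>u\<in>{u \<in> closed_walks n (2 * p). heavy_walk (2 * p) u}. \<alpha> ^ edge_count (2 * p) u)"
    by (rule expectation_frob2_centered_le) (use q \<alpha> \<alpha>0 in force)+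
  also have "\<dots> \<le> real n / real r * real (card {u \<in> closed_walks r (2 * p). heavy_walk (2 * p) u})"
    using n \<alpha> \<alpha>0 r by (intro heavy_walks_comparison) auto
  also have "\<dots> \<le> real n / real r * (3 * real r * (skew_const * real r) ^ p)"
    by (intro mult_left_mono order_trans[OF expectation_frob2_skew_ge expectation_frob2_skew_le] r) simp
  also have "\<dots> = 3 * real n * (skew_const * real r) ^ p" using r by simp
  also have "\<dots> \<le> 3 * real n * (skew_const * (6 * (real n * \<alpha>))) ^ p"
    using r sc by (intro mult_left_mono power_mono) auto
  finally have EZ: "measure_pmf.expectation (edge_law n q) (?Z p) \<le> 3 * real n * (skew_const * (6 * (real n * \<alpha>))) ^ p" .
  \<comment> \<open>Markov's inequality: the choice of t leaves 3 n / exp (4 p), which is at most 3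
    / n^3 and hence at most 1 / n for n \<ge> 2.\<close>
  have "?P {E. ?Z p E \<ge> t ^ (2 * p)} \<le> measure_pmf.expectation (edge_law n q) (?Z p) / t ^ (2 * p)"
    using integral_Markov_inequality_measure[of "measure_pmf (edge_law n q)" "?Z p" UNIV "t ^ (2 * p)"] tpos
    by (simp add: frob2_def sum_nonneg)
  also have "\<dots> \<le> 3 * real n * (skew_const * (6 * (real n * \<alpha>))) ^ p / t ^ (2 * p)"
    using EZ tpos by (intro divide_right_mono) auto
  also have "\<dots> = 3 * real n / exp 4 ^ p"
  proof -
    have "t ^ (2 * p) = exp 4 ^ p * (skew_const * (6 * (real n * \<alpha>))) ^ p"
      by (simp only: power_mult t2) (simp add: power_mult_distrib mult_ac)
    then show ?thesis using sc \<alpha>0 n by simp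
  qed
  also have "\<dots> \<le> 3 * real n / real n ^ 4"
  proof (intro divide_left_mono)
    have "real n ^ 4 = exp (ln (real n)) ^ 4" using n by simp
    also have "\<dots> \<le> exp (real p) ^ 4" using p by (intro power_mono) auto
    also have "\<dots> = exp 4 ^ p" by (simp flip: exp_of_nat_mult add: mult.commute)
    finally show "real n ^ 4 \<le> exp 4 ^ p" .
  qed (use n in auto)
  also have "\<dots> \<le> 1 / real n"
  proof -
    have "(2::real) ^ 2 \<le> real n ^ 2" using n by (intro power_mono) auto
    then show ?thesis using n by (simp add: field_simps power4_eq_xxxx power2_eq_square)
  qed
  finally have bad: "?P {E. ?Z p E \<ge> t ^ (2 * p)} \<le> 1 / real n" .
  have "1 - 1 / real n \<le> 1 - ?P {E. ?Z p E \<ge> t ^ (2 * p)}" using bad by simp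
  also have "\<dots> = ?P (UNIV - {E. ?Z p E \<ge> t ^ (2 * p)})"
    using measure_pmf.prob_compl[of "{E. ?Z p E \<ge> t ^ (2 * p)}"] by simp
  also have "\<dots> \<le> ?P {E. \<forall>x. L2_set (mat_app n (?X E) x) {..<n} \<le> t * L2_set x {..<n}}"
  proof (rule measure_pmf.finite_measure_mono)
    show "UNIV - {E. ?Z p E \<ge> t ^ (2 * p)}
        \<subseteq> {E. \<forall>x. L2_set (mat_app n (?X E) x) {..<n} \<le> t * L2_set x {..<n}}"
      using L2_set_mat_app_le[OF edge_matrix_sym p(1) t0] by (auto simp: not_le intro: less_imp_le)
  qed simp
  finally show ?thesis .
qed

section \<open>Symmetric matrices without the spectral theorem\<close>

text \<open>A trivial kernel forces a nonzero determinant, so the matrix is a unit of the matrix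
  ring. Only the right inverse is extracted, since it is applied in the form of
  surjectivity.\<close>

lemma exists_inverse_of_injective:
  fixes N :: "nat \<Rightarrow> nat \<Rightarrow> real"
  assumes inj: "\<And>v. (\<And>i. i < K \<Longrightarrow> mat_app K N v i = 0) \<Longrightarrow> \<forall>i<K. v i = 0"
  obtains B where "\<And>x i. i < K \<Longrightarrow> mat_app K N (mat_app K B x) i = x i"
proof -
  define M where "M = mat K K (\<lambda>(i, j). N i j)"
  have M: "M \<in> carrier_mat K K" by (simp add: M_def)
  have "det M \<noteq> 0"
  proof
    assume "det M = 0"
    then obtain v where v: "v \<in> carrier_vec K" "v \<noteq> 0\<^sub>v K" "M *\<^sub>v v = 0\<^sub>v K"
      using det_0_iff_vec_prod_zero_field[OF M] by blast
    have "mat_app K N (vec_index v) i = 0" if "i < K" for i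
      using arg_cong[OF v(3), of "\<lambda>w. w $ i"] v(1) that
      by (simp add: M_def mat_app_def scalar_prod_def lessThan_atLeast0)
    then have "\<forall>i<K. v $ i = 0" by (rule inj)
    then have "v = 0\<^sub>v K" using v(1) by auto
    then show False using v(2) by simp
  qed
  then have "M \<in> Units (ring_mat TYPE(real) K ())"
    by (rule det_non_zero_imp_unit[OF M])
  then obtain B where B: "B \<in> carrier_mat K K" "M * B = 1\<^sub>m K"
    unfolding Units_def ring_mat_simps by blast
  show ?thesis
  proof
    fix x :: "nat \<Rightarrow> real" and i assume i: "i < K"
    have "mat_app K N (mat_app K (\<lambda>i j. B $$ (i, j)) x) i = (\<Sum>k<K. \<Sum>j<K. N i j * B $$ (j, k) * x k)"
      unfolding mat_app_def sum_distrib_left by (subst sum.swap) (simp add: mult.assoc)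
    also have "\<dots> = (\<Sum>k<K. (M * B) $$ (i, k) * x k)"
      using i B(1) by (intro sum.cong) (auto simp: M_def scalar_prod_def sum_distrib_right lessThan_atLeast0)
    also have "\<dots> = (\<Sum>k<K. of_bool (i = k) * x k)"
      using i by (intro sum.cong) (auto simp: B(2))
    also have "\<dots> = x i" using i by (simp add: sum_of_bool_eq_mult)
    finally show "mat_app K N (mat_app K (\<lambda>i j. B $$ (i, j)) x) i = x i" .
  qed
qed

text \<open>A zero row pads the system to a square one. Were the padded matrix injective, its right
  inverse would produce a vector with last coordinate 1, which the zero row forbids.\<close>

lemma exists_nontrivial_kernel:
  fixes d :: "nat \<Rightarrow> nat \<Rightarrow> real"
  obtains c where "\<exists>j\<le>K. c j \<noteq> 0" "\<And>k. k < K \<Longrightarrow> (\<Sum>j\<le>K. d k j * c j) = 0"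
proof -
  define N where "N = (\<lambda>k j. if k < K then d k j else 0)"
  have "\<exists>c. (\<forall>i<Suc K. mat_app (Suc K) N c i = 0) \<and> (\<exists>j<Suc K. c j \<noteq> 0)"
  proof (rule ccontr)
    assume "\<not> ?thesis"
    then have inj: "(\<And>i. i < Suc K \<Longrightarrow> mat_app (Suc K) N v i = 0) \<Longrightarrow> \<forall>i<Suc K. v i = 0" for v
      by blast
    obtain B where B: "\<And>x i. i < Suc K \<Longrightarrow> mat_app (Suc K) N (mat_app (Suc K) B x) i = x i"
      using exists_inverse_of_injective[OF inj] by blast
    have "mat_app (Suc K) N (mat_app (Suc K) B (\<lambda>_. 1)) K = 0"
      by (subst mat_app_def) (simp add: N_def)
    then show False using B[of K "\<lambda>_. 1"] by simp
  qed
  then obtain c where c: "\<And>i. i < Suc K \<Longrightarrow> mat_app (Suc K) N c i = 0" "\<exists>j<Suc K. c j \<noteq> 0" by blast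
  show ?thesis
  proof
    show "\<exists>j\<le>K. c j \<noteq> 0" using c(2) by (simp add: less_Suc_eq_le)
    show "(\<Sum>j\<le>K. d k j * c j) = 0" if "k < K" for k
      using c(1)[of k] that by (simp add: mat_app_def N_def lessThan_Suc_atMost)
  qed
qed

lemma mat_app_linear:
  "mat_app n a (\<lambda>i. x i + c * y i) i = mat_app n a x i + c * mat_app n a y i"
  by (simp add: mat_app_def sum.distrib sum_distrib_left algebra_simps)

text \<open>Nonnegativity of the form at x + t y for all real t is the discriminant condition; the
  form may vanish at y, and then it is affine in t.\<close>

lemma psd_cauchy_schwarz:
  fixes N :: "nat \<Rightarrow> nat \<Rightarrow> real"
  assumes sym: "\<And>i j. N i j = N j i"
    and psd: "\<And>x. (\<Sum>i<K. mat_app K N x i * x i) \<ge> 0"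
  shows "(\<Sum>i<K. mat_app K N y i * x i)\<^sup>2 \<le> (\<Sum>i<K. mat_app K N y i * y i) * (\<Sum>i<K. mat_app K N x i * x i)"
proof -
  let ?q = "\<lambda>x y. \<Sum>i<K. mat_app K N x i * y i"
  have swap: "?q x y = ?q y x"
    using mat_app_self_adjoint[of N K x y, OF sym] by (simp add: mult.commute)
  have quad: "0 \<le> ?q x x + 2 * t * ?q y x + t\<^sup>2 * ?q y y" for t
  proof -
    have "?q (\<lambda>i. x i + t * y i) (\<lambda>i. x i + t * y i) = ?q x x + t * ?q x y + t * ?q y x + t\<^sup>2 * ?q y y"
      by (simp add: mat_app_linear algebra_simps sum.distrib sum_distrib_left power2_eq_square)
    then show ?thesis using psd[of "\<lambda>i. x i + t * y i"] swap by simp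
  qed
  show ?thesis
  proof (cases "?q y y = 0")
    case True
    have "?q y x = 0"
    proof (rule ccontr)
      assume ne: "?q y x \<noteq> 0"
      \<comment> \<open>Chosen so that the affine function of t takes the value -1.\<close>
      define t where "t = - (?q x x + 1) / (2 * ?q y x)"
      have "2 * t * ?q y x = - (?q x x + 1)" using ne by (simp add: t_def field_simps)
      then show False using quad[of t] by (simp add: True)
    qed
    then show ?thesis by (simp add: True)
  next
    case False
    then have pos: "?q y y > 0" using psd[of y] by simp
    from quad[of "- ?q y x / ?q y y"] pos
    have "0 \<le> ?q x x - (?q y x)\<^sup>2 / ?q y y"
      by (simp add: power2_eq_square field_simps)
    then show ?thesis using pos by (simp add: field_simps)
  qed
qed

text \<open>
  No spectral theorem is needed: if \<open>m\<close> is the infimum of \<open>|C x|\<^sup>2\<close> over unit vectors, the positive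
  semidefinite \<open>C\<^sup>2 - m\<close> cannot be invertible, and \<open>C\<^sup>2 - m = (C - \<surd>m) (C + \<surd>m)\<close>.
\<close>
lemma symmetric_eigenvalue_gap:
  fixes C :: "nat \<Rightarrow> nat \<Rightarrow> real"
  assumes sym: "\<And>i j. C i j = C j i"
    and gap: "\<And>\<mu> v. (\<exists>i<K. v i \<noteq> 0) \<Longrightarrow> (\<And>i. i < K \<Longrightarrow> mat_app K C v i = \<mu> * v i) \<Longrightarrow> \<gamma> \<le> \<bar>\<mu>\<bar>"
    and \<gamma>: "\<gamma> \<ge> 0"
  shows "\<gamma> * L2_set x {..<K} \<le> L2_set (mat_app K C x) {..<K}"
proof (cases "L2_set x {..<K} = 0")
  case False
  let ?n = "\<lambda>x. L2_set x {..<K}"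
  let ?R = "{(?n (mat_app K C x))\<^sup>2 | x. ?n x = 1}"
  define m where "m = Inf ?R"
  have bdd: "bdd_below ?R" by (rule bdd_belowI[of _ 0]) auto
  note scale = L2_set_scale[where S = "{..<K}"]
  have Cscale: "mat_app K C (\<lambda>i. c * x i) = (\<lambda>i. c * mat_app K C x i)" for c x
    by (auto simp: mat_app_def sum_distrib_left mult_ac)
  have "?n (\<lambda>i. (1 / ?n x) * x i) = 1" using False by (simp only: scale) simp
  then have ne: "?R \<noteq> {}" by blast
  have m0: "m \<ge> 0" unfolding m_def by (rule cInf_greatest[OF ne]) auto
  have m_le: "m * (?n y)\<^sup>2 \<le> (?n (mat_app K C y))\<^sup>2" for y
  proof (cases "?n y = 0")
    case False
    have "m \<le> (?n (mat_app K C (\<lambda>i. (1 / ?n y) * y i)))\<^sup>2"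
      unfolding m_def by (rule cInf_lower[OF _ bdd]) (use False scale[of "1 / ?n y" y] in auto)
    then show ?thesis
      using False by (simp only: Cscale scale) (simp add: power_mult_distrib power_divide field_simps)
  qed simp
  define N where "N = (\<lambda>i j. (\<Sum>l<K. C i l * C l j) - m * of_bool (i = j))"
  have Napp: "mat_app K N y i = mat_app K C (mat_app K C y) i - m * y i" if "i < K" for y i
  proof -
    have "mat_app K N y i = (\<Sum>j<K. (\<Sum>l<K. C i l * C l j) * y j - m * (of_bool (i = j) * y j))"
      by (simp add: mat_app_def N_def left_diff_distrib mult.assoc)
    also have "\<dots> = (\<Sum>j<K. (\<Sum>l<K. C i l * C l j) * y j) - m * (\<Sum>j<K. of_bool (i = j) * y j)"
      by (simp only: sum_subtractf sum_distrib_left)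
    also have "(\<Sum>j<K. (\<Sum>l<K. C i l * C l j) * y j) = (\<Sum>l<K. C i l * (\<Sum>j<K. C l j * y j))"
      unfolding sum_distrib_left sum_distrib_right by (subst sum.swap) (simp add: mult_ac)
    finally show ?thesis using that by (simp add: sum_of_bool_eq_mult mat_app_def)
  qed
  have Nsym: "N i j = N j i" for i j
    using sym by (auto simp: N_def mult.commute intro!: sum.cong)
  have Nq: "(\<Sum>i<K. mat_app K N y i * y i) = (?n (mat_app K C y))\<^sup>2 - m * (?n y)\<^sup>2" for y
  proof -
    have "(\<Sum>i<K. mat_app K N y i * y i) = (\<Sum>i<K. mat_app K C (mat_app K C y) i * y i) - m * (\<Sum>i<K. y i * y i)"
      using Napp by (simp add: left_diff_distrib sum_subtractf sum_distrib_left mult.assoc)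
    also have "(\<Sum>i<K. mat_app K C (mat_app K C y) i * y i) = (\<Sum>i<K. mat_app K C y i * mat_app K C y i)"
      by (rule mat_app_self_adjoint) (rule sym)
    finally show ?thesis unfolding L2_set_power2 by (simp add: power2_eq_square)
  qed
  have psd: "(\<Sum>i<K. mat_app K N y i * y i) \<ge> 0" for y using Nq m_le by simp
  obtain v where v: "\<And>i. i < K \<Longrightarrow> mat_app K N v i = 0" "\<exists>i<K. v i \<noteq> 0"
  proof (rule ccontr)
    assume "\<not> thesis"
    then have inj: "(\<And>i. i < K \<Longrightarrow> mat_app K N v i = 0) \<Longrightarrow> \<forall>i<K. v i = 0" for v
      using that by blast
    obtain B where B: "\<And>x i. i < K \<Longrightarrow> mat_app K N (mat_app K B x) i = x i"
      using exists_inverse_of_injective[OF inj] by blast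
    define b where "b = sqrt (frob2 K B) + 1"
    have b: "b > 0" by (simp add: b_def frob2_def sum_nonneg add_nonneg_pos)
    \<comment> \<open>If N had a right inverse of norm below b, then applying Cauchy-Schwarz for the
      form of N to y and its preimage would give 1 \<le> b (|C y|^2 - m) for every unit vector y,
      which pushes the infimum above m.\<close>
    have "m + 1 / b \<le> m"
      unfolding m_def
    proof (rule cInf_greatest[OF ne], clarify)
      fix y assume y: "?n y = 1"
      let ?z = "mat_app K B y"
      have zz: "(\<Sum>i<K. mat_app K N ?z i * ?z i) \<le> b"
      proof -
        have "(\<Sum>i<K. mat_app K N ?z i * ?z i) = (\<Sum>i<K. y i * ?z i)" using B by simp
        also have "\<dots> \<le> ?n y * ?n ?z" using L2_set_inner_le[of y ?z "{..<K}"] by linarith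
        also have "\<dots> \<le> sqrt (frob2 K B)"
          using mat_app_frob2_le[where n = K and a = B and x = y] y by (simp add: mat_app_def[abs_def])
        finally show ?thesis by (simp add: b_def)
      qed
      have "(\<Sum>i<K. mat_app K N ?z i * y i) = (?n y)\<^sup>2" using B unfolding L2_set_power2 by (simp add: power2_eq_square)
      then have "1 \<le> (\<Sum>i<K. mat_app K N ?z i * ?z i) * (\<Sum>i<K. mat_app K N y i * y i)"
        using psd_cauchy_schwarz[OF Nsym psd, of ?z y] y by simp
      also have "\<dots> \<le> b * ((?n (mat_app K C y))\<^sup>2 - m)"
        using zz psd[of y] Nq[of y] y b by (intro mult_mono) auto
      finally show "Inf ?R + 1 / b \<le> (?n (mat_app K C y))\<^sup>2"
        using b unfolding m_def[symmetric] by (simp add: field_simps)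
    qed
    then show False using b by simp
  qed
  define s where "s = sqrt m"
  have s: "s \<ge> 0" "s * s = m" using m0 by (auto simp: s_def)
  have CC: "mat_app K C (mat_app K C v) i = m * v i" if "i < K" for i
    using v(1)[OF that] Napp[OF that, of v] by simp
  \<comment> \<open>Here w = (C + s) v and (C - s) w = 0. Either w is an eigenvector for s, or w
    vanishes and v is an eigenvector for -s; in both cases s is the modulus of an
    eigenvalue.\<close>
  define w where "w = (\<lambda>i. mat_app K C v i + s * v i)"
  have "\<gamma> \<le> s"
  proof (cases "\<exists>i<K. w i \<noteq> 0")
    case True
    have "mat_app K C w i = s * w i" if "i < K" for i
      using CC[OF that] unfolding w_def mat_app_linear by (simp add: s(2)[symmetric] algebra_simps)
    then show ?thesis using gap[OF True] s by fastforce
  next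
    case False
    then have "mat_app K C v i = - s * v i" if "i < K" for i using that by (force simp: w_def)
    then show ?thesis using gap[OF v(2)] s by fastforce
  qed
  then have "\<gamma>\<^sup>2 \<le> m" using s \<gamma> by (metis mult_mono power2_eq_square)
  then have "(\<gamma> * ?n x)\<^sup>2 \<le> (?n (mat_app K C x))\<^sup>2"
    using m_le[of x] by (smt (verit) mult_right_mono power_mult_distrib zero_le_power2)
  then show ?thesis by (rule power2_le_imp_le) simp
qed simp

section \<open>Perturbation of the leading eigenspace\<close>

text \<open>
  \<open>V\<close> is the full eigenbasis of the observed matrix \<open>A\<close>; the columns of \<open>\<Phi>\<close> are the normalised
  community vectors, so that the mean matrix is \<open>P = \<Phi> C \<Phi>\<^sup>T\<close>.
\<close>
locale perturbed_block_matrix =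
  fixes n K :: nat and g :: "nat \<Rightarrow> nat" and \<psi> :: "nat \<Rightarrow> real"
    and C A V :: "nat \<Rightarrow> nat \<Rightarrow> real" and lam :: "nat \<Rightarrow> real" and \<gamma> s :: real
  assumes g: "\<And>i. i < n \<Longrightarrow> g i < K"
    and \<psi>_unit: "\<And>k. k < K \<Longrightarrow> (\<Sum>i\<in>{i \<in> {..<n}. g i = k}. (\<psi> i)\<^sup>2) = 1"
    and C_gap: "\<And>x. \<gamma> * L2_set x {..<K} \<le> L2_set (mat_app K C x) {..<K}"
    and A_sym: "\<And>i j. A i j = A j i"
    and \<gamma>: "\<gamma> > 0" and s0: "s \<ge> 0"
    and close: "\<And>x. L2_set (\<lambda>i. mat_app n A x i - mat_app n (\<lambda>i j. \<psi> i * C (g i) (g j) * \<psi> j) x i) {..<n}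
      \<le> s * L2_set x {..<n}"
    and Kn: "K \<le> n"
    and V_cols: "\<And>j l. j < n \<Longrightarrow> l < n \<Longrightarrow> (\<Sum>i<n. V i j * V i l) = of_bool (j = l)"
    and V_rows: "\<And>i l. i < n \<Longrightarrow> l < n \<Longrightarrow> (\<Sum>j<n. V i j * V l j) = of_bool (i = l)"
    and V_eig: "\<And>i j. i < n \<Longrightarrow> j < n \<Longrightarrow> mat_app n A (\<lambda>i. V i j) i = lam j * V i j"
    and lam_le: "\<And>j l. j < K \<Longrightarrow> K \<le> l \<Longrightarrow> l < n \<Longrightarrow> \<bar>lam l\<bar> \<le> \<bar>lam j\<bar>"
begin

definition P :: "nat \<Rightarrow> nat \<Rightarrow> real" where
  "P i j = \<psi> i * C (g i) (g j) * \<psi> j"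

text \<open>In matrix notation \<open>lift\<close> is multiplication by \<Phi>, \<open>proj\<close>
  by its transpose and \<open>coord\<close> by the transpose of V; \<open>M\<close> is the overlap
  matrix \<Phi>^T V. The first K columns of \<open>M\<close> form the nearly orthogonal K by K
  matrix.\<close>

definition lift :: "(nat \<Rightarrow> real) \<Rightarrow> nat \<Rightarrow> real" where
  "lift y i = \<psi> i * y (g i)"

definition coord :: "(nat \<Rightarrow> real) \<Rightarrow> nat \<Rightarrow> real" where
  "coord x j = (\<Sum>i<n. V i j * x i)"

definition proj :: "(nat \<Rightarrow> real) \<Rightarrow> nat \<Rightarrow> real" where
  "proj x k = (\<Sum>i\<in>{i \<in> {..<n}. g i = k}. \<psi> i * x i)"

definition M :: "nat \<Rightarrow> nat \<Rightarrow> real" where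
  "M k l = proj (\<lambda>i. V i l) k"

lemma sum_by_label: "(\<Sum>i<n. f i) = (\<Sum>k<K. \<Sum>i\<in>{i \<in> {..<n}. g i = k}. f i)" for f :: "nat \<Rightarrow> real"
  using g by (intro sum.group[symmetric]) auto

lemma sum_lift: "(\<Sum>i<n. lift y i * x i) = (\<Sum>k<K. y k * proj x k)"
  unfolding sum_by_label[of "\<lambda>i. lift y i * x i"] proj_def sum_distrib_left
  by (intro sum.cong) (auto simp: lift_def)

lemma proj_lift:
  assumes "k < K"
  shows "proj (lift y) k = y k"
proof -
  have "proj (lift y) k = (\<Sum>i\<in>{i \<in> {..<n}. g i = k}. (\<psi> i)\<^sup>2) * y k"
    unfolding proj_def sum_distrib_right by (intro sum.cong) (auto simp: lift_def power2_eq_square)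
  then show ?thesis using \<psi>_unit[OF assms] by simp
qed

lemma L2_lift: "L2_set (lift y) {..<n} = L2_set y {..<K}"
proof -
  have "(\<Sum>i<n. lift y i * lift y i) = (\<Sum>k<K. y k * y k)"
    unfolding sum_lift by (intro sum.cong) (auto simp: proj_lift)
  then show ?thesis by (simp add: L2_set_def power2_eq_square)
qed

lemma P_app: "i < n \<Longrightarrow> mat_app n P x i = lift (mat_app K C (proj x)) i"
proof -
  assume "i < n"
  have "mat_app n P x i = \<psi> i * (\<Sum>j<n. C (g i) (g j) * (\<psi> j * x j))"
    by (simp add: mat_app_def P_def sum_distrib_left mult.assoc)
  also have "(\<Sum>j<n. C (g i) (g j) * (\<psi> j * x j)) = (\<Sum>k<K. C (g i) k * proj x k)"
    unfolding sum_by_label[of "\<lambda>j. C (g i) (g j) * (\<psi> j * x j)"] proj_def sum_distrib_left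
    by (intro sum.cong) auto
  finally show ?thesis by (simp add: lift_def mat_app_def)
qed

lemma close_P: "L2_set (\<lambda>i. mat_app n A x i - mat_app n P x i) {..<n} \<le> s * L2_set x {..<n}"
  using close[of x] by (simp add: P_def[abs_def])

lemma parseval: "(\<Sum>j<n. (coord x j)\<^sup>2) = (\<Sum>i<n. (x i)\<^sup>2)"
proof -
  have "(\<Sum>j<n. (coord x j)\<^sup>2) = (\<Sum>j<n. \<Sum>i<n. \<Sum>l<n. (V i j * V l j) * (x i * x l))"
    by (simp add: coord_def power2_eq_square sum_product mult_ac)
  also have "\<dots> = (\<Sum>i<n. \<Sum>l<n. (\<Sum>j<n. V i j * V l j) * (x i * x l))"
    unfolding sum_distrib_right by (subst sum.swap, rule sum.cong[OF refl], rule sum.swap)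
  also have "\<dots> = (\<Sum>i<n. \<Sum>l<n. of_bool (i = l) * (x i * x l))"
    by (intro sum.cong refl) (simp add: V_rows)
  also have "\<dots> = (\<Sum>i<n. x i * x i)"
    by (intro sum.cong refl sum_of_bool_eq_mult) auto
  finally show ?thesis by (simp add: power2_eq_square)
qed

lemma coord_A:
  assumes "j < n"
  shows "coord (mat_app n A x) j = lam j * coord x j"
proof -
  have "coord (mat_app n A x) j = (\<Sum>i<n. mat_app n A x i * V i j)"
    by (simp add: coord_def mult.commute)
  also have "\<dots> = (\<Sum>i<n. x i * mat_app n A (\<lambda>i. V i j) i)"
    by (rule mat_app_self_adjoint) (rule A_sym)
  also have "\<dots> = (\<Sum>i<n. lam j * (V i j * x i))"
    using assms by (intro sum.cong) (auto simp: V_eig)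
  finally show ?thesis by (simp add: coord_def sum_distrib_left)
qed

text \<open>Weyl's inequality by a dimension count: \<open>K + 1\<close> eigenvectors meet the kernel of \<open>P\<close>.\<close>
lemma lam_tail_le:
  assumes l: "K \<le> l" "l < n"
  shows "\<bar>lam l\<bar> \<le> s"
proof -
  \<comment> \<open>These K + 1 indices belong to eigenvalues of modulus at least |lam l|. A
    combination x of their eigenvectors with P x = 0 satisfies |lam l| |x| \<le> |A x| = |(A - P) x|
    \<le> s |x|.\<close>
  define e where "e = (\<lambda>j. if j < K then j else l)"
  have e: "e j < n" "\<bar>lam l\<bar> \<le> \<bar>lam (e j)\<bar>" for j using l lam_le by (auto simp: e_def)
  have einj: "inj_on e {..K}" using l by (auto simp: inj_on_def e_def split: if_splits)
  obtain c where c: "\<exists>j\<le>K. c j \<noteq> 0" "\<And>k. k < K \<Longrightarrow> (\<Sum>j\<le>K. M k (e j) * c j) = 0"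
    using exists_nontrivial_kernel[of K "\<lambda>k j. M k (e j)"] by blast
  define x where "x = (\<lambda>i. \<Sum>j\<le>K. c j * V i (e j))"
  have proj: "proj x k = 0" if "k < K" for k
  proof -
    have "proj x k = (\<Sum>j\<le>K. M k (e j) * c j)"
      unfolding proj_def x_def M_def sum_distrib_left sum_distrib_right
      by (subst sum.swap) (simp add: mult_ac)
    then show ?thesis using c(2)[OF that] by simp
  qed
  have Px: "mat_app n P x i = 0" if "i < n" for i
    unfolding P_app[OF that] using proj by (simp add: lift_def mat_app_def)
  have cx: "coord x j = (\<Sum>t\<le>K. c t * of_bool (j = e t))" if "j < n" for j
  proof -
    have "coord x j = (\<Sum>t\<le>K. c t * (\<Sum>i<n. V i j * V i (e t)))"
      unfolding coord_def x_def sum_distrib_left by (subst sum.swap) (simp add: mult_ac)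
    then show ?thesis using that e by (simp add: V_cols)
  qed
  have cxe: "coord x (e t) = c t" if "t \<le> K" for t
  proof -
    have "coord x (e t) = (\<Sum>u\<le>K. of_bool (t = u) * c u)"
      unfolding cx[OF e(1)] using that einj
      by (intro sum.cong) (auto simp: inj_on_def mult.commute)
    then show ?thesis using that by (simp add: sum_of_bool_eq_mult)
  qed
  have cx0: "coord x j = 0" if "j < n" "j \<notin> e ` {..K}" for j
    unfolding cx[OF that(1)] using that(2) by (intro sum.neutral) auto
  have "L2_set x {..<n} \<noteq> 0"
  proof
    assume "L2_set x {..<n} = 0"
    then have "x i = 0" if "i < n" for i using that by (simp add: L2_set_eq_0_iff)
    then have "coord x j = 0" for j by (simp add: coord_def)
    then show False using c(1) cxe by metis
  qed
  then have xpos: "L2_set x {..<n} > 0" by (simp add: order_less_le)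
  have "\<bar>lam l\<bar> * L2_set x {..<n} \<le> L2_set (mat_app n A x) {..<n}"
  proof (rule power2_le_imp_le)
    have "(\<bar>lam l\<bar> * L2_set x {..<n})\<^sup>2 = (\<Sum>j<n. (lam l)\<^sup>2 * (coord x j)\<^sup>2)"
      by (simp add: power_mult_distrib L2_set_power2 parseval sum_distrib_left[symmetric])
    also have "\<dots> \<le> (\<Sum>j<n. (coord (mat_app n A x) j)\<^sup>2)"
    proof (rule sum_mono)
      fix j assume j: "j \<in> {..<n}"
      show "(lam l)\<^sup>2 * (coord x j)\<^sup>2 \<le> (coord (mat_app n A x) j)\<^sup>2"
      proof (cases "j \<in> e ` {..K}")
        case True
        then have "\<bar>lam l\<bar> \<le> \<bar>lam j\<bar>" using e by auto
        then have "(lam l)\<^sup>2 \<le> (lam j)\<^sup>2" by (simp add: abs_le_square_iff)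
        then show ?thesis using j by (simp add: coord_A power_mult_distrib mult_right_mono)
      next
        case False
        then show ?thesis using j cx0 by simp
      qed
    qed
    finally show "(\<bar>lam l\<bar> * L2_set x {..<n})\<^sup>2 \<le> (L2_set (mat_app n A x) {..<n})\<^sup>2"
      by (simp add: parseval L2_set_power2)
  qed simp
  also have "\<dots> = L2_set (\<lambda>i. mat_app n A x i - mat_app n P x i) {..<n}"
    by (rule L2_set_cong) (auto simp: Px)
  also have "\<dots> \<le> s * L2_set x {..<n}" by (rule close_P)
  finally show ?thesis using xpos by simp
qed

lemma coord_diff: "coord (\<lambda>i. x i - y i) j = coord x j - coord y j"
  by (simp add: coord_def right_diff_distrib sum_subtractf)

lemma L2_tail_le: "L2_set (coord x) {K..<n} \<le> L2_set x {..<n}"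
proof (rule power2_le_imp_le)
  have "(\<Sum>j\<in>{K..<n}. (coord x j)\<^sup>2) \<le> (\<Sum>j<n. (coord x j)\<^sup>2)"
    by (rule sum_mono2) auto
  then show "(L2_set (coord x) {K..<n})\<^sup>2 \<le> (L2_set x {..<n})\<^sup>2"
    by (simp add: L2_set_power2 parseval)
qed simp

lemma C_surj: obtains x where "\<And>k. k < K \<Longrightarrow> mat_app K C x k = y k"
proof -
  have inj: "(\<And>i. i < K \<Longrightarrow> mat_app K C v i = 0) \<Longrightarrow> \<forall>i<K. v i = 0" for v
  proof -
    assume "\<And>i. i < K \<Longrightarrow> mat_app K C v i = 0"
    then have "L2_set (mat_app K C v) {..<K} = 0" by (simp add: L2_set_eq_0_iff)
    then have "\<gamma> * L2_set v {..<K} \<le> 0" using C_gap[of v] by simp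
    then have "L2_set v {..<K} = 0"
      using \<gamma> by (simp add: mult_le_0_iff order_antisym)
    then show ?thesis by (simp add: L2_set_eq_0_iff)
  qed
  from exists_inverse_of_injective[OF inj] obtain B where
    "\<And>x i. i < K \<Longrightarrow> mat_app K C (mat_app K B x) i = x i" by blast
  then show ?thesis using that by blast
qed

text \<open>The Davis-Kahan step. Writing y = C x and z = \<Phi> x gives \<Phi> y = P z = A z - (A -
  P) z. On the tail coordinates A multiplies by eigenvalues of modulus at most s, the second term is
  at most s |z|, and |z| = |x| \<le> |y| / \<gamma>.\<close>

lemma tail_lift_le: "L2_set (coord (lift y)) {K..<n} \<le> 2 * s / \<gamma> * L2_set y {..<K}"
proof -
  obtain x where x: "\<And>k. k < K \<Longrightarrow> mat_app K C x k = y k" using C_surj[of y] by blast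
  let ?z = "lift x" and ?E = "\<lambda>x i. mat_app n A x i - mat_app n P x i"
  have Pz: "mat_app n P ?z i = lift y i" if "i < n" for i
  proof -
    have "mat_app K C (proj ?z) (g i) = mat_app K C x (g i)"
      unfolding mat_app_def by (intro sum.cong) (auto simp: proj_lift)
    then show ?thesis unfolding P_app[OF that] using x g[OF that] by (simp add: lift_def)
  qed
  have "L2_set (coord (lift y)) {K..<n} = L2_set (\<lambda>j. lam j * coord ?z j + - coord (?E ?z) j) {K..<n}"
  proof (rule L2_set_cong)
    fix j assume j: "j \<in> {K..<n}"
    have "coord (lift y) j = coord (mat_app n P ?z) j"
      unfolding coord_def by (intro sum.cong) (auto simp: Pz)
    then show "coord (lift y) j = lam j * coord ?z j + - coord (?E ?z) j"
      using j coord_diff[of "mat_app n A ?z" "mat_app n P ?z" j] by (simp add: coord_A)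
  qed simp
  also have "\<dots> \<le> L2_set (\<lambda>j. lam j * coord ?z j) {K..<n} + L2_set (\<lambda>j. - coord (?E ?z) j) {K..<n}"
    by (rule L2_set_triangle_ineq)
  also have "L2_set (\<lambda>j. - coord (?E ?z) j) {K..<n} = L2_set (coord (?E ?z)) {K..<n}"
    by (simp add: L2_set_def)
  also have "\<dots> \<le> s * L2_set ?z {..<n}"
    by (rule order_trans[OF L2_tail_le close_P])
  also have "L2_set (\<lambda>j. lam j * coord ?z j) {K..<n} \<le> s * L2_set ?z {..<n}"
  proof (rule power2_le_imp_le)
    have "(L2_set (\<lambda>j. lam j * coord ?z j) {K..<n})\<^sup>2 \<le> (\<Sum>j\<in>{K..<n}. s\<^sup>2 * (coord ?z j)\<^sup>2)"
      unfolding L2_set_power2 power_mult_distrib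
      by (intro sum_mono mult_right_mono) (use lam_tail_le s0 in \<open>auto simp: abs_le_square_iff[symmetric]\<close>)
    also have "\<dots> \<le> s\<^sup>2 * (L2_set ?z {..<n})\<^sup>2"
      unfolding sum_distrib_left[symmetric]
      using power_mono[OF L2_tail_le[of ?z], of 2] by (simp add: L2_set_power2 mult_left_mono)
    finally show "(L2_set (\<lambda>j. lam j * coord ?z j) {K..<n})\<^sup>2 \<le> (s * L2_set ?z {..<n})\<^sup>2"
      by (simp add: power_mult_distrib)
  qed (use s0 in simp)
  finally have "L2_set (coord (lift y)) {K..<n} \<le> 2 * s * L2_set x {..<K}"
    by (simp add: L2_lift)
  also have "\<dots> \<le> 2 * s * (L2_set y {..<K} / \<gamma>)"
  proof (rule mult_left_mono)
    have "\<gamma> * L2_set x {..<K} \<le> L2_set y {..<K}"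
      using C_gap[of x] x by (metis (no_types, lifting) L2_set_cong lessThan_iff)
    then show "L2_set x {..<K} \<le> L2_set y {..<K} / \<gamma>" using \<gamma> by (simp add: field_simps)
  qed (use s0 in simp)
  finally show ?thesis by simp
qed

lemma coord_lift: "coord (lift y) l = (\<Sum>k<K. y k * M k l)"
  using sum_lift[of y "\<lambda>i. V i l"] by (simp add: coord_def M_def mult.commute)

lemma head_plus_tail:
  "(\<Sum>l<K. (\<Sum>k<K. y k * M k l)\<^sup>2) + (L2_set (coord (lift y)) {K..<n})\<^sup>2 = (L2_set y {..<K})\<^sup>2"
proof -
  have "(\<Sum>l<K. (coord (lift y) l)\<^sup>2) + (\<Sum>l\<in>{K..<n}. (coord (lift y) l)\<^sup>2) = (\<Sum>l<n. (coord (lift y) l)\<^sup>2)"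
    using sum.atLeastLessThan_concat[of 0 K n "\<lambda>l. (coord (lift y) l)\<^sup>2"] Kn
    by (simp add: lessThan_atLeast0)
  also have "\<dots> = (L2_set y {..<K})\<^sup>2"
    unfolding parseval L2_lift[symmetric] L2_set_power2 ..
  finally show ?thesis by (simp add: coord_lift L2_set_power2)
qed

text \<open>By Parseval, restricting \<Phi> y to the leading coordinates loses exactly the tail. The
  overlap matrix is therefore almost isometric from below, which later yields both the length and
  the separation of its rows.\<close>

lemma M_lower:
  "(1 - (2 * s / \<gamma>)\<^sup>2) * (L2_set y {..<K})\<^sup>2 \<le> (\<Sum>l<K. (\<Sum>k<K. y k * M k l)\<^sup>2)"
  using power_mono[OF tail_lift_le[of y], of 2] head_plus_tail[of y]
  unfolding power_mult_distrib by (simp add: left_diff_distrib)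

lemma M_row_le: "k < K \<Longrightarrow> (\<Sum>l<K. (M k l)\<^sup>2) \<le> 1"
  and M_row_tail: "k < K \<Longrightarrow> 1 - (\<Sum>l<K. (M k l)\<^sup>2) \<le> (2 * s / \<gamma>)\<^sup>2"
proof -
  assume k: "k < K"
  let ?e = "\<lambda>j. of_bool (k = j) :: real"
  have e: "(\<Sum>j<K. ?e j * M j l) = M k l" for l
    using k by (simp add: sum_of_bool_eq_mult)
  have "(\<Sum>i<K. (?e i)\<^sup>2) = (\<Sum>i<K. ?e i * 1)" by (intro sum.cong) auto
  then have n1: "(L2_set ?e {..<K})\<^sup>2 = 1"
    using k sum_of_bool_eq_mult(1)[of "{..<K}" k "\<lambda>_. 1::real"] by (simp add: L2_set_power2)
  show "(\<Sum>l<K. (M k l)\<^sup>2) \<le> 1"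
    using head_plus_tail[of ?e] unfolding e n1 by (smt (verit) zero_le_power2)
  show "1 - (\<Sum>l<K. (M k l)\<^sup>2) \<le> (2 * s / \<gamma>)\<^sup>2"
    using M_lower[of ?e] unfolding e n1 by simp
qed

text \<open>
  The squared Frobenius distance of the leading eigenvectors to the column space of \<open>\<Phi>\<close> equals
  that of the columns of \<open>\<Phi>\<close> to the leading eigenspace, both spaces having dimension \<open>K\<close>.
\<close>
lemma rows_close:
  "(\<Sum>i<n. \<Sum>l<K. (V i l - \<psi> i * M (g i) l)\<^sup>2) \<le> real K * (2 * s / \<gamma>)\<^sup>2"
proof -
  have col: "(\<Sum>i<n. (V i l - \<psi> i * M (g i) l)\<^sup>2) = 1 - (\<Sum>k<K. (M k l)\<^sup>2)" if "l < K" for l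
  proof -
    let ?y = "\<lambda>k. M k l"
    have "(\<Sum>i<n. (V i l - \<psi> i * M (g i) l)\<^sup>2)
        = (\<Sum>i<n. V i l * V i l) - 2 * (\<Sum>i<n. lift ?y i * V i l) + (\<Sum>i<n. lift ?y i * lift ?y i)"
      by (simp add: lift_def power2_eq_square algebra_simps sum.distrib sum_subtractf sum_distrib_left)
    also have "(\<Sum>i<n. V i l * V i l) = 1" using that Kn by (simp add: V_cols)
    also have "(\<Sum>i<n. lift ?y i * V i l) = (\<Sum>k<K. (M k l)\<^sup>2)"
      unfolding sum_lift by (simp add: M_def power2_eq_square)
    also have "(\<Sum>i<n. lift ?y i * lift ?y i) = (\<Sum>k<K. (M k l)\<^sup>2)"
      unfolding sum_lift by (intro sum.cong) (auto simp: proj_lift power2_eq_square)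
    finally show ?thesis by simp
  qed
  have "(\<Sum>i<n. \<Sum>l<K. (V i l - \<psi> i * M (g i) l)\<^sup>2) = (\<Sum>l<K. 1 - (\<Sum>k<K. (M k l)\<^sup>2))"
    by (subst sum.swap) (simp add: col)
  \<comment> \<open>Equality of dimensions enters here: as many leading columns as communities, so
    the defects of columns and of rows have the same total.\<close>
  also have "\<dots> = (\<Sum>k<K. 1 - (\<Sum>l<K. (M k l)\<^sup>2))"
    unfolding sum_subtractf by (subst (2) sum.swap) simp
  also have "\<dots> \<le> (\<Sum>k<K. (2 * s / \<gamma>)\<^sup>2)"
    by (intro sum_mono M_row_tail) simp
  finally show ?thesis by simp
qed

end

section \<open>Spherical k-median\<close>

lemma L2_set_diff_commute: "L2_set (\<lambda>l. x l - y l) S = L2_set (\<lambda>l. y l - x l) S"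
  by (simp add: L2_set_def power2_commute)

lemma L2_set_dist_triangle:
  "L2_set (\<lambda>l. x l - z l) S \<le> L2_set (\<lambda>l. x l - y l) S + L2_set (\<lambda>l. y l - z l) S"
  using L2_set_triangle_ineq[of "\<lambda>l. x l - y l" "\<lambda>l. y l - z l" S] by simp

lemma L2_set_norm_diff_le: "\<bar>L2_set x S - L2_set y S\<bar> \<le> L2_set (\<lambda>l. x l - y l) S"
  using L2_set_dist_triangle[of x "\<lambda>_. 0" S y] L2_set_dist_triangle[of y "\<lambda>_. 0" S x]
    L2_set_diff_commute[of x y S] by simp

text \<open>The difference is split as (x - y) / |y| + (1/|x| - 1/|y|) x. Only |y| remains in the
  denominator, which matters because an observed row x may be arbitrarily short.\<close>

lemma L2_set_normalized_diff_le:
  assumes x: "L2_set x S > 0" and y: "L2_set y S > 0"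
  shows "L2_set (\<lambda>l. x l / L2_set x S - y l / L2_set y S) S \<le> 2 * L2_set (\<lambda>l. x l - y l) S / L2_set y S"
proof -
  let ?a = "L2_set x S" and ?b = "L2_set y S" and ?d = "L2_set (\<lambda>l. x l - y l) S"
  have "L2_set (\<lambda>l. x l / ?a - y l / ?b) S = L2_set (\<lambda>l. (1 / ?b) * (x l - y l) + (1 / ?a - 1 / ?b) * x l) S"
    by (rule L2_set_cong) (simp_all add: algebra_simps diff_divide_distrib)
  also have "\<dots> \<le> L2_set (\<lambda>l. (1 / ?b) * (x l - y l)) S + L2_set (\<lambda>l. (1 / ?a - 1 / ?b) * x l) S"
    by (rule L2_set_triangle_ineq)
  also have "\<dots> = ?d / ?b + \<bar>1 / ?a - 1 / ?b\<bar> * ?a"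
    using y by (simp only: L2_set_scale) simp
  also have "\<bar>1 / ?a - 1 / ?b\<bar> * ?a = \<bar>?b - ?a\<bar> / ?b"
    using x y by (simp add: abs_if field_simps)
  also have "\<dots> \<le> ?d / ?b"
    using y L2_set_norm_diff_le[of y S x] L2_set_diff_commute[of x y S]
    by (intro divide_right_mono) auto
  finally show ?thesis by simp
qed

context perturbed_block_matrix
begin

definition row_err :: "nat \<Rightarrow> real" where
  "row_err i = L2_set (\<lambda>l. V i l - \<psi> i * M (g i) l) {..<K}"

text \<open>Row i of the leading eigenvectors is near \<open>\<psi> i\<close> times row
  \<open>g i\<close> of \<open>M\<close>. Normalisation removes the positive factor, so the target
  depends on the community alone.\<close>

definition M_dir :: "nat \<Rightarrow> nat \<Rightarrow> real" where
  "M_dir k l = M k l / L2_set (M k) {..<K}"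

text \<open>Normalising a row divides its error by \<open>\<psi> i\<close>. Cauchy-Schwarz separates
  these weights from the Frobenius error and thereby creates the heterogeneity term of the
  theorem.\<close>

lemma sum_row_err_le:
  assumes \<psi>: "\<And>i. i < n \<Longrightarrow> \<psi> i > 0"
  shows "(\<Sum>i<n. row_err i / \<psi> i) \<le> sqrt (\<Sum>i<n. 1 / (\<psi> i)\<^sup>2) * (sqrt (real K) * (2 * s / \<gamma>))"
proof -
  have "(\<Sum>i<n. row_err i / \<psi> i) \<le> \<bar>\<Sum>i<n. (1 / \<psi> i) * row_err i\<bar>" by simp
  also have "\<dots> \<le> L2_set (\<lambda>i. 1 / \<psi> i) {..<n} * L2_set row_err {..<n}"
    by (rule L2_set_inner_le)
  also have "\<dots> \<le> sqrt (\<Sum>i<n. 1 / (\<psi> i)\<^sup>2) * (sqrt (real K) * (2 * s / \<gamma>))"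
  proof (rule mult_mono)
    show "L2_set (\<lambda>i. 1 / \<psi> i) {..<n} \<le> sqrt (\<Sum>i<n. 1 / (\<psi> i)\<^sup>2)"
      by (simp add: L2_set_def power_one_over)
    have "(\<Sum>i<n. (row_err i)\<^sup>2) \<le> real K * (2 * s / \<gamma>)\<^sup>2"
      using rows_close by (simp add: row_err_def L2_set_power2)
    also have "\<dots> = (sqrt (real K) * (2 * s / \<gamma>))\<^sup>2"
      by (simp only: power_mult_distrib real_sqrt_pow2 of_nat_0_le_iff)
    finally show "L2_set row_err {..<n} \<le> sqrt (real K) * (2 * s / \<gamma>)"
      using s0 \<gamma> by (subst L2_set_le_iff) auto
  qed (auto simp: sum_nonneg)
  finally show ?thesis .
qed

text \<open>For s \<le> \<gamma> / 4 a row loses at most a quarter of its squared unit length, and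
  16/25 \<le> 3/4.\<close>

lemma M_norm_ge:
  assumes small: "s \<le> \<gamma> / 4" and k: "k < K"
  shows "L2_set (M k) {..<K} \<ge> 4 / 5"
proof (rule power2_le_imp_le)
  have "2 * s / \<gamma> \<le> 1 / 2" using small \<gamma> by (simp add: field_simps)
  then have "(2 * s / \<gamma>)\<^sup>2 \<le> (1 / 2)\<^sup>2" using s0 \<gamma> by (intro power_mono) auto
  moreover have "(4 / 5 :: real)\<^sup>2 \<le> 1 - (1 / 2)\<^sup>2" by (simp add: power2_eq_square)
  ultimately show "(4 / 5)\<^sup>2 \<le> (L2_set (M k) {..<K})\<^sup>2"
    unfolding L2_set_power2 using M_row_tail[OF k] by linarith
qed simp

text \<open>The near-isometry is tested on the combination of two coordinate vectors that produces
  the difference of the directions. Its squared norm is at least 2 because rows of \<open>M\<close>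
  have length at most 1, so the squared distance is at least 3/2 \<ge> (6/5)^2.\<close>

lemma M_dir_separated:
  assumes small: "s \<le> \<gamma> / 4" and k: "k < K" "k' < K" "k \<noteq> k'"
  shows "L2_set (\<lambda>l. M_dir k l - M_dir k' l) {..<K} \<ge> 6 / 5"
proof (rule power2_le_imp_le)
  let ?m = "\<lambda>k. L2_set (M k) {..<K}"
  define y where "y = (\<lambda>j. of_bool (k = j) * (1 / ?m k) - of_bool (k' = j) * (1 / ?m k'))"
  have m: "?m k > 0" "?m k' > 0" "?m k \<le> 1" "?m k' \<le> 1"
    using M_norm_ge[OF small k(1)] M_norm_ge[OF small k(2)] M_row_le[OF k(1)] M_row_le[OF k(2)]
    by (auto simp: L2_set_le_iff)
  have "2 * s / \<gamma> \<le> 1 / 2" using small \<gamma> by (simp add: field_simps)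
  then have "(2 * s / \<gamma>)\<^sup>2 \<le> (1 / 2)\<^sup>2" using s0 \<gamma> by (intro power_mono) auto
  then have q: "3 / 4 \<le> 1 - (2 * s / \<gamma>)\<^sup>2" by (simp add: power2_eq_square)
  have lin: "(\<Sum>j<K. y j * f j) = (1 / ?m k) * f k - (1 / ?m k') * f k'" for f
  proof -
    have "(\<Sum>j<K. y j * f j) = (\<Sum>j<K. of_bool (k = j) * ((1 / ?m k) * f j)) - (\<Sum>j<K. of_bool (k' = j) * ((1 / ?m k') * f j))"
      by (simp add: y_def left_diff_distrib sum_subtractf mult.assoc)
    also have "(\<Sum>j<K. of_bool (k = j) * ((1 / ?m k) * f j)) = (1 / ?m k) * f k"
      by (rule sum_of_bool_eq_mult) (use k in auto)
    also have "(\<Sum>j<K. of_bool (k' = j) * ((1 / ?m k') * f j)) = (1 / ?m k') * f k'"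
      by (rule sum_of_bool_eq_mult) (use k in auto)
    finally show ?thesis .
  qed
  have yk: "y k = 1 / ?m k" "y k' = - (1 / ?m k')" using k by (auto simp: y_def)
  have "(L2_set y {..<K})\<^sup>2 = (1 / ?m k)\<^sup>2 + (1 / ?m k')\<^sup>2"
    unfolding L2_set_power2 using lin[of y] by (simp add: power2_eq_square yk)
  moreover have "1 \<le> (1 / ?m k)\<^sup>2" "1 \<le> (1 / ?m k')\<^sup>2"
    using m by (auto intro!: power_le_one simp: field_simps)
  ultimately have "2 \<le> (L2_set y {..<K})\<^sup>2" by linarith
  then have "3 / 4 * 2 \<le> (1 - (2 * s / \<gamma>)\<^sup>2) * (L2_set y {..<K})\<^sup>2"
    using q by (intro mult_mono) auto
  also have "\<dots> \<le> (\<Sum>l<K. (\<Sum>j<K. y j * M j l)\<^sup>2)" by (rule M_lower)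
  also have "\<dots> = (L2_set (\<lambda>l. M_dir k l - M_dir k' l) {..<K})\<^sup>2"
    unfolding lin L2_set_power2 by (simp add: M_dir_def)
  finally have "3 / 2 \<le> (L2_set (\<lambda>l. M_dir k l - M_dir k' l) {..<K})\<^sup>2" by simp
  then show "(6 / 5)\<^sup>2 \<le> (L2_set (\<lambda>l. M_dir k l - M_dir k' l) {..<K})\<^sup>2"
    by (simp add: power2_eq_square)
qed simp

text \<open>A node is bad if its row vanishes or if its fitted centre \<open>W i\<close> is at
  distance at least 3/5 from its true direction. As 3/5 is half the separation, good nodes of
  different communities cannot share a centre, hence cannot share a label.\<close>

lemma spherical_median_misclustered:
  fixes W :: "nat \<Rightarrow> nat \<Rightarrow> real" and h :: "nat \<Rightarrow> nat"
  defines "N \<equiv> \<lambda>i. L2_set (V i) {..<K}"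
  defines "I \<equiv> {i \<in> {..<n}. N i > 0}"
  assumes small: "s \<le> \<gamma> / 4" and \<psi>: "\<And>i. i < n \<Longrightarrow> \<psi> i > 0" and \<epsilon>: "\<epsilon> > 0"
    and W: "\<And>i j. i \<in> I \<Longrightarrow> j \<in> I \<Longrightarrow> h i = h j \<Longrightarrow> W i = W j"
    and median: "(\<Sum>i\<in>I. L2_set (\<lambda>l. W i l - V i l / N i) {..<K})
      \<le> (1 + \<epsilon>) * (\<Sum>i\<in>I. L2_set (\<lambda>l. M_dir (g i) l - V i l / N i) {..<K})"
  obtains Bad where "Bad \<subseteq> {..<n}"
    "real (card Bad) \<le> 25 / 3 * (2.5 + \<epsilon>) * sqrt (\<Sum>i<n. 1 / (\<psi> i)\<^sup>2) * sqrt (real K) * s / \<gamma>"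
    "\<And>i j. i \<in> {..<n} - Bad \<Longrightarrow> j \<in> {..<n} - Bad \<Longrightarrow> g i \<noteq> g j \<Longrightarrow> h i \<noteq> h j"
proof
  let ?dU = "\<lambda>i. L2_set (\<lambda>l. M_dir (g i) l - V i l / N i) {..<K}"
  let ?dW = "\<lambda>i. L2_set (\<lambda>l. W i l - V i l / N i) {..<K}"
  let ?dWU = "\<lambda>i. L2_set (\<lambda>l. W i l - M_dir (g i) l) {..<K}"
  define Bad1 where "Bad1 = {i \<in> I. ?dWU i \<ge> 3 / 5}"
  define Bad0 where "Bad0 = {..<n} - I"
  define Q where "Q = (\<Sum>i<n. row_err i / \<psi> i)"
  let ?Bad = "Bad0 \<union> Bad1"
  have I: "I \<subseteq> {..<n}" "finite I" by (auto simp: I_def)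
  show "?Bad \<subseteq> {..<n}" using I by (auto simp: Bad0_def Bad1_def)
  have err0: "row_err i / \<psi> i \<ge> 0" if "i < n" for i
    using \<psi>[OF that] by (simp add: row_err_def)
  have u_norm: "L2_set (\<lambda>l. \<psi> i * M (g i) l) {..<K} = \<psi> i * L2_set (M (g i)) {..<K}" if "i < n" for i
    using \<psi>[OF that] by (simp add: L2_set_scale)
  have u_ge: "\<psi> i * (4 / 5) \<le> L2_set (\<lambda>l. \<psi> i * M (g i) l) {..<K}" if "i < n" for i
    unfolding u_norm[OF that] using \<psi>[OF that] M_norm_ge[OF small g[OF that]] by (intro mult_left_mono) auto
  have dU: "?dU i \<le> 5 / 2 * (row_err i / \<psi> i)" if i: "i \<in> I" for i
  proof -
    have in': "i < n" and Ni: "N i > 0" using i by (auto simp: I_def)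
    let ?u = "\<lambda>l. \<psi> i * M (g i) l"
    have upos: "L2_set ?u {..<K} > 0" using u_ge[OF in'] \<psi>[OF in'] by linarith
    have "?dU i = L2_set (\<lambda>l. V i l / L2_set (V i) {..<K} - ?u l / L2_set ?u {..<K}) {..<K}"
      unfolding u_norm[OF in'] using \<psi>[OF in']
      by (subst L2_set_diff_commute) (simp add: M_dir_def N_def)
    also have "\<dots> \<le> 2 * row_err i / L2_set ?u {..<K}"
      unfolding row_err_def by (rule L2_set_normalized_diff_le) (use Ni upos in \<open>auto simp: N_def\<close>)
    \<comment> \<open>The factor 5/2 arises as 2 from the normalisation over the row length
      4/5.\<close>
    also have "\<dots> \<le> 2 * row_err i / (\<psi> i * (4 / 5))"
      using u_ge[OF in'] upos \<psi>[OF in'] by (intro divide_left_mono) (auto simp: row_err_def)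
    finally show ?thesis by simp
  qed
  have "(\<Sum>i\<in>I. ?dU i) \<le> (\<Sum>i\<in>I. 5 / 2 * (row_err i / \<psi> i))" by (intro sum_mono dU)
  also have "\<dots> \<le> (\<Sum>i<n. 5 / 2 * (row_err i / \<psi> i))"
    using I by (intro sum_mono2 mult_nonneg_nonneg err0) auto
  also have "\<dots> = 5 / 2 * Q" by (simp add: Q_def sum_distrib_left)
  finally have dUQ: "(\<Sum>i\<in>I. ?dU i) \<le> 5 / 2 * Q" .
  have "real (card Bad1) * (3 / 5) = (\<Sum>i\<in>Bad1. 3 / 5)" by simp
  also have "\<dots> \<le> (\<Sum>i\<in>Bad1. ?dWU i)" by (intro sum_mono) (auto simp: Bad1_def)
  also have "\<dots> \<le> (\<Sum>i\<in>I. ?dWU i)" using I by (intro sum_mono2) (auto simp: Bad1_def)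
  also have "\<dots> \<le> (\<Sum>i\<in>I. ?dW i + ?dU i)"
  proof (rule sum_mono)
    fix i
    show "?dWU i \<le> ?dW i + ?dU i"
      using L2_set_dist_triangle[of "W i" "M_dir (g i)" "{..<K}" "\<lambda>l. V i l / N i"]
        L2_set_diff_commute[of "M_dir (g i)" "\<lambda>l. V i l / N i" "{..<K}"] by simp
  qed
  also have "\<dots> \<le> (2 + \<epsilon>) * (\<Sum>i\<in>I. ?dU i)" using median by (simp add: sum.distrib algebra_simps)
  also have "\<dots> \<le> (2 + \<epsilon>) * (5 / 2 * Q)" using dUQ \<epsilon> by (intro mult_left_mono) auto
  finally have b1: "real (card Bad1) \<le> 25 / 6 * (2 + \<epsilon>) * Q" by (simp add: algebra_simps)
  have "real (card Bad0) = (\<Sum>i\<in>Bad0. 1)" by simp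
  \<comment> \<open>For a vanishing row the error is the whole length of its target, which is at
    least 4/5 of \<open>\<psi> i\<close>.\<close>
  also have "\<dots> \<le> (\<Sum>i\<in>Bad0. 5 / 4 * (row_err i / \<psi> i))"
  proof (rule sum_mono)
    fix i assume "i \<in> Bad0"
    then have i: "i < n" and "L2_set (V i) {..<K} = 0"
      by (auto simp: Bad0_def I_def N_def not_less order_antisym)
    then have "V i l = 0" if "l < K" for l using that by (simp add: L2_set_eq_0_iff)
    then have "row_err i = L2_set (\<lambda>l. - 1 * (\<psi> i * M (g i) l)) {..<K}"
      unfolding row_err_def by (intro L2_set_cong) auto
    also have "\<dots> = L2_set (\<lambda>l. \<psi> i * M (g i) l) {..<K}"
      by (simp only: L2_set_scale)
    finally have "\<psi> i * (4 / 5) \<le> row_err i" using u_ge[OF i] by simp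
    then show "1 \<le> 5 / 4 * (row_err i / \<psi> i)" using \<psi>[OF i] by (simp add: field_simps)
  qed
  also have "\<dots> \<le> (\<Sum>i<n. 5 / 4 * (row_err i / \<psi> i))"
    by (intro sum_mono2 mult_nonneg_nonneg err0) (auto simp: Bad0_def)
  also have "\<dots> = 5 / 4 * Q" by (simp add: Q_def sum_distrib_left)
  finally have b0: "real (card Bad0) \<le> 5 / 4 * Q" .
  have Q0: "Q \<ge> 0" unfolding Q_def by (intro sum_nonneg err0) simp
  have "real (card ?Bad) \<le> real (card Bad0) + real (card Bad1)"
    using card_Un_le[of Bad0 Bad1] by linarith
  \<comment> \<open>The extra 0.5 contributes 25/12 Q, which covers the 5/4 Q of the vanishing
    rows.\<close>
  also have "\<dots> \<le> 25 / 6 * (2.5 + \<epsilon>) * Q" using b0 b1 Q0 by (simp add: algebra_simps)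
  also have "\<dots> \<le> 25 / 6 * (2.5 + \<epsilon>) * (sqrt (\<Sum>i<n. 1 / (\<psi> i)\<^sup>2) * (sqrt (real K) * (2 * s / \<gamma>)))"
    using \<epsilon> sum_row_err_le[OF \<psi>] unfolding Q_def by (intro mult_left_mono) auto
  finally show "real (card ?Bad) \<le> 25 / 3 * (2.5 + \<epsilon>) * sqrt (\<Sum>i<n. 1 / (\<psi> i)\<^sup>2) * sqrt (real K) * s / \<gamma>"
    by (simp add: mult_ac)
  fix i j assume ij: "i \<in> {..<n} - ?Bad" "j \<in> {..<n} - ?Bad" "g i \<noteq> g j"
  show "h i \<noteq> h j"
  proof
    assume "h i = h j"
    moreover have II: "i \<in> I" "j \<in> I" using ij by (auto simp: Bad0_def)
    ultimately have "W i = W j" using W by blast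
    moreover have "?dWU i < 3 / 5" "?dWU j < 3 / 5" using ij II by (auto simp: Bad1_def)
    moreover have "L2_set (\<lambda>l. M_dir (g i) l - M_dir (g j) l) {..<K} \<ge> 6 / 5"
      using ij g by (intro M_dir_separated[OF small]) auto
    ultimately show False
      using L2_set_dist_triangle[of "M_dir (g i)" "M_dir (g j)" "{..<K}" "W i"]
        L2_set_diff_commute[of "M_dir (g i)" "W i" "{..<K}"] by simp
  qed
qed

end

text \<open>One representative per community is chosen. Separation makes the map from communities to
  the estimated labels of their representatives injective, hence a permutation of the K labels; p is
  its inverse.\<close>

lemma exists_label_permutation:
  fixes g h :: "nat \<Rightarrow> nat"
  assumes h: "\<And>i. i \<in> G \<Longrightarrow> h i < K"
    and onto: "\<And>k. k < K \<Longrightarrow> \<exists>i\<in>G. g i = k"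
    and sep: "\<And>i j. i \<in> G \<Longrightarrow> j \<in> G \<Longrightarrow> g i \<noteq> g j \<Longrightarrow> h i \<noteq> h j"
  obtains p where "p permutes {..<K}" "\<And>i. i \<in> G \<Longrightarrow> p (h i) = g i"
proof -
  obtain w where w: "\<And>k. k < K \<Longrightarrow> w k \<in> G \<and> g (w k) = k"
    using onto by metis
  define q where "q = (\<lambda>k. if k < K then h (w k) else k)"
  have inj: "inj_on q {..<K}"
  proof (rule inj_onI)
    fix a b assume "a \<in> {..<K}" "b \<in> {..<K}" "q a = q b"
    then show "a = b" using sep[of "w a" "w b"] w[of a] w[of b] by (auto simp: q_def)
  qed
  have sub: "q ` {..<K} \<subseteq> {..<K}" using h w by (auto simp: q_def)
  have img: "q ` {..<K} = {..<K}" by (rule endo_inj_surj[OF finite_lessThan sub inj])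
  have q: "q permutes {..<K}"
    by (rule bij_imp_permutes) (use inj img in \<open>auto simp: bij_betw_def q_def\<close>)
  show ?thesis
  proof
    show "inv_into UNIV q permutes {..<K}" by (rule permutes_inv[OF q])
    fix i assume i: "i \<in> G"
    then obtain k where k: "k < K" "q k = h i" using h img by (metis imageE lessThan_iff)
    then have "g i = k" using sep[OF i, of "w k"] w[OF k(1)] by (auto simp: q_def)
    then show "inv_into UNIV q (h i) = g i" using permutes_inverses(2)[OF q] k by metis
  qed
qed

section \<open>Membership matrices and the mean matrix\<close>

lemma membership_label:
  assumes "\<Theta> \<in> membership_mats n K" "i < n"
  shows "label \<Theta> i < K" "k < K \<Longrightarrow> \<Theta> $$ (i, k) = of_bool (label \<Theta> i = k)"
proof -
  from assms obtain g where g: "g < K" "\<And>k. k < K \<Longrightarrow> \<Theta> $$ (i, k) = (if k = g then 1 else 0)"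
    by (auto simp: membership_mats_def)
  have "dim_col \<Theta> = K" using assms by (auto simp: membership_mats_def)
  then have "label \<Theta> i = g"
    unfolding label_def using g by (intro the_equality) (auto split: if_splits)
  then show "label \<Theta> i < K" "k < K \<Longrightarrow> \<Theta> $$ (i, k) = of_bool (label \<Theta> i = k)"
    using g by auto
qed

lemma membership_mult_index:
  assumes T: "T \<in> membership_mats m K" and X: "X \<in> carrier_mat K K'" and "a < m" "l < K'"
  shows "(T * X) $$ (a, l) = X $$ (label T a, l)"
proof -
  have "(T * X) $$ (a, l) = (\<Sum>k<K. T $$ (a, k) * X $$ (k, l))"
    using assms by (auto simp: membership_mats_def scalar_prod_def lessThan_atLeast0)
  also have "\<dots> = (\<Sum>k<K. of_bool (label T a = k) * X $$ (k, l))"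
    using membership_label(2)[OF T assms(3)] by (intro sum.cong) auto
  also have "\<dots> = X $$ (label T a, l)"
    using membership_label(1)[OF T assms(3)] by (simp add: sum_of_bool_eq_mult)
  finally show ?thesis .
qed

lemma norm21_membership:
  assumes T: "T \<in> membership_mats m K" and X: "X \<in> carrier_mat K K'" and Y: "Y \<in> carrier_mat m K'"
  shows "norm21 (T * X - Y) = (\<Sum>a<m. L2_set (\<lambda>l. X $$ (label T a, l) - Y $$ (a, l)) {..<K'})"
proof -
  have d: "dim_row T = m" using T by (auto simp: membership_mats_def)
  have "vec_norm2 (row (T * X - Y) a) = L2_set (\<lambda>l. X $$ (label T a, l) - Y $$ (a, l)) {..<K'}" if "a < m" for a
    unfolding vec_norm2_def using that X Y d
    by (intro L2_set_cong) (auto simp: membership_mult_index[OF T X that] simp del: index_mult_mat(1))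
  then show ?thesis using Y by (simp add: norm21_def)
qed

lemma k_median_value_le:
  assumes T: "T \<in> membership_mats (dim_row Y) K" and X: "X \<in> carrier_mat K (dim_col Y)"
  shows "k_median_value K Y \<le> norm21 (T * X - Y)"
proof -
  have "(INF p\<in>membership_mats (dim_row Y) K \<times> carrier_mat K (dim_col Y). norm21 (fst p * snd p - Y))
      \<le> norm21 (fst (T, X) * snd (T, X) - Y)"
    by (rule cINF_lower) (use T X in \<open>auto intro!: bdd_belowI[of _ 0] simp: norm21_def vec_norm2_def sum_nonneg\<close>)
  then show ?thesis by (simp add: k_median_value_def case_prod_unfold)
qed

text \<open>Rows of a submatrix are renumbered by \<open>pick\<close>; this turns the k-median cost
  into a sum over the original nodes.\<close>

lemma pick_bij_betw:
  assumes "finite I"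
  shows "bij_betw (pick I) {..<card I} I"
proof -
  have inj: "inj_on (pick I) {..<card I}"
    by (rule linorder_inj_onI') (use pick_mono_le in fastforce)
  moreover have "pick I ` {..<card I} \<subseteq> I" by (auto intro: pick_in_set_le)
  ultimately show ?thesis
    using card_subset_eq[OF assms] by (simp add: bij_betw_def card_image)
qed

lemma pick_lessThan: "j < K \<Longrightarrow> pick {..<K} j = j"
proof -
  assume j: "j < K"
  then have "{a \<in> {..<K}. a < j} = {..<j}" by auto
  then show ?thesis using pick_card_in_set[of j "{..<K}"] j by simp
qed

lemma submatrix_rows:
  assumes A: "A \<in> carrier_mat n K" and I: "I \<subseteq> {..<n}"
  shows "submatrix A I {..<K} \<in> carrier_mat (card I) K"
    and "a < card I \<Longrightarrow> l < K \<Longrightarrow> submatrix A I {..<K} $$ (a, l) = A $$ (pick I a, l)"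
proof -
  have r: "{i. i < dim_row A \<and> i \<in> I} = I" and c: "{j. j < dim_col A \<and> j \<in> {..<K}} = {..<K}"
    using A I by auto
  show "submatrix A I {..<K} \<in> carrier_mat (card I) K"
    by (intro carrier_matI) (simp_all only: dim_submatrix r c card_lessThan)
  show "submatrix A I {..<K} $$ (a, l) = A $$ (pick I a, l)" if "a < card I" "l < K"
    by (subst submatrix_index) (simp_all only: r c card_lessThan that pick_lessThan)
qed

text \<open>A wrongly labelled node spoils at most two entries of its row: the misplaced 1 and the
  missing one.\<close>

lemma cluster_error_le:
  assumes \<Theta>: "\<Theta> \<in> membership_mats n K" and \<Theta>': "\<Theta>' \<in> membership_mats n K"
    and p: "p permutes {..<K}" and Bad: "Bad \<subseteq> {..<n}"
    and good: "\<And>i. i \<in> {..<n} - Bad \<Longrightarrow> p (label \<Theta>' i) = label \<Theta> i"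
  shows "cluster_error \<Theta>' \<Theta> \<le> 2 * real (card Bad) / real n"
proof -
  define J where "J = (mat K K (\<lambda>(i, j). if p i = j then 1 else 0) :: real mat)"
  have d: "dim_row \<Theta> = n" "dim_col \<Theta> = K" using \<Theta> by (auto simp: membership_mats_def)
  have J: "J \<in> permutation_mats K" "J \<in> carrier_mat K K" using p by (auto simp: J_def permutation_mats_def)
  have fin: "finite (permutation_mats K)"
  proof -
    have "permutation_mats K = (\<lambda>p. mat K K (\<lambda>(i, j). if p i = j then 1 else 0)) ` {p. p permutes {..<K}}"
      by (auto simp: permutation_mats_def)
    then show ?thesis by (simp add: finite_permutations)
  qed
  have finB: "finite Bad" using Bad finite_subset by blast
  let ?N = "{(i, j). i < dim_row (\<Theta>' * J - \<Theta>) \<and> j < dim_col (\<Theta>' * J - \<Theta>) \<and> (\<Theta>' * J - \<Theta>) $$ (i, j) \<noteq> 0}"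
  let ?S = "(\<lambda>i. (i, p (label \<Theta>' i))) ` Bad \<union> (\<lambda>i. (i, label \<Theta> i)) ` Bad"
  have "?N \<subseteq> ?S"
  proof clarify
    fix i j assume ij: "i < dim_row (\<Theta>' * J - \<Theta>)" "j < dim_col (\<Theta>' * J - \<Theta>)"
      "(\<Theta>' * J - \<Theta>) $$ (i, j) \<noteq> 0" "(i, j) \<notin> (\<lambda>i. (i, label \<Theta> i)) ` Bad"
    then have i: "i < n" and j: "j < K" by (simp_all add: d)
    have "(\<Theta>' * J) $$ (i, j) = J $$ (label \<Theta>' i, j)"
      by (rule membership_mult_index[OF \<Theta>' J(2) i j])
    also have "\<dots> = of_bool (p (label \<Theta>' i) = j)"
      using j membership_label(1)[OF \<Theta>' i] by (simp add: J_def)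
    finally have "(\<Theta>' * J) $$ (i, j) = of_bool (p (label \<Theta>' i) = j)" .
    moreover have "(\<Theta>' * J - \<Theta>) $$ (i, j) = (\<Theta>' * J) $$ (i, j) - \<Theta> $$ (i, j)"
      by (rule index_minus_mat(1)) (use i j d in auto)
    ultimately have ne: "of_bool (p (label \<Theta>' i) = j) \<noteq> (of_bool (label \<Theta> i = j) :: real)"
      using ij(3) membership_label(2)[OF \<Theta> i j] by simp
    then have "i \<in> Bad" using good[of i] i by (metis DiffI lessThan_iff)
    moreover then have "p (label \<Theta>' i) = j" using ne ij(4) by (auto split: if_splits)
    ultimately show "(i, j) \<in> (\<lambda>i. (i, p (label \<Theta>' i))) ` Bad" by blast
  qed
  then have "card ?N \<le> card ?S" using finB by (intro card_mono) auto
  also have "\<dots> \<le> card Bad + card Bad"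
    using finB by (intro order_trans[OF card_Un_le] add_mono card_image_le)
  finally have "nonzero_entries (\<Theta>' * J - \<Theta>) \<le> 2 * card Bad" by (simp add: nonzero_entries_def)
  moreover have "Min ((\<lambda>J. nonzero_entries (\<Theta>' * J - \<Theta>)) ` permutation_mats (dim_col \<Theta>))
      \<le> nonzero_entries (\<Theta>' * J - \<Theta>)"
    using fin J d by (intro Min_le) auto
  ultimately have "real (Min ((\<lambda>J. nonzero_entries (\<Theta>' * J - \<Theta>)) ` permutation_mats (dim_col \<Theta>))) \<le> 2 * real (card Bad)"
    by linarith
  then show ?thesis unfolding cluster_error_def d by (intro divide_right_mono) auto
qed

lemma community_eq:
  assumes "\<Theta> \<in> membership_mats n K"
  shows "community \<Theta> k = {i \<in> {..<n}. label \<Theta> i = k}"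
  using assms by (auto simp: community_def membership_mats_def)

lemma dcbm_mean_index:
  assumes \<Theta>: "\<Theta> \<in> membership_mats n K" and B: "B \<in> carrier_mat K K" and \<psi>: "\<psi> \<in> carrier_vec n"
  shows "dcbm_mean \<Theta> B \<psi> \<in> carrier_mat n n"
    and "i < n \<Longrightarrow> j < n \<Longrightarrow> dcbm_mean \<Theta> B \<psi> $$ (i, j) = \<psi> $ i * B $$ (label \<Theta> i, label \<Theta> j) * \<psi> $ j"
proof -
  have \<Theta>c: "\<Theta> \<in> carrier_mat n K" using \<Theta> by (simp add: membership_mats_def)
  let ?D = "diag_of_vec \<psi>"
  have D: "?D = mat_diag n (\<lambda>i. \<psi> $ i)" using \<psi> by (simp add: diag_of_vec_def)
  then have Dc: "?D \<in> carrier_mat n n" by simp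
  show c: "dcbm_mean \<Theta> B \<psi> \<in> carrier_mat n n"
    unfolding dcbm_mean_def using Dc \<Theta>c B by auto
  have TB: "(\<Theta> * B * transpose_mat \<Theta>) $$ (i, j) = B $$ (label \<Theta> i, label \<Theta> j)" if "i < n" "j < n" for i j
  proof -
    have "(\<Theta> * B * transpose_mat \<Theta>) $$ (i, j) = scalar_prod (row (\<Theta> * B) i) (col (transpose_mat \<Theta>) j)"
      by (rule index_mult_mat(1)) (use that \<Theta>c B in auto)
    also have "\<dots> = (\<Sum>k<K. row (\<Theta> * B) i $ k * col (transpose_mat \<Theta>) j $ k)"
      using \<Theta>c by (simp only: scalar_prod_def lessThan_atLeast0) simp
    also have "\<dots> = (\<Sum>k<K. (\<Theta> * B) $$ (i, k) * \<Theta> $$ (j, k))"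
      using that \<Theta>c B by (intro sum.cong) simp_all
    also have "\<dots> = (\<Sum>k<K. of_bool (label \<Theta> j = k) * B $$ (label \<Theta> i, k))"
      using that by (intro sum.cong) (auto simp: membership_mult_index[OF \<Theta> B] membership_label(2)[OF \<Theta>] simp del: index_mult_mat(1))
    also have "\<dots> = B $$ (label \<Theta> i, label \<Theta> j)"
      using membership_label(1)[OF \<Theta> that(2)] by (simp add: sum_of_bool_eq_mult)
    finally show ?thesis .
  qed
  have TBc: "\<Theta> * B * transpose_mat \<Theta> \<in> carrier_mat n n" using \<Theta>c B by auto
  have "dcbm_mean \<Theta> B \<psi> = ?D * (\<Theta> * B * transpose_mat \<Theta>) * ?D"
  proof -
    have "?D * \<Theta> * B * transpose_mat \<Theta> = ?D * (\<Theta> * B * transpose_mat \<Theta>)"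
      using Dc \<Theta>c B by (simp add: assoc_mult_mat[of _ n n _ K] assoc_mult_mat[of _ n K _ K] assoc_mult_mat[of _ n n _ K _ n] assoc_mult_mat[of _ n n _ K _ K] transpose_carrier_mat)
    then show ?thesis by (simp add: dcbm_mean_def)
  qed
  also have "\<dots> = mat n n (\<lambda>(i, j). \<psi> $ i * (\<Theta> * B * transpose_mat \<Theta>) $$ (i, j) * \<psi> $ j)"
    unfolding D mat_diag_mult_left[OF TBc] by (subst mat_diag_mult_right[of _ n n]) auto
  finally show "dcbm_mean \<Theta> B \<psi> $$ (i, j) = \<psi> $ i * B $$ (label \<Theta> i, label \<Theta> j) * \<psi> $ j" if "i < n" "j < n"
    using that TB by simp
qed

text \<open>
  If the core \<open>C\<close> were singular, so would be \<open>C Z\<close> for the block \<open>Z\<close> belonging to any \<open>K\<close> columns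
  of \<open>P\<close>, and these columns would be linearly dependent.
\<close>
lemma core_nonsingular_of_rank:
  fixes P :: "real mat" and F :: "nat \<Rightarrow> nat \<Rightarrow> real"
  assumes P: "P \<in> carrier_mat n n" and rank: "vec_space.rank n P = K"
    and fac: "\<And>i j. i < n \<Longrightarrow> j < n \<Longrightarrow> P $$ (i, j) = f i * N (g i) j" and g: "\<And>i. i < n \<Longrightarrow> g i < K"
    and ker: "\<And>j. j < n \<Longrightarrow> (\<Sum>k<K. v k * N k j) = 0"
  shows "\<forall>k<K. v k = 0"
proof (rule ccontr)
  assume "\<not> ?thesis"
  then obtain k0 where k0: "k0 < K" "v k0 \<noteq> 0" by blast
  interpret vec_space "TYPE(real)" n .
  \<comment> \<open>A maximal independent set of columns has as many elements as the rank, so it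
    supplies exactly K columns.\<close>
  obtain S where S: "finite S" "maximal S (\<lambda>T. T \<subseteq> set (cols P) \<and> lin_indpt T)"
    using maximal_exists_superset[of "set (cols P)" "\<lambda>T. T \<subseteq> set (cols P) \<and> lin_indpt T" "{}"]
      subset_li_is_li
    by (metis (no_types, lifting) List.finite_set empty_subsetI lin_dep_def finite.emptyI subset_empty empty_iff)
  have cardS: "card S = K" using rank_card_indpt[OF P S(2)] rank by simp
  have Sc: "S \<subseteq> set (cols P)" "lin_indpt S" using S(2) by (auto simp: maximal_def)
  obtain xs where xs: "set xs = S" "distinct xs" using finite_distinct_list[OF S(1)] by blast
  have len: "length xs = K" using xs cardS distinct_card by metis
  have "\<exists>j<n. xs ! t = col P j" if "t < K" for t
  proof -
    have "xs ! t \<in> set (cols P)" using that len xs Sc by (metis nth_mem subsetD)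
    then show ?thesis using P by (auto simp: cols_def)
  qed
  then obtain c where c: "\<And>t. t < K \<Longrightarrow> c t < n \<and> xs ! t = col P (c t)" by metis
  define Z where "Z = (\<lambda>k t. N k (c t))"
  \<comment> \<open>The vector v annihilates Z from the left. Were Z injective, v would be Z w for
    some w, and the product of v with itself would vanish. The resulting y is a linear relation
    among the chosen columns.\<close>
  have "\<exists>y. (\<forall>k<K. mat_app K Z y k = 0) \<and> (\<exists>t<K. y t \<noteq> 0)"
  proof (rule ccontr)
    assume "\<not> ?thesis"
    then have inj: "(\<And>k. k < K \<Longrightarrow> mat_app K Z y k = 0) \<Longrightarrow> \<forall>t<K. y t = 0" for y by blast
    obtain D where D: "\<And>x k. k < K \<Longrightarrow> mat_app K Z (mat_app K D x) k = x k"
      using exists_inverse_of_injective[OF inj] by blast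
    let ?w = "mat_app K D v"
    have "(\<Sum>k<K. v k * v k) = (\<Sum>k<K. v k * mat_app K Z ?w k)" using D by simp
    also have "\<dots> = (\<Sum>t<K. (\<Sum>k<K. v k * N k (c t)) * ?w t)"
      unfolding mat_app_def[of K Z] sum_distrib_left sum_distrib_right
      by (subst sum.swap) (simp add: Z_def mult_ac)
    also have "\<dots> = 0" using c ker by (intro sum.neutral) auto
    finally have "v k0 * v k0 \<le> 0" using k0 member_le_sum[of k0 "{..<K}" "\<lambda>k. v k * v k"] by simp
    then show False using k0(2) by (metis not_le not_real_square_gt_zero)
  qed
  then obtain y where y: "\<And>k. k < K \<Longrightarrow> mat_app K Z y k = 0" "\<exists>t<K. y t \<noteq> 0" by blast
  define M where "M = mat_of_cols n xs"
  have xsc: "set xs \<subseteq> carrier_vec n" using xs Sc P cols_dim by (metis carrier_matD(1) order_trans)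
  have M: "M \<in> carrier_mat n K" using mat_of_cols_carrier(1)[of n xs] by (simp only: M_def len)
  have cols: "cols M = xs" unfolding M_def using xsc by (rule cols_mat_of_cols)
  have "M *\<^sub>v vec K y = 0\<^sub>v n"
  proof (rule eq_vecI)
    fix i assume i: "i < dim_vec (0\<^sub>v n :: real vec)"
    have "(M *\<^sub>v vec K y) $ i = (\<Sum>t<K. M $$ (i, t) * y t)"
      using i M by (simp add: scalar_prod_def lessThan_atLeast0)
    also have "\<dots> = (\<Sum>t<K. f i * (Z (g i) t * y t))"
      using i c P len by (intro sum.cong) (auto simp: M_def mat_of_cols_index fac Z_def)
    also have "\<dots> = f i * mat_app K Z y (g i)" by (simp add: mat_app_def sum_distrib_left)
    also have "\<dots> = 0" using y(1) g i by simp
    finally show "(M *\<^sub>v vec K y) $ i = 0\<^sub>v n $ i" using i by simp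
  qed (use M in simp)
  moreover have "vec K y \<noteq> 0\<^sub>v K" using y(2) by (metis index_vec index_zero_vec(1))
  ultimately have "lin_dep (set (cols M))"
    by (intro lin_depI[OF M, of "vec K y"]) (simp_all add: cols xs(2))
  then show False using cols xs Sc by simp
qed

section \<open>Deterministic misclustering bound\<close>

definition block_norm :: "real mat \<Rightarrow> real vec \<Rightarrow> nat \<Rightarrow> real" where
  "block_norm \<Theta> \<psi> k = vec_norm2 (community_part \<Theta> \<psi> k)"

text \<open>The middle factor C in P = \<Phi> C \<Phi>^T, obtained by moving the norms of the
  community vectors into B. The value 0 outside the range makes symmetry hold for all
  indices.\<close>

definition block_core :: "real mat \<Rightarrow> real mat \<Rightarrow> real vec \<Rightarrow> nat \<Rightarrow> nat \<Rightarrow> real" where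
  "block_core \<Theta> B \<psi> k l = (if k < dim_col \<Theta> \<and> l < dim_col \<Theta>
     then block_norm \<Theta> \<psi> k * B $$ (k, l) * block_norm \<Theta> \<psi> l else 0)"

text \<open>The square root of the sum of n_k^2 \<nu>_k, written over nodes: n_k^2 cancels the
  normalisation in \<nu>_k.\<close>

definition degree_heterogeneity :: "real mat \<Rightarrow> real vec \<Rightarrow> real" where
  "degree_heterogeneity \<Theta> \<psi> = sqrt (\<Sum>i<dim_row \<Theta>. 1 / (psi_tilde \<Theta> \<psi> i)\<^sup>2)"

context
  fixes n K :: nat and \<Theta> B :: "real mat" and \<psi> :: "real vec"
  assumes dcbm: "dcbm n K \<Theta> B \<psi>"
begin

lemma \<Theta>_mem: "\<Theta> \<in> membership_mats n K" and \<Theta>_dim: "dim_row \<Theta> = n" "dim_col \<Theta> = K"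
  and B_mem: "B \<in> carrier_mat K K" and \<psi>_mem: "\<psi> \<in> carrier_vec n"
  using dcbm by (auto simp: dcbm_def membership_mats_def)

lemma label_less: "i < n \<Longrightarrow> label \<Theta> i < K"
  by (rule membership_label(1)[OF \<Theta>_mem])

lemma K_pos: "K > 0"
  using label_less[of 0] dcbm by (auto simp: dcbm_def)

lemma B_sym: "k < K \<Longrightarrow> l < K \<Longrightarrow> B $$ (k, l) = B $$ (l, k)"
  using dcbm B_mem by (metis carrier_matD dcbm_def index_transpose_mat(1))

lemma block_norm_power2: "(block_norm \<Theta> \<psi> k)\<^sup>2 = (\<Sum>i\<in>{i \<in> {..<n}. label \<Theta> i = k}. (\<psi> $ i)\<^sup>2)"
proof -
  have "(block_norm \<Theta> \<psi> k)\<^sup>2 = (\<Sum>i<n. (if label \<Theta> i = k then \<psi> $ i else 0)\<^sup>2)"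
    using \<psi>_mem unfolding block_norm_def vec_norm2_def L2_set_power2 community_part_def
    by (intro sum.cong) (auto simp: community_eq[OF \<Theta>_mem])
  also have "\<dots> = (\<Sum>i<n. if label \<Theta> i = k then (\<psi> $ i)\<^sup>2 else 0)"
    by (intro sum.cong) auto
  also have "\<dots> = (\<Sum>i\<in>{i \<in> {..<n}. label \<Theta> i = k}. (\<psi> $ i)\<^sup>2)"
    by (rule sum.inter_filter[symmetric]) simp
  finally show ?thesis .
qed

lemma block_norm_pos: "k < K \<Longrightarrow> block_norm \<Theta> \<psi> k > 0"
proof -
  assume "k < K"
  then have "community \<Theta> k \<noteq> {}" using dcbm by (simp add: dcbm_def)
  then have "(block_norm \<Theta> \<psi> k)\<^sup>2 > 0"
    unfolding block_norm_power2 community_eq[OF \<Theta>_mem]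
    by (intro sum_pos) (use dcbm in \<open>auto simp: dcbm_def\<close>)
  then show ?thesis
    by (simp add: block_norm_def vec_norm2_def order_less_le)
qed

lemma psi_tilde_eq: "psi_tilde \<Theta> \<psi> i = \<psi> $ i / block_norm \<Theta> \<psi> (label \<Theta> i)"
  by (simp add: psi_tilde_def block_norm_def)

lemma psi_tilde_pos: "i < n \<Longrightarrow> psi_tilde \<Theta> \<psi> i > 0"
  using dcbm block_norm_pos[OF label_less] by (simp add: psi_tilde_eq dcbm_def)

lemma psi_tilde_unit:
  assumes "k < K"
  shows "(\<Sum>i\<in>{i \<in> {..<n}. label \<Theta> i = k}. (psi_tilde \<Theta> \<psi> i)\<^sup>2) = 1"
proof -
  have "(\<Sum>i\<in>{i \<in> {..<n}. label \<Theta> i = k}. (psi_tilde \<Theta> \<psi> i)\<^sup>2)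
     = (\<Sum>i\<in>{i \<in> {..<n}. label \<Theta> i = k}. (\<psi> $ i)\<^sup>2 / (block_norm \<Theta> \<psi> k)\<^sup>2)"
    by (intro sum.cong) (auto simp: psi_tilde_eq power_divide)
  also have "\<dots> = 1"
    unfolding sum_divide_distrib[symmetric] block_norm_power2[symmetric]
    using block_norm_pos[OF assms] by simp
  finally show ?thesis .
qed

lemma mean_index:
  assumes "i < n" "j < n"
  shows "dcbm_mean \<Theta> B \<psi> $$ (i, j)
    = psi_tilde \<Theta> \<psi> i * block_core \<Theta> B \<psi> (label \<Theta> i) (label \<Theta> j) * psi_tilde \<Theta> \<psi> j"
  using assms block_norm_pos[OF label_less] label_less
  by (simp add: dcbm_mean_index(2)[OF \<Theta>_mem B_mem \<psi>_mem] psi_tilde_eq block_core_def \<Theta>_dim less_imp_neq[symmetric])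

lemma block_core_sym: "block_core \<Theta> B \<psi> k l = block_core \<Theta> B \<psi> l k"
  using B_sym by (auto simp: block_core_def \<Theta>_dim mult_ac)

lemma degree_heterogeneity_eq:
  "degree_heterogeneity \<Theta> \<psi> = sqrt (\<Sum>k<K. (real (card (community \<Theta> k)))\<^sup>2 * nu \<Theta> \<psi> k)"
proof -
  have "(\<Sum>k<K. (real (card (community \<Theta> k)))\<^sup>2 * nu \<Theta> \<psi> k)
      = (\<Sum>k<K. \<Sum>i\<in>{i \<in> {..<n}. label \<Theta> i = k}. 1 / (psi_tilde \<Theta> \<psi> i)\<^sup>2)"
  proof (rule sum.cong[OF refl])
    fix k assume "k \<in> {..<K}"
    then have "community \<Theta> k \<noteq> {}" using dcbm by (simp add: dcbm_def)
    then have "card (community \<Theta> k) \<noteq> 0" by (simp add: community_eq[OF \<Theta>_mem])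
    then show "(real (card (community \<Theta> k)))\<^sup>2 * nu \<Theta> \<psi> k
        = (\<Sum>i\<in>{i \<in> {..<n}. label \<Theta> i = k}. 1 / (psi_tilde \<Theta> \<psi> i)\<^sup>2)"
      by (simp add: nu_def community_eq[OF \<Theta>_mem])
  qed
  also have "\<dots> = (\<Sum>i<n. 1 / (psi_tilde \<Theta> \<psi> i)\<^sup>2)"
    by (rule sum.group) (use label_less in auto)
  finally show ?thesis by (simp add: degree_heterogeneity_def \<Theta>_dim)
qed

lemma n_min_le_card: "k < K \<Longrightarrow> n_min \<Theta> \<le> card (community \<Theta> k)"
  unfolding n_min_def \<Theta>_dim by (intro Min_le) auto

text \<open>Cauchy-Schwarz in a single community, where the squares of \<open>psi_tilde\<close> sum
  to 1. It turns the smallness hypothesis of the theorem into a bound of the perturbation by the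
  gap.\<close>

lemma n_min_le_heterogeneity: "real (n_min \<Theta>) \<le> degree_heterogeneity \<Theta> \<psi>"
proof -
  let ?G = "{i \<in> {..<n}. label \<Theta> i = 0}"
  have "real (card ?G) = (\<Sum>i\<in>?G. psi_tilde \<Theta> \<psi> i * (1 / psi_tilde \<Theta> \<psi> i))"
    using psi_tilde_pos by (simp add: less_imp_neq[symmetric])
  also have "\<dots> \<le> L2_set (psi_tilde \<Theta> \<psi>) ?G * L2_set (\<lambda>i. 1 / psi_tilde \<Theta> \<psi> i) ?G"
    using L2_set_inner_le[of "psi_tilde \<Theta> \<psi>" "\<lambda>i. 1 / psi_tilde \<Theta> \<psi> i" ?G] by linarith
  also have "L2_set (psi_tilde \<Theta> \<psi>) ?G = 1"
    unfolding L2_set_def psi_tilde_unit[OF K_pos] by simp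
  also have "1 * L2_set (\<lambda>i. 1 / psi_tilde \<Theta> \<psi> i) ?G \<le> degree_heterogeneity \<Theta> \<psi>"
    unfolding degree_heterogeneity_def L2_set_def \<Theta>_dim
    by (auto simp: power_one_over intro!: sum_mono2)
  finally show ?thesis
    using n_min_le_card[OF K_pos] by (simp add: community_eq[OF \<Theta>_mem])
qed

lemma degree_heterogeneity_pos: "degree_heterogeneity \<Theta> \<psi> > 0"
proof -
  have "1 / (psi_tilde \<Theta> \<psi> i)\<^sup>2 > 0" if "i \<in> {..<n}" for i
    using psi_tilde_pos[of i] that by simp
  then show ?thesis
    unfolding degree_heterogeneity_def \<Theta>_dim
    by (intro real_sqrt_gt_zero sum_pos) (use dcbm in \<open>auto simp: dcbm_def\<close>)
qed

text \<open>P acts on block vectors as C acts on their coefficients, so eigenvectors of the core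
  lift to eigenvectors of P.\<close>

lemma mean_lift:
  assumes i: "i < n"
  shows "(\<Sum>j<n. dcbm_mean \<Theta> B \<psi> $$ (i, j) * (psi_tilde \<Theta> \<psi> j * v (label \<Theta> j)))
    = psi_tilde \<Theta> \<psi> i * mat_app K (block_core \<Theta> B \<psi>) v (label \<Theta> i)"
proof -
  let ?c = "\<lambda>k. block_core \<Theta> B \<psi> (label \<Theta> i) k * v k"
  have "(\<Sum>j<n. dcbm_mean \<Theta> B \<psi> $$ (i, j) * (psi_tilde \<Theta> \<psi> j * v (label \<Theta> j)))
      = psi_tilde \<Theta> \<psi> i * (\<Sum>j<n. ?c (label \<Theta> j) * (psi_tilde \<Theta> \<psi> j)\<^sup>2)"
    unfolding sum_distrib_left using i by (intro sum.cong) (auto simp: mean_index power2_eq_square)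
  also have "(\<Sum>j<n. ?c (label \<Theta> j) * (psi_tilde \<Theta> \<psi> j)\<^sup>2)
      = (\<Sum>k<K. \<Sum>j\<in>{j \<in> {..<n}. label \<Theta> j = k}. ?c (label \<Theta> j) * (psi_tilde \<Theta> \<psi> j)\<^sup>2)"
    by (rule sum.group[symmetric]) (use label_less in auto)
  also have "\<dots> = (\<Sum>k<K. ?c k * (\<Sum>j\<in>{j \<in> {..<n}. label \<Theta> j = k}. (psi_tilde \<Theta> \<psi> j)\<^sup>2))"
    unfolding sum_distrib_left by (intro sum.cong refl) auto
  also have "\<dots> = mat_app K (block_core \<Theta> B \<psi>) v (label \<Theta> i)"
    unfolding mat_app_def using psi_tilde_unit by (intro sum.cong refl) simp
  finally show ?thesis .
qed

text \<open>The rank hypothesis excludes the eigenvalue 0 of the core; every other eigenvalue lifts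
  to a nonzero eigenvalue of P and is therefore at least \<gamma> in modulus.\<close>

lemma block_core_gap:
  assumes rank: "vec_space.rank n (dcbm_mean \<Theta> B \<psi>) = K"
    and \<gamma>: "0 < \<gamma>" "\<gamma> \<le> Min (abs ` (spectrum (dcbm_mean \<Theta> B \<psi>) - {0}))"
  shows "\<gamma> * L2_set x {..<K} \<le> L2_set (mat_app K (block_core \<Theta> B \<psi>) x) {..<K}"
proof (rule symmetric_eigenvalue_gap[OF block_core_sym])
  fix \<mu> v
  assume v: "\<exists>i<K. v i \<noteq> 0" and ev: "\<And>i. i < K \<Longrightarrow> mat_app K (block_core \<Theta> B \<psi>) v i = \<mu> * v i"
  let ?P = "dcbm_mean \<Theta> B \<psi>"
  have P: "?P \<in> carrier_mat n n" by (rule dcbm_mean_index(1)[OF \<Theta>_mem B_mem \<psi>_mem])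
  have "\<mu> \<noteq> 0"
  proof
    assume "\<mu> = 0"
    have "\<forall>k<K. v k = 0"
    proof (rule core_nonsingular_of_rank[OF P rank])
      show "?P $$ (i, j) = psi_tilde \<Theta> \<psi> i * (block_core \<Theta> B \<psi> (label \<Theta> i) (label \<Theta> j) * psi_tilde \<Theta> \<psi> j)"
        if "i < n" "j < n" for i j using mean_index[OF that] by simp
      show "(\<Sum>k<K. v k * (block_core \<Theta> B \<psi> k (label \<Theta> j) * psi_tilde \<Theta> \<psi> j)) = 0" if j: "j < n" for j
      proof -
        have "(\<Sum>k<K. v k * (block_core \<Theta> B \<psi> k (label \<Theta> j) * psi_tilde \<Theta> \<psi> j))
            = mat_app K (block_core \<Theta> B \<psi>) v (label \<Theta> j) * psi_tilde \<Theta> \<psi> j"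
          unfolding mat_app_def sum_distrib_right
          by (intro sum.cong refl) (subst block_core_sym, simp)
        then show ?thesis using ev[OF label_less[OF j]] \<open>\<mu> = 0\<close> by simp
      qed
    qed (rule label_less)
    then show False using v by blast
  qed
  define w where "w = vec n (\<lambda>j. psi_tilde \<Theta> \<psi> j * v (label \<Theta> j))"
  have "eigenvector ?P w \<mu>"
    unfolding eigenvector_def
  proof (intro conjI)
    show "w \<in> carrier_vec (dim_row ?P)" using P by (simp add: w_def)
    obtain k where k: "k < K" "v k \<noteq> 0" using v by blast
    then have "community \<Theta> k \<noteq> {}" using dcbm by (simp add: dcbm_def)
    then obtain j where j: "j < n" "label \<Theta> j = k" by (auto simp: community_eq[OF \<Theta>_mem])
    then have "w $ j \<noteq> 0" using k psi_tilde_pos[OF j(1)] by (simp add: w_def)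
    then show "w \<noteq> 0\<^sub>v (dim_row ?P)" using j P by auto
    show "?P *\<^sub>v w = \<mu> \<cdot>\<^sub>v w"
    proof (rule eq_vecI)
      fix i assume "i < dim_vec (\<mu> \<cdot>\<^sub>v w)"
      then have i: "i < n" by (simp add: w_def)
      have "(?P *\<^sub>v w) $ i = (\<Sum>j<n. ?P $$ (i, j) * (psi_tilde \<Theta> \<psi> j * v (label \<Theta> j)))"
        using i P by (simp add: scalar_prod_def w_def lessThan_atLeast0)
      also have "\<dots> = psi_tilde \<Theta> \<psi> i * (\<mu> * v (label \<Theta> i))"
        unfolding mean_lift[OF i] using ev[OF label_less[OF i]] by simp
      finally show "(?P *\<^sub>v w) $ i = (\<mu> \<cdot>\<^sub>v w) $ i" using i by (simp add: w_def)
    qed (use P in \<open>simp add: w_def\<close>)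
  qed
  then have "\<mu> \<in> spectrum ?P - {0}" using \<open>\<mu> \<noteq> 0\<close> by (auto simp: spectrum_def eigenvalue_def)
  then have "Min (abs ` (spectrum ?P - {0})) \<le> \<bar>\<mu>\<bar>"
    using card_finite_spectrum(1)[OF P] by (intro Min_le) auto
  then show "\<gamma> \<le> \<bar>\<mu>\<bar>" using \<gamma> by linarith
qed (use \<gamma> in simp)

text \<open>The true partition with the directions \<open>M_dir\<close> as centres competes in the
  k-median problem, so its cost controls that of the output. The bound \<open>few\<close> keeps any
  community from consisting of bad nodes only.\<close>

lemma misclustering_bound:
  fixes A :: "real mat"
  defines "\<beta> \<equiv> \<lambda>\<epsilon> s \<gamma>. 25 / 3 * (2.5 + \<epsilon>) * degree_heterogeneity \<Theta> \<psi> * sqrt (real K) * s / \<gamma>"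
  assumes gap: "\<And>x. \<gamma> * L2_set x {..<K} \<le> L2_set (mat_app K (block_core \<Theta> B \<psi>) x) {..<K}"
    and A: "A \<in> carrier_mat n n" and A_sym: "\<And>i j. i < n \<Longrightarrow> j < n \<Longrightarrow> A $$ (i, j) = A $$ (j, i)"
    and close: "\<And>x. L2_set (\<lambda>i. \<Sum>j<n. (A $$ (i, j) - dcbm_mean \<Theta> B \<psi> $$ (i, j)) * x j) {..<n} \<le> s * L2_set x {..<n}"
    and \<gamma>: "\<gamma> > 0" and s: "0 \<le> s" "s \<le> \<gamma> / 4" and \<epsilon>: "\<epsilon> > 0"
    and few: "\<beta> \<epsilon> s \<gamma> < real (n_min \<Theta>)"
    and sph: "spherical_k_median \<epsilon> K A \<Theta>'"
  shows "cluster_error \<Theta>' \<Theta> \<le> 2 * \<beta> \<epsilon> s \<gamma> / real n"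
proof -
  let ?g = "label \<Theta>" and ?w = "psi_tilde \<Theta> \<psi>" and ?h = "label \<Theta>'"
  have dA: "dim_row A = n" using A by simp
  obtain U T X where
      lead: "leading_eigenvectors A K U"
    and T: "T \<in> membership_mats (card {i. i < n \<and> vec_norm2 (row U i) > 0}) K"
    and X: "X \<in> carrier_mat K K"
    and med: "norm21 (T * X - normalize_rows (submatrix U {i. i < n \<and> vec_norm2 (row U i) > 0} {..<K}))
      \<le> (1 + \<epsilon>) * k_median_value K (normalize_rows (submatrix U {i. i < n \<and> vec_norm2 (row U i) > 0} {..<K}))"
    and \<Theta>': "\<Theta>' \<in> membership_mats n K"
    and sub: "submatrix \<Theta>' {i. i < n \<and> vec_norm2 (row U i) > 0} {..<K} = T"
    using sph unfolding spherical_k_median_def Let_def dA by blast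
  from lead obtain V0 lam where Kn: "K \<le> n" and V0: "V0 \<in> carrier_mat n n" "transpose_mat V0 * V0 = 1\<^sub>m n"
    and eig: "\<And>j. j < n \<Longrightarrow> eigenvector A (col V0 j) (lam j)"
    and lam: "\<And>j l. j < K \<Longrightarrow> K \<le> l \<Longrightarrow> l < n \<Longrightarrow> \<bar>lam l\<bar> \<le> \<bar>lam j\<bar>"
    and U: "U = mat n K (\<lambda>(i, j). V0 $$ (i, j))"
    unfolding leading_eigenvectors_def Let_def dA by blast
  define V where "V = (\<lambda>i j. V0 $$ (i, j))"
  \<comment> \<open>Cut off outside the range, since the locale requires symmetry for all
    indices.\<close>
  define A' where "A' = (\<lambda>i j. if i < n \<and> j < n then A $$ (i, j) else 0)"
  interpret perturbed_block_matrix n K ?g ?w "block_core \<Theta> B \<psi>" A' V lam \<gamma> s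
  proof
    show "A' i j = A' j i" for i j using A_sym by (auto simp: A'_def)
    show "L2_set (\<lambda>i. mat_app n A' x i - mat_app n (\<lambda>i j. ?w i * block_core \<Theta> B \<psi> (?g i) (?g j) * ?w j) x i) {..<n}
        \<le> s * L2_set x {..<n}" for x
    proof -
      have "L2_set (\<lambda>i. mat_app n A' x i - mat_app n (\<lambda>i j. ?w i * block_core \<Theta> B \<psi> (?g i) (?g j) * ?w j) x i) {..<n}
          = L2_set (\<lambda>i. \<Sum>j<n. (A $$ (i, j) - dcbm_mean \<Theta> B \<psi> $$ (i, j)) * x j) {..<n}"
        by (intro L2_set_cong refl)
          (auto simp: mat_app_def A'_def mean_index left_diff_distrib sum_subtractf[symmetric] intro!: sum.cong)
      then show ?thesis using close by simp
    qed
    show "(\<Sum>i<n. V i j * V i l) = of_bool (j = l)" if "j < n" "l < n" for j l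
    proof -
      have "(\<Sum>i<n. V i j * V i l) = (transpose_mat V0 * V0) $$ (j, l)"
        using V0(1) that by (simp add: V_def scalar_prod_def lessThan_atLeast0)
      then show ?thesis using that by (simp add: V0(2))
    qed
    \<comment> \<open>Orthonormal columns of a square matrix force orthonormal rows.\<close>
    have VV: "V0 * transpose_mat V0 = 1\<^sub>m n"
      using mat_mult_left_right_inverse[OF _ V0(1) V0(2)] V0(1) by simp
    show "(\<Sum>j<n. V i j * V l j) = of_bool (i = l)" if "i < n" "l < n" for i l
    proof -
      have "(\<Sum>j<n. V i j * V l j) = (V0 * transpose_mat V0) $$ (i, l)"
        using V0(1) that by (simp add: V_def scalar_prod_def lessThan_atLeast0)
      then show ?thesis using that by (simp add: VV)
    qed
    show "mat_app n A' (\<lambda>i. V i j) i = lam j * V i j" if "i < n" "j < n" for i j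
    proof -
      have "A *\<^sub>v col V0 j = lam j \<cdot>\<^sub>v col V0 j" using eig[OF that(2)] by (simp add: eigenvector_def)
      then have "(A *\<^sub>v col V0 j) $ i = (lam j \<cdot>\<^sub>v col V0 j) $ i" by simp
      then show ?thesis
        using that V0(1) A by (simp add: mat_app_def A'_def V_def scalar_prod_def lessThan_atLeast0)
    qed
  qed (use label_less psi_tilde_unit gap \<gamma> s Kn lam in auto)
  define N where "N = (\<lambda>i. L2_set (V i) {..<K})"
  define I where "I = {i \<in> {..<n}. N i > 0}"
  have rowN: "vec_norm2 (row U i) = N i" if "i < n" for i
    using that by (auto simp: vec_norm2_def N_def U V_def intro!: L2_set_cong)
  have I_eq: "{i. i < n \<and> vec_norm2 (row U i) > 0} = I" using rowN by (auto simp: I_def)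
  note T = T[unfolded I_eq] and med = med[unfolded I_eq] and sub = sub[unfolded I_eq]
  have I: "I \<subseteq> {..<n}" "finite I" by (auto simp: I_def)
  have U_mem: "U \<in> carrier_mat n K" by (simp add: U)
  define Y where "Y = normalize_rows (submatrix U I {..<K})"
  note subU = submatrix_rows[OF U_mem I(1)]
  have pk: "pick I a < n" if "a < card I" for a
    using pick_in_set_le[OF that] I by auto
  have Y: "Y \<in> carrier_mat (card I) K" using subU(1) by (simp add: Y_def normalize_rows_def)
  have Yi: "Y $$ (a, l) = V (pick I a) l / N (pick I a)" if "a < card I" "l < K" for a l
  proof -
    have "vec_norm2 (row (submatrix U I {..<K}) a) = N (pick I a)"
      unfolding vec_norm2_def N_def using that subU pk[OF that(1)]
      by (intro L2_set_cong) (auto simp: U V_def)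
    then show ?thesis
      using that subU pk[OF that(1)] by (simp add: Y_def normalize_rows_def U V_def)
  qed
  have cost: "norm21 (T1 * X1 - Y) = (\<Sum>i\<in>I. L2_set (\<lambda>l. X1 $$ (t i, l) - V i l / N i) {..<K})"
    if T1: "T1 \<in> membership_mats (card I) K" and X1: "X1 \<in> carrier_mat K K"
      and t: "\<And>a. a < card I \<Longrightarrow> label T1 a = t (pick I a)" for T1 X1 t
  proof -
    have "norm21 (T1 * X1 - Y) = (\<Sum>a<card I. L2_set (\<lambda>l. X1 $$ (t (pick I a), l) - V (pick I a) l / N (pick I a)) {..<K})"
      unfolding norm21_membership[OF T1 X1 Y]
      by (intro sum.cong refl L2_set_cong) (auto simp: t Yi)
    also have "\<dots> = (\<Sum>i\<in>I. L2_set (\<lambda>l. X1 $$ (t i, l) - V i l / N i) {..<K})"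
      by (rule sum.reindex_bij_betw[OF pick_bij_betw[OF I(2)]])
    finally show ?thesis .
  qed
  have labT: "label T a = ?h (pick I a)" if a: "a < card I" for a
  proof -
    let ?k = "?h (pick I a)"
    have k: "?k < K" by (rule membership_label(1)[OF \<Theta>' pk[OF a]])
    have "T $$ (a, ?k) = \<Theta>' $$ (pick I a, ?k)"
      using submatrix_rows(2)[OF _ I(1) a k, of \<Theta>'] \<Theta>' sub by (auto simp: membership_mats_def)
    then have "of_bool (label T a = ?k) = (1 :: real)"
      using membership_label(2)[OF T a k] membership_label(2)[OF \<Theta>' pk[OF a] k] by simp
    then show ?thesis by (simp split: if_splits)
  qed
  \<comment> \<open>The competitor, indexed like the submatrix: row a belongs to node
    \<open>pick I a\<close> and carries its true community.\<close>
  define T0 where "T0 = (mat (card I) K (\<lambda>(a, k). of_bool (k = ?g (pick I a))) :: real mat)"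
  define X0 where "X0 = mat K K (\<lambda>(k, l). M_dir k l)"
  have T0: "T0 \<in> membership_mats (card I) K"
    unfolding membership_mats_def T0_def using label_less[OF pk] by auto
  have labT0: "label T0 a = ?g (pick I a)" if a: "a < card I" for a
  proof -
    have "T0 $$ (a, ?g (pick I a)) = 1" using a label_less[OF pk[OF a]] by (simp add: T0_def)
    then have "of_bool (label T0 a = ?g (pick I a)) = (1 :: real)"
      using membership_label(2)[OF T0 a label_less[OF pk[OF a]]] by simp
    then show ?thesis by (simp split: if_splits)
  qed
  have X0: "X0 \<in> carrier_mat K K" by (simp add: X0_def)
  have "(\<Sum>i\<in>I. L2_set (\<lambda>l. X $$ (?h i, l) - V i l / N i) {..<K}) = norm21 (T * X - Y)"
    using cost[OF T X labT] by simp
  also have "\<dots> \<le> (1 + \<epsilon>) * k_median_value K Y" using med by (simp add: Y_def)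
  also have "\<dots> \<le> (1 + \<epsilon>) * norm21 (T0 * X0 - Y)"
    using \<epsilon> Y T0 X0 by (intro mult_left_mono k_median_value_le) auto
  also have "norm21 (T0 * X0 - Y) = (\<Sum>i\<in>I. L2_set (\<lambda>l. X0 $$ (?g i, l) - V i l / N i) {..<K})"
    by (rule cost[OF T0 X0 labT0])
  also have "\<dots> = (\<Sum>i\<in>I. L2_set (\<lambda>l. M_dir (?g i) l - V i l / N i) {..<K})"
    using I label_less by (intro sum.cong refl L2_set_cong) (auto simp: X0_def)
  finally have median: "(\<Sum>i\<in>I. L2_set (\<lambda>l. X $$ (?h i, l) - V i l / N i) {..<K})
      \<le> (1 + \<epsilon>) * (\<Sum>i\<in>I. L2_set (\<lambda>l. M_dir (?g i) l - V i l / N i) {..<K})" .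
  obtain Bad where Bad: "Bad \<subseteq> {..<n}"
    "real (card Bad) \<le> 25 / 3 * (2.5 + \<epsilon>) * sqrt (\<Sum>i<n. 1 / (?w i)\<^sup>2) * sqrt (real K) * s / \<gamma>"
    "\<And>i j. i \<in> {..<n} - Bad \<Longrightarrow> j \<in> {..<n} - Bad \<Longrightarrow> ?g i \<noteq> ?g j \<Longrightarrow> ?h i \<noteq> ?h j"
    using spherical_median_misclustered[of \<epsilon> ?h "\<lambda>i l. X $$ (?h i, l)"] s(2) psi_tilde_pos \<epsilon> median
    unfolding I_def N_def by auto
  have card: "real (card Bad) \<le> \<beta> \<epsilon> s \<gamma>"
    using Bad(2) by (simp add: \<beta>_def degree_heterogeneity_def \<Theta>_dim)
  obtain p where p: "p permutes {..<K}" "\<And>i. i \<in> {..<n} - Bad \<Longrightarrow> p (?h i) = ?g i"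
  proof (rule exists_label_permutation[of "{..<n} - Bad" ?h K ?g])
    show "?h i < K" if "i \<in> {..<n} - Bad" for i using that membership_label(1)[OF \<Theta>'] by simp
    show "\<exists>i\<in>{..<n} - Bad. ?g i = k" if k: "k < K" for k
    proof (rule ccontr)
      assume "\<not> ?thesis"
      then have "community \<Theta> k \<subseteq> Bad" by (auto simp: community_eq[OF \<Theta>_mem])
      then have "card (community \<Theta> k) \<le> card Bad"
        using Bad(1) finite_subset by (intro card_mono) auto
      then show False using n_min_le_card[OF k] card few by linarith
    qed
  qed (use Bad(3) in auto)
  have "cluster_error \<Theta>' \<Theta> \<le> 2 * real (card Bad) / real n"
    by (rule cluster_error_le[OF \<Theta>_mem \<Theta>' p(1) Bad(1) p(2)])
  also have "\<dots> \<le> 2 * \<beta> \<epsilon> s \<gamma> / real n"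
    using card by (intro divide_right_mono) auto
  finally show ?thesis .
qed

end

section \<open>Concentration of the adjacency matrix\<close>

text \<open>The added 1 pays for the diagonal of the mean matrix.\<close>

definition spectral_const :: real where
  "spectral_const = sqrt (6 * skew_const * exp 4) + 1"

text \<open>A - P is the centered matrix minus the diagonal of P. The entries of that diagonal lie
  between 0 and \<alpha>, and \<alpha> \<le> sqrt (n \<alpha>) because \<alpha> \<le> 1 \<le>
  n.\<close>

lemma adjacency_concentration:
  fixes \<alpha> :: real
  assumes dcbm: "dcbm n K \<Theta> B \<psi>" and n: "n \<ge> 2"
    and \<alpha>: "Max (elements_mat (dcbm_mean \<Theta> B \<psi>)) \<le> \<alpha>" "ln (real n) / real n \<le> \<alpha>" "\<alpha> \<le> 1"
  defines "s \<equiv> spectral_const * sqrt (real n * \<alpha>)"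
  shows "measure_pmf.prob (dcbm_adjacency \<Theta> B \<psi>)
      {A. A \<in> carrier_mat n n \<and> (\<forall>i<n. \<forall>j<n. A $$ (i, j) = A $$ (j, i)) \<and>
        (\<forall>x. L2_set (\<lambda>i. \<Sum>j<n. (A $$ (i, j) - dcbm_mean \<Theta> B \<psi> $$ (i, j)) * x j) {..<n} \<le> s * L2_set x {..<n})}
    \<ge> 1 - 1 / real n"
    (is "measure_pmf.prob _ ?good \<ge> _")
proof -
  note mem = \<Theta>_mem[OF dcbm] \<Theta>_dim[OF dcbm] B_mem[OF dcbm] \<psi>_mem[OF dcbm]
  let ?P = "\<lambda>i j. dcbm_mean \<Theta> B \<psi> $$ (i, j)"
  define q where "q = (\<lambda>e. \<psi> $ fst e * \<psi> $ snd e * B $$ (label \<Theta> (fst e), label \<Theta> (snd e)))"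
  let ?X = "edge_matrix (\<lambda>e b. of_bool b - q e)"
  define F where "F = (\<lambda>E. mat n n (\<lambda>(i, j). if i < j then of_bool (E (i, j))
     else if j < i then of_bool (E (j, i)) else 0) :: real mat)"
  have law: "dcbm_adjacency \<Theta> B \<psi> = map_pmf F (edge_law n q)"
    unfolding dcbm_adjacency_def Let_def edge_law_def F_def q_def pairs_def
    by (simp add: mem(2) case_prod_unfold)
  have Pmem: "dcbm_mean \<Theta> B \<psi> \<in> carrier_mat n n"
    and Pij: "?P i j = \<psi> $ i * B $$ (label \<Theta> i, label \<Theta> j) * \<psi> $ j" if "i < n" "j < n" for i j
    using dcbm_mean_index[OF mem(1,4,5)] that by auto
  have P0: "0 \<le> ?P i j" if "i < n" "j < n" for i j
    using that dcbm label_less[OF dcbm that(1)] label_less[OF dcbm that(2)]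
    unfolding Pij[OF that] by (intro mult_nonneg_nonneg) (auto simp: dcbm_def intro: less_imp_le)
  have P_le: "?P i j \<le> \<alpha>" if "i < n" "j < n" for i j
  proof -
    have "?P i j \<le> Max (elements_mat (dcbm_mean \<Theta> B \<psi>))"
      by (rule Max_ge) (use elements_matI[OF dcbm_mean_index(1)[OF mem(1,4,5)] that] in \<open>auto simp: elements_mat_def\<close>)
    then show ?thesis using \<alpha>(1) by linarith
  qed
  have Psym: "?P i j = ?P j i" if "i < n" "j < n" for i j
    using that by (simp add: Pij mult_ac B_sym[OF dcbm label_less[OF dcbm that(1)] label_less[OF dcbm that(2)]])
  have q_eq: "q (i, j) = ?P i j" if "i < n" "j < n" for i j
    using that by (simp add: q_def Pij mult_ac)
  have n\<alpha>: "0 \<le> \<alpha>" "\<alpha> \<le> sqrt (real n * \<alpha>)"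
  proof -
    have "0 \<le> ln (real n) / real n" using n by simp
    then show a: "0 \<le> \<alpha>" using \<alpha>(2) by linarith
    have "\<alpha> * \<alpha> \<le> real n * \<alpha>" using a \<alpha>(3) n by (intro mult_right_mono) auto
    then show "\<alpha> \<le> sqrt (real n * \<alpha>)" by (intro real_le_rsqrt) (simp add: power2_eq_square)
  qed
  have "1 - 1 / real n \<le> measure_pmf.prob (edge_law n q)
      {E. \<forall>x. L2_set (mat_app n (?X E) x) {..<n} \<le> sqrt (6 * skew_const * exp 4) * sqrt (real n * \<alpha>) * L2_set x {..<n}}"
    by (rule centered_norm_bound[OF n \<alpha>(2,3)]) (auto simp: pairs_def q_eq P0 P_le)
  also have "\<dots> \<le> measure_pmf.prob (edge_law n q) (F -` ?good)"
  proof (rule measure_pmf.finite_measure_mono, clarify)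
    fix E assume E: "\<forall>x. L2_set (mat_app n (?X E) x) {..<n} \<le> sqrt (6 * skew_const * exp 4) * sqrt (real n * \<alpha>) * L2_set x {..<n}"
    have Fij: "F E $$ (i, j) = (if i < j then of_bool (E (i, j)) else if j < i then of_bool (E (j, i)) else 0)"
      if "i < n" "j < n" for i j using that by (simp add: F_def)
    have "L2_set (\<lambda>i. \<Sum>j<n. (F E $$ (i, j) - ?P i j) * x j) {..<n} \<le> s * L2_set x {..<n}" for x
    proof -
      have entry: "F E $$ (i, j) - ?P i j = ?X E i j - of_bool (i = j) * ?P i j" if "i < n" "j < n" for i j
        using that Psym[OF that] by (auto simp: Fij edge_matrix_def q_eq)
      have "L2_set (\<lambda>i. \<Sum>j<n. (F E $$ (i, j) - ?P i j) * x j) {..<n}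
          = L2_set (\<lambda>i. mat_app n (?X E) x i + - (?P i i * x i)) {..<n}"
      proof (rule L2_set_cong[OF refl])
        fix i assume "i \<in> {..<n}"
        then have i: "i < n" by simp
        have "(\<Sum>j<n. (F E $$ (i, j) - ?P i j) * x j) = (\<Sum>j<n. ?X E i j * x j - of_bool (i = j) * (?P i j * x j))"
          using i by (intro sum.cong refl) (simp add: entry left_diff_distrib mult.assoc)
        also have "\<dots> = mat_app n (?X E) x i - (\<Sum>j<n. of_bool (i = j) * (?P i j * x j))"
          by (simp only: sum_subtractf mat_app_def)
        also have "(\<Sum>j<n. of_bool (i = j) * (?P i j * x j)) = ?P i i * x i"
          using i by (intro sum_of_bool_eq_mult(1)) auto
        finally show "(\<Sum>j<n. (F E $$ (i, j) - ?P i j) * x j) = mat_app n (?X E) x i + - (?P i i * x i)" by simp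
      qed
      also have "\<dots> \<le> L2_set (mat_app n (?X E) x) {..<n} + L2_set (\<lambda>i. - (?P i i * x i)) {..<n}"
        by (rule L2_set_triangle_ineq)
      also have "L2_set (\<lambda>i. - (?P i i * x i)) {..<n} \<le> L2_set (\<lambda>i. \<alpha> * x i) {..<n}"
        unfolding L2_set_def
        by (intro real_sqrt_le_mono sum_mono)
          (use P0 P_le in \<open>auto simp: power_mult_distrib intro!: mult_right_mono power_mono\<close>)
      also have "L2_set (\<lambda>i. \<alpha> * x i) {..<n} = \<alpha> * L2_set x {..<n}"
        using n\<alpha>(1) by (simp add: L2_set_scale)
      also have "\<dots> \<le> sqrt (real n * \<alpha>) * L2_set x {..<n}"
        using n\<alpha>(2) by (intro mult_right_mono) auto
      finally have "L2_set (\<lambda>i. \<Sum>j<n. (F E $$ (i, j) - ?P i j) * x j) {..<n}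
          \<le> L2_set (mat_app n (?X E) x) {..<n} + sqrt (real n * \<alpha>) * L2_set x {..<n}" by simp
      also have "\<dots> \<le> sqrt (6 * skew_const * exp 4) * sqrt (real n * \<alpha>) * L2_set x {..<n}
          + sqrt (real n * \<alpha>) * L2_set x {..<n}"
        by (rule add_right_mono) (use E in blast)
      also have "\<dots> = s * L2_set x {..<n}"
        by (simp only: s_def spectral_const_def distrib_right mult_1)
      finally show ?thesis .
    qed
    moreover have "F E \<in> carrier_mat n n" by (simp add: F_def)
    moreover have "F E $$ (i, j) = F E $$ (j, i)" if "i < n" "j < n" for i j
      using that by (simp add: Fij)
    ultimately show "E \<in> F -` ?good" by blast
  qed simp
  finally show ?thesis by (simp add: law measure_map_pmf)
qed

theorem theorem4p2:
  "\<exists>c>0::real.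
     \<forall>(n::nat) (K::nat) (\<Theta>::real mat) (B::real mat) (\<psi>::real vec)
      (\<gamma>::real) (\<alpha>::real) (\<epsilon>::real).
       let P = dcbm_mean \<Theta> B \<psi>;
           S = sqrt (\<Sum>k<K. (real (card (community \<Theta> k)))\<^sup>2 * nu \<Theta> \<psi> k)
       in
       dcbm n K \<Theta> B \<psi> \<longrightarrow>
       vec_space.rank n P = K \<longrightarrow>
       0 < \<gamma> \<longrightarrow> \<gamma> \<le> Min (abs ` (spectrum P - {0})) \<longrightarrow>
       Max (elements_mat P) \<le> \<alpha> \<longrightarrow> ln (real n) / real n \<le> \<alpha> \<longrightarrow>
       0 < \<epsilon> \<longrightarrow>
       (2.5 + \<epsilon>) * sqrt (real K * real n * \<alpha>) / \<gamma> < c * (real (n_min \<Theta>) / S) \<longrightarrow>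
       measure_pmf.prob (dcbm_adjacency \<Theta> B \<psi>)
         {A. \<forall>\<Theta>'. spherical_k_median \<epsilon> K A \<Theta>' \<longrightarrow>
               cluster_error \<Theta>' \<Theta>
                 \<le> (1 / c) * (2.5 + \<epsilon>) * S * (sqrt (real K * \<alpha>) / (\<gamma> * sqrt (real n)))}
         \<ge> 1 - 1 / real n"
proof -
  define C1 where "C1 = spectral_const"
  have C1: "C1 \<ge> 1" by (simp add: C1_def spectral_const_def skew_const_def)
  \<comment> \<open>The bound needs 2 * 25/3 = 50/3 \<le> 17: two wrong entries per bad node, with
    25/3 from the count of bad nodes.\<close>
  define c where "c = 1 / (17 * C1)"
  have c: "c > 0" "1 / c = 17 * C1" using C1 by (auto simp: c_def)
  show ?thesis
    unfolding Let_def
  proof (rule exI[of _ c], intro conjI allI impI)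
    show "c > 0" by (rule c)
    fix n K :: nat and \<Theta> B :: "real mat" and \<psi> :: "real vec" and \<gamma> \<alpha> \<epsilon> :: real
    assume dcbm: "dcbm n K \<Theta> B \<psi>" and rank: "vec_space.rank n (dcbm_mean \<Theta> B \<psi>) = K"
      and \<gamma>: "0 < \<gamma>" "\<gamma> \<le> Min (abs ` (spectrum (dcbm_mean \<Theta> B \<psi>) - {0}))"
      and \<alpha>: "Max (elements_mat (dcbm_mean \<Theta> B \<psi>)) \<le> \<alpha>" "ln (real n) / real n \<le> \<alpha>"
      and \<epsilon>: "0 < \<epsilon>"
      and small: "(2.5 + \<epsilon>) * sqrt (real K * real n * \<alpha>) / \<gamma>
        < c * (real (n_min \<Theta>) / sqrt (\<Sum>k<K. (real (card (community \<Theta> k)))\<^sup>2 * nu \<Theta> \<psi> k))"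
    define S where "S = degree_heterogeneity \<Theta> \<psi>"
    have S_eq: "sqrt (\<Sum>k<K. (real (card (community \<Theta> k)))\<^sup>2 * nu \<Theta> \<psi> k) = S"
      by (simp add: S_def degree_heterogeneity_eq[OF dcbm])
    note small = small[unfolded S_eq]
    have S: "S > 0" "real (n_min \<Theta>) \<le> S"
      using degree_heterogeneity_pos[OF dcbm] n_min_le_heterogeneity[OF dcbm] by (auto simp: S_def)
    have n0: "n > 0" using dcbm by (simp add: dcbm_def)
    have K1: "real K \<ge> 1" using K_pos[OF dcbm] by simp
    let ?bound = "(1 / c) * (2.5 + \<epsilon>) * S * (sqrt (real K * \<alpha>) / (\<gamma> * sqrt (real n)))"
    show "1 - 1 / real n \<le> measure_pmf.prob (dcbm_adjacency \<Theta> B \<psi>)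
        {A. \<forall>\<Theta>'. spherical_k_median \<epsilon> K A \<Theta>' \<longrightarrow> cluster_error \<Theta>' \<Theta>
          \<le> (1 / c) * (2.5 + \<epsilon>) * sqrt (\<Sum>k<K. (real (card (community \<Theta> k)))\<^sup>2 * nu \<Theta> \<psi> k) * (sqrt (real K * \<alpha>) / (\<gamma> * sqrt (real n)))}"
      unfolding S_eq
    proof (cases "n \<ge> 2")
      \<comment> \<open>For n = 1 the claimed probability is 0.\<close>
      case False
      then have "n = 1" using n0 by simp
      then show "1 - 1 / real n \<le> measure_pmf.prob (dcbm_adjacency \<Theta> B \<psi>)
        {A. \<forall>\<Theta>'. spherical_k_median \<epsilon> K A \<Theta>' \<longrightarrow> cluster_error \<Theta>' \<Theta> \<le> ?bound}" by simp
    next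
      case n: True
      \<comment> \<open>Concentration requires \<alpha> \<le> 1. Truncation is harmless because the
        entries of P and ln n / n are all at most 1.\<close>
      define a where "a = min \<alpha> 1"
      have lnn: "0 \<le> ln (real n) / real n" "ln (real n) / real n \<le> 1"
        using n ln_le_minus_one[of "real n"] by (auto simp: field_simps)
      have P1: "Max (elements_mat (dcbm_mean \<Theta> B \<psi>)) \<le> 1"
      proof (rule Max.boundedI)
        have P: "dcbm_mean \<Theta> B \<psi> \<in> carrier_mat n n"
          by (rule dcbm_mean_index(1)[OF \<Theta>_mem[OF dcbm] B_mem[OF dcbm] \<psi>_mem[OF dcbm]])
        show "finite (elements_mat (dcbm_mean \<Theta> B \<psi>))" by (simp add: elements_mat_def)
        show "elements_mat (dcbm_mean \<Theta> B \<psi>) \<noteq> {}" using elements_matI[OF P n0 n0 refl] by blast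
        fix y assume "y \<in> elements_mat (dcbm_mean \<Theta> B \<psi>)"
        then obtain i j where ij: "i < n" "j < n" "y = dcbm_mean \<Theta> B \<psi> $$ (i, j)" using P by auto
        have b: "0 \<le> B $$ (label \<Theta> i, label \<Theta> j)" "B $$ (label \<Theta> i, label \<Theta> j) \<le> 1"
          using dcbm label_less[OF dcbm ij(1)] label_less[OF dcbm ij(2)] by (auto simp: dcbm_def)
        have p: "0 \<le> \<psi> $ i" "\<psi> $ i \<le> 1" "0 \<le> \<psi> $ j" "\<psi> $ j \<le> 1"
          using dcbm ij by (auto simp: dcbm_def intro: less_imp_le)
        show "y \<le> 1"
          unfolding ij(3) dcbm_mean_index(2)[OF \<Theta>_mem[OF dcbm] B_mem[OF dcbm] \<psi>_mem[OF dcbm] ij(1,2)]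
          by (intro mult_le_one mult_nonneg_nonneg b p)
      qed
      have \<alpha>0: "\<alpha> \<ge> 0" and a: "0 \<le> a" "a \<le> \<alpha>" "a \<le> 1"
        using \<alpha> lnn by (auto simp: a_def)
      define s where "s = spectral_const * sqrt (real n * a)"
      define s' where "s' = C1 * sqrt (real n * \<alpha>)"
      have ss: "0 \<le> s" "s \<le> s'"
        unfolding s_def s'_def C1_def[symmetric] using C1 a
        by (auto intro!: mult_left_mono)
      define R where "R = (2.5 + \<epsilon>) * sqrt (real K * real n * \<alpha>) / \<gamma>"
      have R: "R < c * (real (n_min \<Theta>) / S)" using small by (simp add: R_def)
      have Ks': "(2.5 + \<epsilon>) * sqrt (real K) * s' / \<gamma> = C1 * R"
        by (simp add: R_def s'_def real_sqrt_mult)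
      \<comment> \<open>Since K \<ge> 1 and \<open>n_min\<close> \<le> S, the smallness hypothesis
        yields 2.5 s' / \<gamma> \<le> 1/17, well below what s \<le> \<gamma> / 4 requires.\<close>
      have "2.5 * 1 \<le> (2.5 + \<epsilon>) * sqrt (real K)"
        using \<epsilon> K1 by (intro mult_mono) auto
      then have "2.5 * s' / \<gamma> \<le> (2.5 + \<epsilon>) * sqrt (real K) * s' / \<gamma>"
        using ss \<gamma> by (intro divide_right_mono mult_right_mono) auto
      also have "\<dots> \<le> C1 * (c * (real (n_min \<Theta>) / S))"
        unfolding Ks' using R C1 by (intro mult_left_mono) auto
      also have "\<dots> \<le> C1 * (c * 1)"
        using S C1 c by (intro mult_left_mono) auto
      also have "\<dots> = 1 / 17" using C1 by (simp add: c_def)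
      finally have s4: "s \<le> \<gamma> / 4" using ss \<gamma> by (simp add: field_simps)
      define \<beta> where "\<beta> = 25 / 3 * (2.5 + \<epsilon>) * S * sqrt (real K) * s / \<gamma>"
      have \<beta>: "\<beta> \<le> 25 / 3 * C1 * S * R"
      proof -
        have "\<beta> \<le> 25 / 3 * (2.5 + \<epsilon>) * S * sqrt (real K) * s' / \<gamma>"
          unfolding \<beta>_def using \<epsilon> S \<gamma> ss by (intro divide_right_mono mult_left_mono) auto
        also have "\<dots> = 25 / 3 * S * ((2.5 + \<epsilon>) * sqrt (real K) * s' / \<gamma>)" by simp
        also have "\<dots> = 25 / 3 * C1 * S * R" unfolding Ks' by simp
        finally show ?thesis .
      qed
      have few: "\<beta> < real (n_min \<Theta>)"
      proof -
        have "25 / 3 * C1 * S * R < 25 / 3 * C1 * S * (c * (real (n_min \<Theta>) / S))"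
          using R C1 S by (intro mult_strict_left_mono) auto
        \<comment> \<open>With c = 1 / (17 C1) the factor is 25 / (3 * 17) < 1, so fewer than
          \<open>n_min\<close> nodes are bad.\<close>
        also have "\<dots> = 25 / 51 * real (n_min \<Theta>)" using C1 S by (simp add: c_def)
        finally show ?thesis using \<beta> by linarith
      qed
      have fin: "2 * \<beta> / real n \<le> ?bound"
      proof -
        have R0: "R \<ge> 0" using \<epsilon> \<gamma> \<alpha>0 by (simp add: R_def)
        have Rn: "R / real n = (2.5 + \<epsilon>) * (sqrt (real K * \<alpha>) / (\<gamma> * sqrt (real n)))"
        proof -
          define r where "r = sqrt (real n)"
          have r: "r > 0" "real n = r * r" using n0 by (simp_all add: r_def)
          have "R = (2.5 + \<epsilon>) * (sqrt (real K * \<alpha>) * r) / \<gamma>"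
            by (simp add: R_def r_def real_sqrt_mult mult_ac)
          then have "R / (r * r) = (2.5 + \<epsilon>) * (sqrt (real K * \<alpha>) / (\<gamma> * r))"
            using r(1) by simp
          then show ?thesis by (simp only: r_def[symmetric] r(2)[symmetric])
        qed
        have "2 * \<beta> / real n \<le> 17 * C1 * S * R / real n"
          using \<beta> mult_nonneg_nonneg[OF mult_nonneg_nonneg[of C1 S] R0] C1 S by (intro divide_right_mono) auto
        also have "\<dots> = 17 * C1 * S * (R / real n)" by simp
        also have "\<dots> = ?bound" unfolding Rn c(2) by simp
        finally show ?thesis .
      qed
      have "1 - 1 / real n \<le> measure_pmf.prob (dcbm_adjacency \<Theta> B \<psi>)
        {A. A \<in> carrier_mat n n \<and> (\<forall>i<n. \<forall>j<n. A $$ (i, j) = A $$ (j, i)) \<and>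
          (\<forall>x. L2_set (\<lambda>i. \<Sum>j<n. (A $$ (i, j) - dcbm_mean \<Theta> B \<psi> $$ (i, j)) * x j) {..<n} \<le> s * L2_set x {..<n})}"
        unfolding s_def by (rule adjacency_concentration[OF dcbm n]) (use \<alpha> P1 lnn in \<open>auto simp: a_def\<close>)
      also have "\<dots> \<le> measure_pmf.prob (dcbm_adjacency \<Theta> B \<psi>)
        {A. \<forall>\<Theta>'. spherical_k_median \<epsilon> K A \<Theta>' \<longrightarrow> cluster_error \<Theta>' \<Theta> \<le> ?bound}"
      proof (rule measure_pmf.finite_measure_mono, clarify)
        fix A \<Theta>'
        assume A: "A \<in> carrier_mat n n" "\<forall>i<n. \<forall>j<n. A $$ (i, j) = A $$ (j, i)"
          "\<forall>x. L2_set (\<lambda>i. \<Sum>j<n. (A $$ (i, j) - dcbm_mean \<Theta> B \<psi> $$ (i, j)) * x j) {..<n} \<le> s * L2_set x {..<n}"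
          and sph: "spherical_k_median \<epsilon> K A \<Theta>'"
        have "cluster_error \<Theta>' \<Theta> \<le> 2 * \<beta> / real n"
          unfolding \<beta>_def S_def
          by (rule misclustering_bound[OF dcbm block_core_gap[OF dcbm rank \<gamma>] A(1) _ _ \<gamma>(1) ss(1) s4 \<epsilon> _ sph])
            (use A few in \<open>auto simp: \<beta>_def S_def\<close>)
        then show "cluster_error \<Theta>' \<Theta> \<le> ?bound" using fin by linarith
      qed simp
      finally show "1 - 1 / real n \<le> measure_pmf.prob (dcbm_adjacency \<Theta> B \<psi>)
        {A. \<forall>\<Theta>'. spherical_k_median \<epsilon> K A \<Theta>' \<longrightarrow> cluster_error \<Theta>' \<Theta> \<le> ?bound}" .
    qed
  qed
qed

end
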